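(* For every fixed rational $\alpha > 0$ we have $$n_{\alpha, m} = \left(\tfrac{1}{2} + o_{\alpha}(1)\right)\left(e^{2\alpha} - 1\right)m^2,$$ where $o_\alpha(1)$ denotes a quantity which, for fixed $\alpha$, tends to $0$ as the positive integer $m$ tends to infinity.
   Context: For a positive rational $\alpha$ and a positive integer $n$, an $\alpha$-partition of $n$ is a finite set $\{a_1, \ldots, a_r\}$ of distinct positive integers with $a_1 + \cdots + a_r = n$ and $\frac{1}{a_1} + \cdots + \frac{1}{a_r} = \alpha$. For a positive integer $m$, such a partition is called $m$-large if all its elements are larger than or equal to $m$. The quantity $n_{\alpha, m}$ is the smallest positive integer such that for every integer $n \ge n_{\alpha,m}$ an $m$-large $\alpha$-partition of $n$ exists (it is known, by a theorem of Graham, that $n_{\alpha,m}$ exists for every positive rational $\alpha$ and every positive integer $m$). *)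

theory Defs
  imports Complex_Main
begin

definition is_partition :: "rat \<Rightarrow> nat \<Rightarrow> nat set \<Rightarrow> bool" where
  "is_partition \<alpha> n A \<longleftrightarrow>
     finite A \<and> (\<forall>a\<in>A. 0 < a) \<and> \<Sum>A = n \<and> (\<Sum>a\<in>A. 1 / of_nat a) = \<alpha>"

definition is_large :: "nat \<Rightarrow> nat set \<Rightarrow> bool" where
  "is_large m A \<longleftrightarrow> (\<forall>a\<in>A. m \<le> a)"

text \<open>
  For positive \<open>\<alpha>\<close> and \<open>m\<close>, a threshold as below exists by a theorem of Graham, so the
  least one is well defined. That theorem is not proved here.
\<close>

definition partition_threshold :: "rat \<Rightarrow> nat \<Rightarrow> nat" where
  "partition_threshold \<alpha> m =
     (LEAST N. 0 < N \<and> (\<forall>n\<ge>N. \<exists>A. is_partition \<alpha> n A \<and> is_large m A))"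

end

(*
  Lower bound.  If the elements of A are at least m and have reciprocal sum alpha, then, with
  X = m exp(alpha), the sum of A exceeds alpha X^2 by the sum of a - X^2/a over A, and this is
  smallest when A consists of all integers in [m, X].

  Upper bound.  It suffices to reach, for every large m, all n in a window of positive relative
  length just above (exp(2 alpha) - 1) m^2 / 2: larger n belong to the window of a larger m.
  Let z^(3d) <= m < (z+1)^(3d).  Take most of the integers in [m, (1+o(1)) exp(alpha) m] all of
  whose odd prime powers are at most z^(3d-4); by Chebyshev's estimates few integers are lost when
  d is large.  The missing reciprocal mass r, of order 1/z, is then supplied exactly.  For every odd
  prime power q, in decreasing order, add a few numbers q 2^i b with b <= z so that q no longer
  divides the denominator of r.  This is possible because reciprocals of distinct b <= z have
  subset sums in every residue class modulo every prime p <= z^(3d).  Between the large and the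
  small prime powers, adding products 2^i p1 p2 p3 with small primes brings r down to the order
  of 1/m; the last remainder has a power of two as denominator and is written in binary.  All these
  additions contribute only o(m^2) to the sum.

  Finally the sum is adjusted without changing the reciprocal sum: replacing 2k by 3k, 6k increases
  it by 7k (coarse steps), and replacing 6k, 8k, 12k by 3k, 24k increases it by k (fine steps, with
  pairs k, k + 2^i).
*)
theory Submission
  imports Defs "HOL-Number_Theory.Number_Theory" "HOL-Real_Asymp.Real_Asymp"
begin

section \<open>Sums of reciprocals modulo a prime\<close>

text \<open>What shapes the construction is that exactness competes with size. Cancelling the prime
  powers up to y takes up to y * z new elements of size at least about m. For these to carry little
  reciprocal mass and a sum o(m^2), y has to stay below m by a fixed power of z. Numbers with a
  larger odd prime power then have density O(1/d), a bound that does not improve with z, so d is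
  fixed in terms of the permitted error before z grows.

  This first round changes r by up to z^-3, far more than 1/m, whereas the last remainder must be
  below 1/m. The products of three primes bridge the gap: scaled to the size of m they have no odd
  prime power above z^d, and although their density is only guaranteed to be of order (1/log z)^3, a
  mass of order 1/z is all they have to supply. The remaining prime powers, at most z^d, are so few
  that their elements may be taken above z^(4d+3): the mass is then below 1/(4m) and the sum still
  O(m^2/z).

  The pieces must also be disjoint. Sizes separate some of them, others are told apart by the least
  common multiples they divide, and powers of two are reserved for the last remainder.\<close>

lemma binary_expansion:
  fixes x :: nat
  assumes "x < 2 ^ l"
  shows "\<exists>I\<subseteq>{..<l}. x = (\<Sum>i\<in>I. 2 ^ i)"
  using assms
proof (induction l arbitrary: x)
  case 0
  then show ?case by auto
next
  case (Suc l)
  show ?case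
  proof (cases "x < 2 ^ l")
    case True
    obtain I where "I \<subseteq> {..<l}" "x = (\<Sum>i\<in>I. 2 ^ i)" using Suc.IH[OF True] by blast
    then show ?thesis by (intro exI[of _ I]) auto
  next
    case False
    then have "x - 2 ^ l < 2 ^ l" using Suc.prems by simp
    then obtain I where I: "I \<subseteq> {..<l}" "x - 2 ^ l = (\<Sum>i\<in>I. 2 ^ i)" using Suc.IH by blast
    have "finite I" "l \<notin> I" using I(1) finite_subset by auto
    then have "x = (\<Sum>i\<in>insert l I. 2 ^ i)" using I(2) False by simp
    moreover have "insert l I \<subseteq> {..<Suc l}" using I(1) by auto
    ultimately show ?thesis by blast
  qed
qed

definition recip_sum :: "nat set \<Rightarrow> real" where
  "recip_sum A = (\<Sum>a\<in>A. 1 / real a)"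

text \<open>Digit i of x yields the denominator c * 2 ^ (K - i). Different odd c give disjoint sets,
  and the lower end \<open>K - l\<close> of the exponents is what later keeps the powers of two in
  \<open>denom_smooth_zero\<close> above m.\<close>

lemma binary_recip_sum:
  fixes x c :: nat
  assumes "x < 2 ^ l" "l \<le> K" "0 < c"
  shows "\<exists>E\<subseteq>(\<lambda>i. c * 2 ^ i) ` {K - l<..K}. real x / (real c * 2 ^ K) = recip_sum E"
proof -
  obtain I where I: "I \<subseteq> {..<l}" "x = (\<Sum>i\<in>I. 2 ^ i)" using binary_expansion[OF assms(1)] by blast
  define E where "E = (\<lambda>i. c * 2 ^ (K - i)) ` I"
  have inj: "inj_on (\<lambda>i. c * 2 ^ (K - i)) I"
    using I(1) assms(2,3) by (auto simp: inj_on_def)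
  have "recip_sum E = (\<Sum>i\<in>I. 1 / real (c * 2 ^ (K - i)))"
    unfolding recip_sum_def E_def using inj by (simp add: sum.reindex)
  also have "\<dots> = (\<Sum>i\<in>I. 2 ^ i / (real c * 2 ^ K))"
  proof (rule sum.cong)
    fix i assume "i \<in> I"
    then have "i \<le> K" using I(1) assms(2) by auto
    then have "(2::real) ^ K = 2 ^ (K - i) * 2 ^ i" by (simp flip: power_add)
    then show "1 / real (c * 2 ^ (K - i)) = 2 ^ i / (real c * 2 ^ K)" by (simp add: field_simps)
  qed simp
  also have "\<dots> = real x / (real c * 2 ^ K)" unfolding I(2) by (simp add: sum_divide_distrib)
  finally have "real x / (real c * 2 ^ K) = recip_sum E" by simp
  moreover have "E \<subseteq> (\<lambda>i. c * 2 ^ i) ` {K - l<..K}"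
  proof -
    have "K - i \<in> {K - l<..K}" if "i \<in> I" for i using that I(1) assms(2) by auto
    then show ?thesis unfolding E_def by blast
  qed
  ultimately show ?thesis by blast
qed

lemma partial_fractions:
  fixes N :: "'i \<Rightarrow> nat" and w :: int
  assumes "finite I" "\<And>i. i \<in> I \<Longrightarrow> 0 < N i"
    and "\<And>i j. i \<in> I \<Longrightarrow> j \<in> I \<Longrightarrow> i \<noteq> j \<Longrightarrow> coprime (N i) (N j)"
  shows "\<exists>(t::int) c. (\<forall>i\<in>I. c i < N i) \<and>
           real_of_int w / real (\<Prod>i\<in>I. N i) = of_int t + (\<Sum>i\<in>I. real (c i) / real (N i))"
  using assms
proof (induction I arbitrary: w rule: finite_induct)
  case empty
  show ?case by auto
next
  case (insert k I)
  define P where "P = (\<Prod>i\<in>I. N i)"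
  have cop: "coprime P (N k)" unfolding P_def
    using insert.prems(2) insert.hyps by (intro prod_coprime_left) auto
  have Nk: "0 < N k" using insert.prems by auto
  have Ppos: "0 < P" unfolding P_def using insert.prems by (intro prod_pos) auto
  obtain x where x: "[int P * x = 1] (mod int (N k))"
    using cop cong_solve_coprime_int[of "int P" "int (N k)"] by (auto simp: coprime_int_iff)
  \<comment> \<open>Modulo N k the decomposition w = c0 * P + a * N k leaves only c0 * P, so c0 has
    to be w divided by P there; x is the inverse of P.\<close>
  define c0 where "c0 = nat ((w * x) mod int (N k))"
  have c0: "c0 < N k" "int c0 = (w * x) mod int (N k)" unfolding c0_def using Nk
    by (simp_all add: nat_less_iff)
  have "[int c0 * int P = w * x * int P] (mod int (N k))" unfolding c0(2)
    by (intro cong_mult) auto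
  also have "[w * x * int P = w * 1] (mod int (N k))"
    using cong_mult[OF cong_refl[of w] x] by (simp add: mult_ac)
  finally have "[w = int c0 * int P] (mod int (N k))" by (simp add: cong_sym_eq)
  then obtain a where a: "w = int c0 * int P + a * int (N k)"
    by (metis cong_iff_lin cong_sym mult.commute)
  obtain t c where tc: "\<forall>i\<in>I. c i < N i"
    "real_of_int a / real P = of_int t + (\<Sum>i\<in>I. real (c i) / real (N i))"
    using insert.IH[of a] insert.prems unfolding P_def by auto
  have "real_of_int w / real (\<Prod>i\<in>insert k I. N i) = real_of_int w / (real (N k) * real P)"
    using insert.hyps unfolding P_def by simp
  also have "\<dots> = real c0 / real (N k) + real_of_int a / real P"
    unfolding a using Nk Ppos by (simp add: field_simps)
  also have "\<dots> = of_int t + (real c0 / real (N k) + (\<Sum>i\<in>I. real (c i) / real (N i)))"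
    using tc by simp
  also have "\<dots> = of_int t + (\<Sum>i\<in>insert k I. real ((c(k := c0)) i) / real (N i))"
  proof -
    have "(\<Sum>i\<in>I. real ((c(k := c0)) i) / real (N i)) = (\<Sum>i\<in>I. real (c i) / real (N i))"
      using insert.hyps by (intro sum.cong) auto
    then show ?thesis using insert.hyps by simp
  qed
  finally show ?case using tc(1) c0(1) by (intro exI[of _ t] exI[of _ "c(k := c0)"]) auto
qed

lemma recip_sum_Un:
  "finite A \<Longrightarrow> finite B \<Longrightarrow> A \<inter> B = {} \<Longrightarrow> recip_sum (A \<union> B) = recip_sum A + recip_sum B"
  unfolding recip_sum_def by (rule sum.union_disjoint)

lemma recip_sum_UNION:
  "finite I \<Longrightarrow> (\<And>i. i \<in> I \<Longrightarrow> finite (F i)) \<Longrightarrow> (\<And>i j. i \<in> I \<Longrightarrow> j \<in> I \<Longrightarrow> i \<noteq> j \<Longrightarrow> F i \<inter> F j = {})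
    \<Longrightarrow> recip_sum (\<Union>i\<in>I. F i) = (\<Sum>i\<in>I. recip_sum (F i))"
  unfolding recip_sum_def by (intro sum.UNION_disjoint) auto

lemma odd_times_power2_eq:
  fixes a b :: nat
  assumes "odd a" "odd b" "a * 2 ^ i = b * 2 ^ j"
  shows "a = b \<and> i = j"
proof (cases "i \<le> j")
  case True
  then have "a * 2 ^ i = b * 2 ^ (j - i) * 2 ^ i" using assms(3) by (simp add: mult.assoc flip: power_add)
  then have "a = b * 2 ^ (j - i)" by simp
  then show ?thesis using assms(1) True by (cases "j - i") auto
next
  case False
  then have "b * 2 ^ j = a * 2 ^ (i - j) * 2 ^ j" using assms(3) by (simp add: mult.assoc flip: power_add)
  then have "b = a * 2 ^ (i - j)" by simp
  then show ?thesis using assms(2) False by (cases "i - j") auto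
qed

text \<open>
  After a partial fraction expansion with terms \<open>c i / N i\<close>, write \<open>c i * 2 ^ s = x i * N i + y i\<close>:
  all \<open>x i\<close> and the integral part merge into one binary expansion, and the denominators
  \<open>N i * 2 ^ l\<close> coming from the \<open>y i\<close> are distinct because the \<open>N i\<close> are odd.
\<close>

lemma recip_sum_coprime_denominators:
  fixes N :: "'i \<Rightarrow> nat" and w :: nat
  assumes fin: "finite I"
    and odd: "\<And>i. i \<in> I \<Longrightarrow> odd (N i)" and gt: "\<And>i. i \<in> I \<Longrightarrow> 1 < N i"
    and cop: "\<And>i j. i \<in> I \<Longrightarrow> j \<in> I \<Longrightarrow> i \<noteq> j \<Longrightarrow> coprime (N i) (N j)"
    and s: "\<And>i. i \<in> I \<Longrightarrow> N i \<le> 2 ^ s"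
    and h: "2 * card I + 2 \<le> 2 ^ h"
    and w: "card I * (\<Prod>i\<in>I. N i) \<le> w" "w \<le> (card I + 1) * (\<Prod>i\<in>I. N i)"
  shows "\<exists>E. finite E \<and> (\<forall>b\<in>E. \<exists>l\<le>h + s. b = 2 ^ l \<or> (\<exists>i\<in>I. b = N i * 2 ^ l)) \<and>
     real w / (real (\<Prod>i\<in>I. N i) * 2 ^ h) = recip_sum E"
proof -
  define P where "P = (\<Prod>i\<in>I. N i)"
  have Npos: "0 < N i" if "i \<in> I" for i using gt[OF that] by simp
  have Ppos: "0 < P" unfolding P_def using Npos by (intro prod_pos) auto
  obtain t c where c: "\<And>i. i \<in> I \<Longrightarrow> c i < N i" and
    tc: "real w / real P = of_int t + (\<Sum>i\<in>I. real (c i) / real (N i))"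
    using partial_fractions[where N = N and w = "int w", OF fin Npos cop] unfolding P_def by auto
  have "(\<Sum>i\<in>I. real (c i) / real (N i)) \<le> (\<Sum>i\<in>I. 1)"
    using c Npos by (intro sum_mono) (auto simp: less_imp_le)
  then have sc: "(\<Sum>i\<in>I. real (c i) / real (N i)) \<le> card I" by simp
  have sc0: "0 \<le> (\<Sum>i\<in>I. real (c i) / real (N i))" by (intro sum_nonneg) auto
  have "real (card I) * P \<le> real w" using w(1) unfolding P_def by (simp only: of_nat_mult[symmetric] of_nat_le_iff)
  then have wl: "real (card I) \<le> real w / P" using Ppos by (simp add: field_simps)
  have "real w \<le> real (card I + 1) * P" using w(2) unfolding P_def by (simp only: of_nat_mult[symmetric] of_nat_le_iff)
  then have wu: "real w / P \<le> real (card I + 1)" using Ppos by (simp add: field_simps)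
  \<comment> \<open>The fractions sum to at most card I while w / P is at least card I. The lower
    bound on w serves exactly this: a negative integral part would have no binary expansion.\<close>
  have t0: "0 \<le> t" using tc sc wl by linarith
  have t1: "t \<le> int (card I + 1)" using tc sc0 wu by linarith
  define x where "x i = (c i * 2 ^ s) div N i" for i
  define y where "y i = (c i * 2 ^ s) mod N i" for i
  have x: "x i < 2 ^ s" if "i \<in> I" for i
    unfolding x_def using c[OF that] Npos[OF that] by (simp add: less_mult_imp_div_less)
  have y: "y i < 2 ^ s" if "i \<in> I" for i
    unfolding y_def using s[OF that] Npos[OF that] by (meson less_le_trans mod_less_divisor)
  have xy: "real (c i) / real (N i) = real (x i) / 2 ^ s + real (y i) / (real (N i) * 2 ^ s)" if "i \<in> I" for i
  proof -
    have "x i * N i + y i = c i * 2 ^ s" unfolding x_def y_def by (rule div_mult_mod_eq)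
    then have "real (x i * N i + y i) = real (c i * 2 ^ s)" by (simp only:)
    then have "real (c i) * 2 ^ s = real (x i) * real (N i) + real (y i)" by simp
    then show ?thesis using Npos[OF that] by (simp add: field_simps)
  qed
  \<comment> \<open>X may reach 2 * card I + 1 units of 2 ^ s, but each power of two can occur only
    once. Dividing by 2 ^ h brings the value below 1, so that one binary expansion holds all of
    it.\<close>
  define X where "X = nat t * 2 ^ s + (\<Sum>i\<in>I. x i)"
  have "(\<Sum>i\<in>I. x i) \<le> card I * 2 ^ s" using sum_bounded_above[of I x "2 ^ s"] x by (simp add: less_imp_le)
  moreover have "nat t * 2 ^ s \<le> (card I + 1) * 2 ^ s" using t1 by (intro mult_right_mono) auto
  ultimately have "X \<le> (2 * card I + 1) * 2 ^ s" unfolding X_def by (simp add: algebra_simps)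
  also have "\<dots> < (2 * card I + 2) * 2 ^ s" by simp
  also have "\<dots> \<le> 2 ^ h * 2 ^ s" using h by (intro mult_right_mono) auto
  finally have X: "X < 2 ^ (h + s)" by (simp add: power_add)
  obtain E0 where E0: "E0 \<subseteq> (\<lambda>i. 1 * 2 ^ i) ` {h + s - (h + s)<..h + s}"
    "real X / (real 1 * 2 ^ (h + s)) = recip_sum E0"
    using binary_recip_sum[OF X order.refl, of 1] by auto
  have "\<exists>E. E \<subseteq> (\<lambda>l. N i * 2 ^ l) ` {h + s - s<..h + s} \<and>
         real (y i) / (real (N i) * 2 ^ (h + s)) = recip_sum E" if "i \<in> I" for i
    using binary_recip_sum[OF y[OF that], of "h + s" "N i"] Npos[OF that] by auto
  then obtain F where F: "\<And>i. i \<in> I \<Longrightarrow> F i \<subseteq> (\<lambda>l. N i * 2 ^ l) ` {h + s - s<..h + s}"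
    "\<And>i. i \<in> I \<Longrightarrow> real (y i) / (real (N i) * 2 ^ (h + s)) = recip_sum (F i)"
    by metis
  have finF: "finite (F i)" if "i \<in> I" for i using F(1)[OF that] finite_subset by blast
  have finE0: "finite E0" using E0(1) finite_subset by blast
  have disF: "F i \<inter> F j = {}" if "i \<in> I" "j \<in> I" "i \<noteq> j" for i j
  proof -
    have "N i \<noteq> N j" using cop[OF that] gt[OF that(1)] by auto
    then show ?thesis using F(1)[OF that(1)] F(1)[OF that(2)] odd that odd_times_power2_eq by blast
  qed
  have dis0: "E0 \<inter> (\<Union>i\<in>I. F i) = {}"
  proof (rule ccontr)
    assume "\<not> ?thesis"
    then obtain b i where "b \<in> E0" "i \<in> I" "b \<in> F i" by blast
    then obtain l l' where "1 * 2 ^ l = N i * 2 ^ l'" using E0(1) F(1) by (metis (no_types, lifting) imageE subsetD)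
    then show False using odd_times_power2_eq[of 1 "N i"] odd[OF \<open>i \<in> I\<close>] gt[OF \<open>i \<in> I\<close>] by auto
  qed
  define E where "E = E0 \<union> (\<Union>i\<in>I. F i)"
  have "recip_sum E = recip_sum E0 + (\<Sum>i\<in>I. recip_sum (F i))"
    unfolding E_def using finE0 fin finF dis0 disF by (subst recip_sum_Un) (auto simp: recip_sum_UNION)
  also have "\<dots> = real X / 2 ^ (h + s) + (\<Sum>i\<in>I. real (y i) / (real (N i) * 2 ^ (h + s)))"
    using E0(2) F(2) by (simp cong: sum.cong)
  also have "\<dots> = (real X / 2 ^ s + (\<Sum>i\<in>I. real (y i) / (real (N i) * 2 ^ s))) / 2 ^ h"
    by (simp add: add_divide_distrib sum_divide_distrib power_add mult_ac)
  also have "real X / 2 ^ s = of_int t + (\<Sum>i\<in>I. real (x i) / 2 ^ s)"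
    unfolding X_def using t0 by (simp add: add_divide_distrib sum_divide_distrib)
  also have "of_int t + (\<Sum>i\<in>I. real (x i) / 2 ^ s) + (\<Sum>i\<in>I. real (y i) / (real (N i) * 2 ^ s)) = real w / P"
    using xy tc by (simp add: sum.distrib cong: sum.cong)
  finally have eq: "real w / (real P * 2 ^ h) = recip_sum E" by simp
  have "\<exists>l\<le>h + s. b = 2 ^ l \<or> (\<exists>i\<in>I. b = N i * 2 ^ l)" if "b \<in> E" for b
  proof -
    from that consider "b \<in> E0" | i where "i \<in> I" "b \<in> F i" unfolding E_def by blast
    then show ?thesis
    proof cases
      case 1
      then have "b \<in> (\<lambda>i. 1 * 2 ^ i) ` {h + s - (h + s)<..h + s}" using E0(1) by blast
      then show ?thesis by auto
    next
      case 2
      then have "b \<in> (\<lambda>l. N i * 2 ^ l) ` {h + s - s<..h + s}" using F(1) by blast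
      then show ?thesis using 2(1) by auto
    qed
  qed
  then show ?thesis using eq finE0 fin finF unfolding P_def[symmetric]
    by (intro exI[of _ E]) (auto simp: E_def)
qed

section \<open>Residue classes modulo a prime from reciprocals of small numbers\<close>

lemma pairwise_coprime_family:
  fixes n :: nat
  shows "\<exists>j (P :: nat \<Rightarrow> nat) M. (\<forall>i\<in>{1..j}. odd (P i) \<and> 1 < P i \<and> P i \<le> M) \<and>
     (\<forall>i\<in>{1..j}. \<forall>k\<in>{1..j}. i \<noteq> k \<longrightarrow> coprime (P i) (P k)) \<and> M ^ n \<le> (\<Prod>i\<in>{1..j}. P i) \<and> 1 < M"
proof -
  define j where "j = 2 * n + 1"
  \<comment> \<open>The numbers 1 + i * F are the moduli of Goedel's beta function: a common prime
    of two of them divides k - i, hence \<open>fact j\<close>, hence F, hence 1. The factor 2 makes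
    them odd. Each is at most F^2, while 2 * n + 1 of them have a product of at least F ^ (2 * n +
    1), which exceeds (F^2) ^ n.\<close>
  define F where "F = (2 * fact j :: nat)"
  define P where "P i = 1 + i * F" for i
  have F2: "2 \<le> F" unfolding F_def using fact_ge_1[of j, where 'a = nat] by linarith
  have j1: "1 \<le> j" unfolding j_def by simp
  have jF: "j \<le> fact j" by (rule fact_ge_self)
  have jF2: "1 + j * F \<le> F ^ 2"
  proof -
    have "F * 1 \<le> F * fact j" by (intro mult_left_mono) (auto simp: fact_ge_1)
    moreover have "F * j \<le> F * fact j" using jF by (intro mult_left_mono) auto
    moreover have "F * fact j + F * fact j = F ^ 2" unfolding F_def by (simp add: power2_eq_square)
    ultimately show ?thesis using F2 by (subst mult.commute) linarith
  qed
  have bound: "P i \<le> F ^ 2" if "i \<in> {1..j}" for i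
  proof -
    have "i * F \<le> j * F" using that by (intro mult_right_mono) auto
    then show ?thesis using jF2 unfolding P_def by linarith
  qed
  have cop: "coprime (P i) (P k)" if "i \<in> {1..j}" "k \<in> {1..j}" "i < k" for i k
  proof (rule ccontr)
    assume "\<not> coprime (P i) (P k)"
    then have "gcd (P i) (P k) \<noteq> 1" by (simp only: coprime_iff_gcd_eq_1 not_False_eq_True)
    then obtain q where q: "prime q" "q dvd gcd (P i) (P k)" using prime_factor_nat by blast
    then have "q dvd P i" "q dvd P k" by auto
    have "q dvd k * P i" "q dvd i * P k" using \<open>q dvd P i\<close> \<open>q dvd P k\<close> by auto
    moreover have "k * P i - i * P k = k - i" using that unfolding P_def by (simp add: algebra_simps)
    ultimately have "q dvd k - i" by (metis dvd_diff_nat)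
    then have "q \<le> j" using that by (metis atLeastAtMost_iff diff_le_self dvd_imp_le le_trans zero_less_diff)
    then have "q dvd fact j" using q(1) by (simp add: prime_dvd_fact_iff)
    then have "q dvd i * F" unfolding F_def by simp
    then have "q dvd 1" using \<open>q dvd P i\<close> unfolding P_def by (metis dvd_add_left_iff)
    then show False using q(1) by auto
  qed
  have "(F ^ 2) ^ n \<le> F ^ j" using F2 unfolding j_def by (simp flip: power_mult)
  also have "F ^ j = (\<Prod>i\<in>{1..j}. F)" by simp
  also have "\<dots> \<le> (\<Prod>i\<in>{1..j}. P i)"
  proof (rule prod_mono)
    fix i assume "i \<in> {1..j}"
    then have "1 * F \<le> i * F" by (intro mult_right_mono) auto
    then show "0 \<le> F \<and> F \<le> P i" unfolding P_def by linarith
  qed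
  finally have "(F ^ 2) ^ n \<le> (\<Prod>i\<in>{1..j}. P i)" .
  moreover have "odd (P i) \<and> 1 < P i" if "i \<in> {1..j}" for i
    using that F2 unfolding P_def F_def by auto
  moreover have "1 < F ^ 2" using F2 by (intro one_less_power) auto
  moreover have "coprime (P i) (P k)" if "i \<in> {1..j}" "k \<in> {1..j}" "i \<noteq> k" for i k
    using cop[OF that(1,2)] cop[OF that(2,1)] that(3) by (metis coprime_commute nat_neq_iff)
  ultimately show ?thesis using bound
    by (intro exI[of _ j] exI[of _ P] exI[of _ "F ^ 2"] conjI ballI impI) simp_all
qed

text \<open>These are the cofactors b of the elements n * 2 ^ i * b that cancel a power n of p. The
  odd part of b has to divide the part of \<open>odd_lcm\<close> prime to p, which b < p ensures. A
  power of two is harmless even above p, and \<open>covers_small_prime\<close> uses one that exceeds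
  p.\<close>

definition admissible :: "nat \<Rightarrow> nat \<Rightarrow> nat \<Rightarrow> bool" where
  "admissible p B b \<longleftrightarrow> 0 < b \<and> b \<le> B \<and> \<not> p dvd b \<and> ((\<exists>l. b = 2 ^ l) \<or> b < p)"

text \<open>
  Stated with a common multiple \<open>W\<close> of the denominators, this says that the sums of
  reciprocals of admissible numbers meet every residue class modulo \<open>p\<close>.
\<close>

definition covers :: "nat \<Rightarrow> nat \<Rightarrow> bool" where
  "covers p B \<longleftrightarrow> (\<forall>(u::int) W. \<not> p dvd W \<longrightarrow> (\<forall>b. admissible p B b \<longrightarrow> b dvd W) \<longrightarrow>
     (\<exists>E. finite E \<and> (\<forall>b\<in>E. admissible p B b) \<and> [(\<Sum>b\<in>E. int (W div b)) = u] (mod int p)))"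

text \<open>Turns exact identities between rationals into congruences: numerators w from p
  consecutive integers, over a K prime to p, run through all residues modulo p, and multiplication
  by W clears the denominators.\<close>

lemma coversI:
  fixes K a :: nat
  assumes p: "prime p" and K: "\<not> p dvd K"
    and rep: "\<And>w. a \<le> w \<Longrightarrow> w < a + p \<Longrightarrow>
      \<exists>E. finite E \<and> (\<forall>b\<in>E. admissible p B b) \<and> real w / real K = recip_sum E"
  shows "covers p B"
  unfolding covers_def
proof (intro allI impI)
  fix u :: int and W
  assume W: "\<not> p dvd W" and dvdW: "\<forall>b. admissible p B b \<longrightarrow> b dvd W"
  have copW: "coprime (int W) (int p)" using p W by (metis coprime_commute coprime_int_iff prime_imp_coprime)
  have copK: "coprime (int K) (int p)" using p K by (metis coprime_commute coprime_int_iff prime_imp_coprime)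
  have p0: "0 < p" using p by (simp add: prime_gt_0_nat)
  have K0: "0 < K" using K by (cases K) auto
  obtain x where x: "[int W * x = 1] (mod int p)" using cong_solve_coprime_int[OF copW] by blast
  \<comment> \<open>The representative in [a, a + p) of u * K * x, where x inverts W; then w * W is
    congruent to K * u, and K can be cancelled.\<close>
  define w where "w = a + nat ((u * int K * x - int a) mod int p)"
  have nn: "0 \<le> (u * int K * x - int a) mod int p" "(u * int K * x - int a) mod int p < int p"
    using p0 by auto
  have w: "a \<le> w" "w < a + p" unfolding w_def using nn p0 by (auto simp: nat_less_iff)
  have "int w = int a + (u * int K * x - int a) mod int p" unfolding w_def using nn by simp
  also have "[\<dots> = int a + (u * int K * x - int a)] (mod int p)" by (intro cong_add cong_refl) (simp add: cong_def)
  also have "int a + (u * int K * x - int a) = u * int K * x" by simp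
  finally have "[int w = u * int K * x] (mod int p)" .
  then have "[int w * int W = u * int K * x * int W] (mod int p)" by (rule cong_scalar_right)
  also have "[u * int K * x * int W = u * int K * 1] (mod int p)"
    using cong_scalar_left[OF x, of "u * int K"] by (simp add: mult_ac)
  finally have ww: "[int w * int W = int K * u] (mod int p)" by (simp add: mult.commute)
  obtain E where E: "finite E" "\<forall>b\<in>E. admissible p B b" "real w / real K = recip_sum E"
    using rep[OF w] by blast
  have "real w * real W = real K * (\<Sum>b\<in>E. real (W div b))"
  proof -
    have "(\<Sum>b\<in>E. real (W div b)) = (\<Sum>b\<in>E. real W * (1 / real b))"
      using E(2) dvdW by (intro sum.cong) (auto simp: real_of_nat_div)
    also have "\<dots> = real W * recip_sum E" unfolding recip_sum_def by (simp add: sum_distrib_left)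
    also have "\<dots> = real W * (real w / real K)" using E(3) by (simp only:)
    finally show ?thesis using K0 by simp
  qed
  then have "real_of_int (int w * int W) = real_of_int (int K * (\<Sum>b\<in>E. int (W div b)))" by simp
  then have "int w * int W = int K * (\<Sum>b\<in>E. int (W div b))" by linarith
  then have "[int K * (\<Sum>b\<in>E. int (W div b)) = int K * u] (mod int p)" using ww by simp
  then have "[(\<Sum>b\<in>E. int (W div b)) = u] (mod int p)" using copK by (simp add: cong_mult_lcancel)
  then show "\<exists>E. finite E \<and> (\<forall>b\<in>E. admissible p B b) \<and> [(\<Sum>b\<in>E. int (W div b)) = u] (mod int p)"
    using E by blast
qed

lemma covers_small_prime:
  assumes p: "prime p" "odd p" "2 * p \<le> B"
  shows "covers p B"
proof -
  have "2 \<le> p" using p by (simp add: prime_ge_2_nat)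
  then obtain k where k: "2 ^ k \<le> p" "p < 2 ^ (k + 1)" using ex_power_ivl1[of 2 p] by auto
  have nd: "\<not> p dvd 2 ^ l" for l
  proof
    assume "p dvd 2 ^ l"
    then have "p dvd 2" using p(1) prime_dvd_power by blast
    then have "p \<le> 2" by (simp add: dvd_imp_le)
    then show False using \<open>2 \<le> p\<close> p(2) by simp
  qed
  show ?thesis
  proof (rule coversI[of p "2 ^ (k + 1)" 0])
    fix w assume "w < 0 + p"
    then have "w < 2 ^ (k + 1)" using k by simp
    from binary_recip_sum[OF this order.refl, of 1]
    obtain E where E: "E \<subseteq> (\<lambda>i. 2 ^ i) ` {0<..k + 1}" "real w / 2 ^ (k + 1) = recip_sum E" by auto
    have "admissible p B b" if "b \<in> E" for b
    proof -
      have "b \<in> (\<lambda>i. 2 ^ i) ` {0<..k + 1}" using E(1) that by blast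
      then obtain i where i: "b = 2 ^ i" "i \<le> k + 1" by auto
      have "(2::nat) ^ i \<le> 2 ^ (k + 1)" using i(2) by (intro power_increasing) auto
      then show ?thesis using i(1) k p(3) nd unfolding admissible_def by auto
    qed
    then show "\<exists>E. finite E \<and> (\<forall>b\<in>E. admissible p B b) \<and> real w / real (2 ^ (k + 1)) = recip_sum E"
      using E finite_subset[OF E(1)] by (intro exI[of _ E]) auto
  next
    show "\<not> p dvd 2 ^ (k + 1)" by (rule nd)
  qed (use p in auto)
qed

text \<open>Treating p consecutive numerators calls for a common denominator of at least p, possibly
  z ^ D, while every single denominator must stay below z. A product of coprime N i = P i ^ x
  reconciles the two: each N i is at most the square root of z, yet their number j, which depends
  only on D, makes the product at least z ^ D.\<close>

lemma eventually_covers: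
  fixes D :: nat
  shows "\<exists>z0. \<forall>z\<ge>z0. \<forall>p. prime p \<longrightarrow> odd p \<longrightarrow> p \<le> z ^ D \<longrightarrow> covers p z"
proof -
  obtain j M :: nat and P :: "nat \<Rightarrow> nat" where fam: "\<forall>i\<in>{1..j}. odd (P i) \<and> 1 < P i \<and> P i \<le> M"
    "\<forall>i\<in>{1..j}. \<forall>k\<in>{1..j}. i \<noteq> k \<longrightarrow> coprime (P i) (P k)"
    and big: "M ^ (4 * D) \<le> (\<Prod>i\<in>{1..j}. P i)" and M1: "1 < M"
    using pairwise_coprime_family[of "4 * D"] by (elim exE conjE) (rule that, assumption+)
  have P: "odd (P i)" "1 < P i" "P i \<le> M" if "i \<in> {1..j}" for i using fam(1) that by auto
  have cop: "coprime (P i) (P k)" if "i \<in> {1..j}" "k \<in> {1..j}" "i \<noteq> k" for i k using fam(2) that by auto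
  obtain h where h: "2 * j + 2 \<le> 2 ^ h" using less_exp[of "2 * j + 2"] by (meson less_imp_le)
  \<comment> \<open>C bounds the total loss in rounding z down to a multiple of 2 ^ (h + 2) and then
    to a power of M^2. It gives z < C * R, and z \<ge> C^2 turns this into z \<le> R^2.\<close>
  define C where "C = 2 ^ (h + 2) * M ^ 2"
  have C0: "0 < C" unfolding C_def using M1 by simp
  show ?thesis
  proof (intro exI[of _ "C ^ 2"] allI impI)
    fix z p :: nat assume z: "C ^ 2 \<le> z" and p: "prime p" "odd p" "p \<le> z ^ D"
    show "covers p z"
    proof (cases "2 * p \<le> z")
      case True
      then show ?thesis using covers_small_prime p by blast
    next
      case False
      have "C \<le> C ^ 2" using C0 by (simp add: power2_eq_square)
      then have zC: "C \<le> z" using z by simp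
      define v where "v = z div 2 ^ (h + 2)"
      have vM: "M ^ 2 \<le> v" unfolding v_def using zC unfolding C_def
        by (metis div_le_mono nonzero_mult_div_cancel_left power_not_zero zero_neq_numeral)
      have M2: "2 \<le> M ^ 2" using M1 by (metis Suc_1 Suc_leI one_less_power pos2)
      obtain x where x: "(M ^ 2) ^ x \<le> v" "v < (M ^ 2) ^ (x + 1)"
        using ex_power_ivl1[of "M ^ 2" v] M2 vM by auto
      have x1: "1 \<le> x" using x vM by (cases x) auto
      define R where "R = (M ^ 2) ^ x"
      have "z < 2 ^ (h + 2) * (v + 1)" unfolding v_def
        by (metis Suc_eq_plus1 dividend_less_times_div pos2 zero_less_power mult.commute mult_Suc_right add.commute)
      also have "\<dots> \<le> 2 ^ (h + 2) * (M ^ 2) ^ (x + 1)" using x by (intro mult_left_mono) auto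
      also have "\<dots> = C * R" unfolding C_def R_def by simp
      finally have "z * z \<le> (C * R) * (C * R)" by (intro mult_mono) auto
      also have "\<dots> = C ^ 2 * R ^ 2" by (simp add: power2_eq_square)
      also have "\<dots> \<le> z * R ^ 2" using z by (intro mult_right_mono) auto
      finally have zR: "z \<le> R ^ 2" using zC C0 by simp
      define N where "N i = P i ^ x" for i
      have Nge: "z ^ D \<le> (\<Prod>i\<in>{1..j}. N i)"
      proof -
        have "z ^ D \<le> (R ^ 2) ^ D" using zR by (rule power_mono) simp
        also have "\<dots> = (M ^ (4 * D)) ^ x" unfolding R_def by (simp add: mult_ac flip: power_mult)
        also have "\<dots> \<le> (\<Prod>i\<in>{1..j}. P i) ^ x" using big by (intro power_mono) auto
        finally show ?thesis unfolding N_def by (simp add: prod_power_distrib)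
      qed
      have NM: "N i \<le> M ^ x" if "i \<in> {1..j}" for i unfolding N_def using P(3)[OF that] by (intro power_mono) auto
      have N1: "1 < N i" if "i \<in> {1..j}" for i unfolding N_def using P(2)[OF that] x1 by (intro one_less_power) auto
      have "1 \<le> M ^ x" using M1 by simp
      then obtain s0 where s0: "2 ^ s0 \<le> M ^ x" "M ^ x < 2 ^ (s0 + 1)" using ex_power_ivl1[of 2 "M ^ x"] by auto
      define s where "s = s0 + 1"
      have s: "M ^ x \<le> 2 ^ s" "2 ^ s \<le> 2 * M ^ x" unfolding s_def using s0 by auto
      \<comment> \<open>The denominators are at most M ^ x * 2 ^ (h + s), and 2 ^ s \<le> 2 * M ^ x.
        The extra factor 2 puts them at most at z / 2, which is below p in the present case, so p
        divides none of them.\<close>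
      have den: "2 * (M ^ x * 2 ^ (h + s)) \<le> z"
      proof -
        have "2 * (M ^ x * 2 ^ (h + s)) = 2 ^ (h + 1) * M ^ x * 2 ^ s" by (simp add: power_add)
        also have "\<dots> \<le> 2 ^ (h + 1) * M ^ x * (2 * M ^ x)" using s(2) by (intro mult_left_mono) auto
        also have "\<dots> = 2 ^ (h + 2) * (M ^ 2) ^ x" by (simp add: power2_eq_square power_mult_distrib)
        also have "\<dots> \<le> 2 ^ (h + 2) * v" using x by (intro mult_left_mono) auto
        also have "\<dots> \<le> z" unfolding v_def by simp
        finally show ?thesis .
      qed
      have denb: "M ^ x * 2 ^ l < p" "M ^ x * 2 ^ l \<le> z" if "l \<le> h + s" for l
      proof -
        have "M ^ x * 2 ^ l \<le> M ^ x * 2 ^ (h + s)" using that by (intro mult_left_mono power_increasing) auto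
        then show "M ^ x * 2 ^ l < p" "M ^ x * 2 ^ l \<le> z" using den False by linarith+
      qed
      have small: "admissible p z b" if "0 < b" "b \<le> M ^ x * 2 ^ l" "l \<le> h + s" for b l
        using that denb[OF that(3)] unfolding admissible_def by (auto dest: dvd_imp_le)
      define K where "K = (\<Prod>i\<in>{1..j}. N i) * 2 ^ h"
      have pK: "\<not> p dvd K"
      proof
        assume "p dvd K"
        then consider i where "i \<in> {1..j}" "p dvd N i" | "p dvd 2 ^ h"
          unfolding K_def using p(1) by (auto simp: prime_dvd_mult_iff prime_dvd_prod_iff)
        then show False
        proof cases
          case 1
          then have "p \<le> M ^ x" using NM N1 by (meson dvd_imp_le le_trans less_trans zero_less_one)
          then show False using denb(1)[of 0] by simp
        next
          case 2
          have "2 ^ h \<le> M ^ x * 2 ^ h" using M1 by simp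
          then have "2 ^ h < p" using denb(1)[of h] by linarith
          then show False using 2 by (auto dest: dvd_imp_le)
        qed
      qed
      show ?thesis
      proof (rule coversI[OF p(1) pK, of "j * (\<Prod>i\<in>{1..j}. N i)"])
        fix w assume w: "j * (\<Prod>i\<in>{1..j}. N i) \<le> w" "w < j * (\<Prod>i\<in>{1..j}. N i) + p"
        have "\<exists>E. finite E \<and> (\<forall>b\<in>E. \<exists>l\<le>h + s. b = 2 ^ l \<or> (\<exists>i\<in>{1..j}. b = N i * 2 ^ l)) \<and>
          real w / (real (\<Prod>i\<in>{1..j}. N i) * 2 ^ h) = recip_sum E"
        proof (rule recip_sum_coprime_denominators)
          show "odd (N i)" if "i \<in> {1..j}" for i using P(1)[OF that] unfolding N_def by simp
          show "coprime (N i) (N k)" if "i \<in> {1..j}" "k \<in> {1..j}" "i \<noteq> k" for i k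
            using cop[OF that] unfolding N_def by simp
          show "N i \<le> 2 ^ s" if "i \<in> {1..j}" for i using NM[OF that] s(1) by simp
          show "w \<le> (card {1..j} + 1) * (\<Prod>i\<in>{1..j}. N i)" using w(2) p(3) Nge by simp
        qed (use N1 h w in auto)
        then obtain E where E: "finite E" "\<forall>b\<in>E. \<exists>l\<le>h + s. b = 2 ^ l \<or> (\<exists>i\<in>{1..j}. b = N i * 2 ^ l)"
          "real w / (real (\<Prod>i\<in>{1..j}. N i) * 2 ^ h) = recip_sum E" by blast
        have "admissible p z b" if bE: "b \<in> E" for b
        proof -
          obtain l where l': "l \<le> h + s \<and> (b = 2 ^ l \<or> (\<exists>i\<in>{1..j}. b = N i * 2 ^ l))"
            using bspec[OF E(2) bE] by (rule exE)
          have l: "l \<le> h + s" "b = 2 ^ l \<or> (\<exists>i\<in>{1..j}. b = N i * 2 ^ l)" using l' by (rule conjunct1, rule conjunct2)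
          from l(2) show ?thesis
          proof
            assume "b = 2 ^ l"
            moreover have "1 * 2 ^ l \<le> M ^ x * 2 ^ l" using M1 by (intro mult_right_mono) auto
            ultimately show ?thesis using l(1) by (intro small[of b l]) auto
          next
            assume "\<exists>i\<in>{1..j}. b = N i * 2 ^ l"
            then obtain i where i: "i \<in> {1..j}" "b = N i * 2 ^ l" by blast
            moreover have "N i * 2 ^ l \<le> M ^ x * 2 ^ l" using NM[OF i(1)] by (rule mult_right_mono) simp
            ultimately show ?thesis using l(1) N1[OF i(1)] by (intro small[of b l]) auto
          qed
        qed
        then show "\<exists>E. finite E \<and> (\<forall>b\<in>E. admissible p z b) \<and> real w / real K = recip_sum E"
          using E unfolding K_def by (intro exI[of _ E]) auto
      qed
    qed
  qed
qed

section \<open>Removing prime powers from a denominator\<close>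

primrec odd_lcm :: "nat \<Rightarrow> nat" where
  "odd_lcm 0 = 1"
| "odd_lcm (Suc y) = (if even y then lcm (Suc y) (odd_lcm y) else odd_lcm y)"

lemma odd_lcm_pos: "0 < odd_lcm y"
  by (induction y) (auto simp: lcm_pos_nat)

lemma odd_lcm_mono: "x \<le> y \<Longrightarrow> odd_lcm x dvd odd_lcm y"
  by (induction rule: dec_induct) (auto intro: dvd_trans)

lemma dvd_odd_lcm: "odd k \<Longrightarrow> k \<le> y \<Longrightarrow> k dvd odd_lcm y"
proof -
  assume k: "odd k" "k \<le> y"
  then obtain j where j: "k = Suc j" by (cases k) auto
  then have "k dvd odd_lcm k" using k by simp
  then show ?thesis using odd_lcm_mono[OF k(2)] by (rule dvd_trans)
qed

lemma prime_power_dvd_lcm: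
  fixes p a b :: nat
  assumes "prime p" "p ^ k dvd lcm a b"
  shows "p ^ k dvd a \<or> p ^ k dvd b"
proof (cases "a = 0 \<or> b = 0")
  case False
  then have "multiplicity p (lcm a b) = max (multiplicity p a) (multiplicity p b)"
    using assms(1) by (intro multiplicity_lcm) auto
  moreover have "k \<le> multiplicity p (lcm a b)"
    using assms False by (subst (asm) power_dvd_iff_le_multiplicity) auto
  ultimately show ?thesis by (auto simp: multiplicity_dvd' max_def split: if_splits)
qed auto

lemma prime_power_dvd_odd_lcm: "prime p \<Longrightarrow> 0 < k \<Longrightarrow> p ^ k dvd odd_lcm y \<Longrightarrow> p ^ k \<le> y"
proof (induction y)
  case 0
  then show ?case by (auto simp: nat_dvd_1_iff_1)
next
  case (Suc y)
  then have "p ^ k dvd Suc y \<or> p ^ k dvd odd_lcm y"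
    using prime_power_dvd_lcm[of p k "Suc y" "odd_lcm y"] by (auto split: if_splits)
  then show ?case using Suc by (auto dest: dvd_imp_le)
qed

lemma dvd_if_prime_powers_dvd:
  fixes a b :: nat
  assumes "a \<noteq> 0" "b \<noteq> 0" "\<And>p k. prime p \<Longrightarrow> p ^ k dvd a \<Longrightarrow> p ^ k dvd b"
  shows "a dvd b"
proof (rule multiplicity_le_imp_dvd)
  fix p :: nat assume "prime p"
  then show "multiplicity p a \<le> multiplicity p b"
    using assms by (intro multiplicity_geI) (auto simp: multiplicity_dvd)
qed (use assms in auto)

text \<open>Smoothness restricts the odd prime powers only: powers of two are unrestricted.\<close>

definition smooth :: "nat \<Rightarrow> nat \<Rightarrow> bool" where
  "smooth y a \<longleftrightarrow> (\<forall>p k. prime p \<longrightarrow> odd p \<longrightarrow> p ^ k dvd a \<longrightarrow> p ^ k \<le> y)"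

lemma smooth_dvd:
  assumes "smooth y a" "0 < a" "a \<le> 2 ^ e"
  shows "a dvd 2 ^ e * odd_lcm y"
proof (rule dvd_if_prime_powers_dvd)
  fix p k :: nat assume p: "prime p" "p ^ k dvd a"
  show "p ^ k dvd 2 ^ e * odd_lcm y"
  proof (cases "odd p")
    case True
    then have "p ^ k \<le> y" using assms(1) p unfolding smooth_def by blast
    then have "p ^ k dvd odd_lcm y" using True by (intro dvd_odd_lcm) auto
    then show ?thesis by simp
  next
    case False
    then have "p = 2" using p(1) primes_dvd_imp_eq two_is_prime_nat by blast
    have "p ^ k \<le> 2 ^ e" using p(2) assms(2,3) by (meson dvd_imp_le le_trans)
    then have "k \<le> e" using \<open>p = 2\<close> by simp
    then show ?thesis using \<open>p = 2\<close> by (simp add: le_imp_power_dvd)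
  qed
qed (use assms odd_lcm_pos[of y] in auto)

lemma smooth_mult:
  assumes "smooth y a" "0 < u" "0 < a"
  shows "smooth (u * y) (u * a)"
  unfolding smooth_def
proof (intro allI impI)
  fix p k :: nat assume p: "prime p" "odd p" "p ^ k dvd u * a"
  obtain b c where bc: "p ^ k = b * c" "b dvd u" "c dvd a" using dvd_productE[OF p(3)] by metis
  then obtain j where j: "c = p ^ j" using divides_primepow_nat[OF p(1), of c k] by auto
  then have "c \<le> y" using assms(1) p bc(3) unfolding smooth_def by blast
  moreover have "b \<le> u" using bc(2) assms(2) by (rule dvd_imp_le)
  ultimately show "p ^ k \<le> u * y" unfolding bc(1) by (intro mult_mono) auto
qed

lemma smooth_mono: "smooth x a \<Longrightarrow> x \<le> y \<Longrightarrow> smooth y a"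
  unfolding smooth_def by (meson le_trans)

text \<open>An integrality condition on a real number instead of a condition on a reduced fraction:
  it passes to differences at once, and r stays a real throughout.\<close>

definition denom_smooth :: "nat \<Rightarrow> nat \<Rightarrow> real \<Rightarrow> bool" where
  "denom_smooth e y r \<longleftrightarrow> 2 ^ e * real (odd_lcm y) * r \<in> \<int>"

lemma denom_smooth_diff: "denom_smooth e y r \<Longrightarrow> denom_smooth e y s \<Longrightarrow> denom_smooth e y (r - s)"
  unfolding denom_smooth_def by (metis Ints_diff right_diff_distrib)

lemma denom_smooth_inverse: "a dvd 2 ^ e * odd_lcm y \<Longrightarrow> denom_smooth e y (1 / real a)"
proof -
  assume "a dvd 2 ^ e * odd_lcm y"
  then obtain c where "2 ^ e * odd_lcm y = a * c" by (rule dvdE)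
  then have "real (2 ^ e * odd_lcm y) = real (a * c)" by (simp only:)
  then have "2 ^ e * real (odd_lcm y) * (1 / real a) = (if a = 0 then 0 else real c)" by simp
  then show ?thesis unfolding denom_smooth_def by auto
qed

lemma denom_smooth_recip_sum:
  "(\<And>a. a \<in> A \<Longrightarrow> a dvd 2 ^ e * odd_lcm y) \<Longrightarrow> denom_smooth e y (recip_sum A)"
  using denom_smooth_inverse unfolding denom_smooth_def recip_sum_def
  by (auto simp: sum_distrib_left intro!: Ints_sum)

text \<open>At a prime power the least common multiple gains exactly one factor p. Hence a single
  congruence modulo p decides whether the denominator can be lowered from \<open>Suc q\<close> to
  q.\<close>

lemma odd_lcm_prime_power:
  assumes p: "prime p" "odd p" and k: "Suc q = p ^ Suc k"
  shows "\<exists>c. odd_lcm q = p ^ k * c \<and> odd_lcm (Suc q) = p ^ Suc k * c \<and> \<not> p dvd c"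
proof -
  have "p ^ k < p ^ Suc k" using prime_gt_1_nat[OF p(1)] by (simp add: prime_gt_0_nat)
  then have "p ^ k \<le> q" using k by linarith
  then have "p ^ k dvd odd_lcm q" using p(2) by (intro dvd_odd_lcm) auto
  then obtain c where c: "odd_lcm q = p ^ k * c" by (rule dvdE)
  have pc: "\<not> p dvd c"
  proof
    assume "p dvd c"
    then have "p ^ Suc k dvd odd_lcm q" unfolding c by simp
    then show False using prime_power_dvd_odd_lcm[OF p(1), of "Suc k" q] k by simp
  qed
  have "even q" using k p(2) by (metis even_Suc even_power)
  then have "odd_lcm (Suc q) = lcm (Suc q) (odd_lcm q)" by simp
  also have "\<dots> = lcm (p ^ k * p) (p ^ k * c)" unfolding k c power_Suc2 ..
  also have "\<dots> = p ^ k * lcm p c" by (simp add: lcm_mult_left)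
  also have "lcm p c = p * c" using prime_imp_coprime[OF p(1) pc] by (simp add: lcm_coprime)
  finally show ?thesis using c pc by (intro exI[of _ c]) simp
qed

lemma odd_lcm_not_prime_power:
  assumes "\<And>p k. prime p \<Longrightarrow> odd p \<Longrightarrow> Suc q \<noteq> p ^ Suc k"
  shows "odd_lcm (Suc q) = odd_lcm q"
proof (cases "even q")
  case True
  have "Suc q dvd odd_lcm q"
  proof (rule dvd_if_prime_powers_dvd)
    fix p k :: nat assume p: "prime p" "p ^ k dvd Suc q"
    show "p ^ k dvd odd_lcm q"
    proof (cases "k = 0")
      case False
      then obtain k' where k': "k = Suc k'" by (cases k) auto
      have "p dvd Suc q" using p(2) k' dvd_trans[of p "p ^ k"] by simp
      moreover have "odd (Suc q)" using True by simp
      ultimately have "odd p" using dvd_trans by blast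
      then have "p ^ k \<noteq> Suc q" using assms p(1) k' by metis
      then have "p ^ k \<le> q" using dvd_imp_le[OF p(2)] by simp
      then show ?thesis using \<open>odd p\<close> by (intro dvd_odd_lcm) auto
    qed simp
  qed (use odd_lcm_pos[of q] in auto)
  then show ?thesis using True by (simp add: lcm_proj2_if_dvd)
qed simp

section \<open>Cancelling prime powers with few new elements\<close>

lemma power2_scale:
  fixes n V :: nat
  assumes "0 < n" "n \<le> V"
  shows "\<exists>i. V \<le> n * 2 ^ i \<and> n * 2 ^ i < 2 * V"
proof -
  define i where "i = (LEAST i. V \<le> n * 2 ^ i)"
  have "V \<le> 1 * 2 ^ V" using less_exp[of V] by simp
  also have "\<dots> \<le> n * 2 ^ V" using assms by (intro mult_right_mono) auto
  finally have i1: "V \<le> n * 2 ^ i" unfolding i_def by (rule LeastI)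
  have "n * 2 ^ i < 2 * V"
  proof (cases i)
    case 0
    then show ?thesis using assms by simp
  next
    case (Suc i')
    then have "\<not> V \<le> n * 2 ^ i'" using not_less_Least[of i' "\<lambda>i. V \<le> n * 2 ^ i"] unfolding i_def by simp
    then show ?thesis using Suc by simp
  qed
  then show ?thesis using i1 by blast
qed

text \<open>With n = \<open>Suc q\<close> a power of p, the new elements are n * 2 ^ i * b, where 2
  ^ i moves n into [V, 2 * V) and b \<le> B is admissible. Over the common denominator n * 2 ^ i * W
  they have numerators \<open>W div b\<close>, so \<open>covers\<close> can match the numerator of r
  modulo p. Being divisible by n, they do not divide the lower modulus; this clause later yields
  disjointness.\<close>

lemma remove_prime_power:
  fixes e q V B :: nat and r :: real
  assumes r: "denom_smooth e (Suc q) r" and V: "Suc q \<le> V" "2 * V * B \<le> 2 ^ e" and B: "0 < B"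
    and cov: "\<And>p. prime p \<Longrightarrow> odd p \<Longrightarrow> p \<le> Suc q \<Longrightarrow> covers p B"
  shows "\<exists>E. finite E \<and> card E \<le> B \<and> E \<subseteq> {V..2 * V * B} \<and>
     (\<forall>a\<in>E. a dvd 2 ^ e * odd_lcm (Suc q) \<and> \<not> a dvd 2 ^ e * odd_lcm q) \<and>
     denom_smooth e q (r - recip_sum E)"
proof (cases "\<exists>p k. prime p \<and> odd p \<and> Suc q = p ^ Suc k")
  case False
  then have "odd_lcm (Suc q) = odd_lcm q" by (intro odd_lcm_not_prime_power) blast
  then show ?thesis using r by (intro exI[of _ "{}"]) (auto simp: denom_smooth_def recip_sum_def)
next
  case True
  then obtain p k where p: "prime p" "odd p" and k: "Suc q = p ^ Suc k" by blast
  define n where "n = p ^ Suc k"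
  obtain c where c: "odd_lcm q = p ^ k * c" "odd_lcm (Suc q) = n * c" "\<not> p dvd c"
    using odd_lcm_prime_power[OF p k] unfolding n_def by blast
  have n0: "0 < n" and nV: "n \<le> V" using k V unfolding n_def by linarith+
  have pn: "p \<le> n" unfolding n_def using prime_gt_0_nat[OF p(1)] by simp
  obtain i where i1: "V \<le> n * 2 ^ i" and i2: "n * 2 ^ i < 2 * V" using power2_scale[OF n0 nV] by blast
  have le: "l \<le> e - i \<and> i \<le> e" if "2 ^ l \<le> B" for l
  proof -
    have "2 ^ (i + l) \<le> n * 2 ^ i * 2 ^ l" using n0 by (simp add: power_add)
    also have "\<dots> \<le> 2 * V * B" by (rule mult_mono[OF less_imp_le[OF i2] that]) auto
    also have "\<dots> \<le> 2 ^ e" by (rule V)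
    finally have "i + l \<le> e" by simp
    then show ?thesis by simp
  qed
  have ie: "i \<le> e" using le[of 0] B by simp
  \<comment> \<open>The modulus with n * 2 ^ i taken out. It is prime to p, and a multiple of every
    admissible b: an odd part below p divides c, and the power of two fits because 2 * V * B \<le> 2
    ^ e.\<close>
  define W where "W = 2 ^ (e - i) * c"
  have p2: "\<not> p dvd 2 ^ l" for l
  proof
    assume "p dvd 2 ^ l"
    then have "p dvd 2" using p(1) prime_dvd_power by blast
    then have "p = 2" using p(1) primes_dvd_imp_eq two_is_prime_nat by blast
    then show False using p(2) by simp
  qed
  have pW: "\<not> p dvd W" unfolding W_def using p2 c(3) p(1) by (simp add: prime_dvd_mult_iff)
  have adm: "b dvd W" if b: "admissible p B b" for b
  proof -
    have b0: "0 < b" "b \<le> B" using b unfolding admissible_def by auto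
    from b consider l where "b = 2 ^ l" | "b < p" unfolding admissible_def by blast
    then show ?thesis
    proof cases
      case 1
      then have "l \<le> e - i" using le b0 by simp
      then show ?thesis unfolding W_def 1 by (intro dvd_mult2 le_imp_power_dvd)
    next
      case 2
      define l where "l = multiplicity 2 b"
      obtain b' where b': "b = 2 ^ l * b'" "odd b'"
        using multiplicity_decompose'[of b 2] b0 unfolding l_def by auto
      have "2 ^ l \<le> b" using b' b0 by (cases b') auto
      then have l: "l \<le> e - i" using le b0 by simp
      have b'0: "0 < b'" "b' \<le> b" using b' b0 by (auto intro!: Nat.gr0I)
      have "b' \<le> q" using b'0 2 pn k unfolding n_def by linarith
      then have "b' dvd p ^ k * c" using dvd_odd_lcm[of b' q] b'(2) c(1) by simp
      moreover have "coprime b' (p ^ k)"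
      proof -
        have "\<not> p dvd b'" using b'0 2 by (auto dest: dvd_imp_le)
        then show ?thesis using prime_imp_coprime[OF p(1)] by (simp add: coprime_commute)
      qed
      ultimately have "b' dvd c" by (simp add: coprime_dvd_mult_right_iff)
      then show ?thesis unfolding W_def b'(1) using l by (intro mult_dvd_mono le_imp_power_dvd)
    qed
  qed
  obtain u where u: "2 ^ e * real (odd_lcm (Suc q)) * r = of_int u"
    using r unfolding denom_smooth_def by (auto elim: Ints_cases)
  have "covers p B" using cov[OF p] pn k n_def by simp
  then have "\<exists>E. finite E \<and> (\<forall>b\<in>E. admissible p B b) \<and> [(\<Sum>b\<in>E. int (W div b)) = u] (mod int p)"
    unfolding covers_def using pW adm by simp
  then obtain E' where E': "finite E'" "\<forall>b\<in>E'. admissible p B b"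
    "[(\<Sum>b\<in>E'. int (W div b)) = u] (mod int p)" by (elim exE conjE)
  define f where "f b = n * 2 ^ i * b" for b
  define E where "E = f ` E'"
  have inj: "inj_on f E'" unfolding f_def using n0 by (auto simp: inj_on_def)
  have "E' \<subseteq> {1..B}" using E'(2) unfolding admissible_def by auto
  then have "card E \<le> card {1..B}" unfolding E_def by (meson card_image_le card_mono E'(1) finite_atLeastAtMost le_trans)
  then have cardE: "card E \<le> B" by simp
  have e2: "(2::nat) ^ e = 2 ^ i * 2 ^ (e - i)" using ie by (simp flip: power_add)
  have eq: "2 ^ e * odd_lcm (Suc q) = n * 2 ^ i * W" unfolding c(2) W_def e2 by (simp add: mult_ac)
  have mem: "a \<in> {V..2 * V * B} \<and> a dvd 2 ^ e * odd_lcm (Suc q) \<and> \<not> a dvd 2 ^ e * odd_lcm q" if a: "a \<in> E" for a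
  proof -
    obtain b where b: "a = n * 2 ^ i * b" "admissible p B b" using a E'(2) unfolding E_def f_def by blast
    have b0: "1 \<le> b" "b \<le> B" using b(2) unfolding admissible_def by auto
    have "V * 1 \<le> n * 2 ^ i * b" using i1 b0 by (intro mult_mono) auto
    moreover have "n * 2 ^ i * b \<le> 2 * V * B" by (rule mult_mono[OF less_imp_le[OF i2] b0(2)]) auto
    moreover have "a dvd n * 2 ^ i * W" unfolding b(1) using adm[OF b(2)] by (intro mult_dvd_mono) auto
    moreover have "\<not> a dvd 2 ^ e * odd_lcm q"
    proof
      assume "a dvd 2 ^ e * odd_lcm q"
      moreover have "n dvd a" unfolding b(1) by simp
      ultimately have "p ^ Suc k dvd 2 ^ e * odd_lcm q" unfolding n_def using dvd_trans by blast
      moreover have "coprime (p ^ Suc k) (2 ^ e)" using prime_imp_coprime[OF p(1) p2[of e]] by (simp only: coprime_power_left_iff simp_thms)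
      ultimately have "p ^ Suc k dvd odd_lcm q" by (simp only: coprime_dvd_mult_right_iff)
      then show False using prime_power_dvd_odd_lcm[OF p(1), of "Suc k" q] k by simp
    qed
    ultimately show ?thesis unfolding eq using b(1) by simp
  qed
  \<comment> \<open>The numerator of the difference is a multiple of p, which is exactly the factor
    between the two least common multiples.\<close>
  obtain t where t: "u - (\<Sum>b\<in>E'. int (W div b)) = int p * t"
    using E'(3) by (metis cong_iff_dvd_diff cong_sym dvdE)
  have "2 ^ e * real (odd_lcm (Suc q)) * recip_sum E = (\<Sum>b\<in>E'. real (W div b))"
  proof -
    have "2 ^ e * real (odd_lcm (Suc q)) = real (2 ^ e * odd_lcm (Suc q))" by simp
    also have "\<dots> = real (n * 2 ^ i) * real W" unfolding eq by simp
    finally have e3: "2 ^ e * real (odd_lcm (Suc q)) = real (n * 2 ^ i) * real W" .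
    have "recip_sum E = (\<Sum>b\<in>E'. 1 / real (f b))" unfolding recip_sum_def E_def using inj by (simp add: sum.reindex)
    then have "2 ^ e * real (odd_lcm (Suc q)) * recip_sum E = (\<Sum>b\<in>E'. real (n * 2 ^ i) * real W * (1 / real (f b)))"
      unfolding e3 by (simp add: sum_distrib_left)
    also have "\<dots> = (\<Sum>b\<in>E'. real (W div b))"
    proof (rule sum.cong)
      fix b assume "b \<in> E'"
      then have "real (W div b) = real W / real b" using adm E'(2) by (simp add: real_of_nat_div)
      then show "real (n * 2 ^ i) * real W * (1 / real (f b)) = real (W div b)"
        unfolding f_def using n0 by simp
    qed simp
    finally show ?thesis .
  qed
  then have "2 ^ e * real (odd_lcm (Suc q)) * (r - recip_sum E) = of_int (u - (\<Sum>b\<in>E'. int (W div b)))"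
    using u by (simp add: right_diff_distrib)
  also have "\<dots> = real p * of_int t" unfolding t by simp
  also have "2 ^ e * real (odd_lcm (Suc q)) = real p * (2 ^ e * real (odd_lcm q))"
    unfolding c n_def by simp
  finally have "2 ^ e * real (odd_lcm q) * (r - recip_sum E) = of_int t"
    using prime_gt_0_nat[OF p(1)] by simp
  then have "denom_smooth e q (r - recip_sum E)" unfolding denom_smooth_def by simp
  then show ?thesis using mem cardE E'(1) unfolding E_def[symmetric]
    by (intro exI[of _ E]) (auto simp: E_def)
qed

text \<open>All steps draw their elements from the same range {V..2 * V * B}. The sets of different
  steps are disjoint because each set divides the modulus of its own step but not that of the next
  lower one.\<close>

lemma remove_prime_powers:
  fixes e y Q V B :: nat and r :: real
  assumes "Q \<le> y" and r: "denom_smooth e y r" and V: "y \<le> V" "2 * V * B \<le> 2 ^ e" and B: "0 < B"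
    and cov: "\<And>p. prime p \<Longrightarrow> odd p \<Longrightarrow> p \<le> y \<Longrightarrow> covers p B"
  shows "\<exists>E. finite E \<and> card E \<le> (y - Q) * B \<and> E \<subseteq> {V..2 * V * B} \<and>
     (\<forall>a\<in>E. a dvd 2 ^ e * odd_lcm y \<and> \<not> a dvd 2 ^ e * odd_lcm Q) \<and>
     denom_smooth e Q (r - recip_sum E)"
  using assms(1) r V(1) cov
proof (induction y arbitrary: r rule: dec_induct)
  case base
  then show ?case by (intro exI[of _ "{}"]) (auto simp: recip_sum_def)
next
  case (step y)
  obtain E1 where E1: "finite E1" "card E1 \<le> B" "E1 \<subseteq> {V..2 * V * B}"
    "\<forall>a\<in>E1. a dvd 2 ^ e * odd_lcm (Suc y) \<and> \<not> a dvd 2 ^ e * odd_lcm y"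
    "denom_smooth e y (r - recip_sum E1)"
    using remove_prime_power[OF step.prems(1,2) V(2) B step.prems(3)] by blast
  obtain E2 where E2: "finite E2" "card E2 \<le> (y - Q) * B" "E2 \<subseteq> {V..2 * V * B}"
    "\<forall>a\<in>E2. a dvd 2 ^ e * odd_lcm y \<and> \<not> a dvd 2 ^ e * odd_lcm Q"
    "denom_smooth e Q (r - recip_sum E1 - recip_sum E2)"
    using step.IH[OF E1(5)] step.prems(2,3) by auto
  have dis: "E1 \<inter> E2 = {}" using E1(4) E2(4) by blast
  have "card (E1 \<union> E2) \<le> B + (y - Q) * B" using E1(2) E2(2) card_Un_le[of E1 E2] by linarith
  also have "\<dots> = (Suc y - Q) * B" using step.hyps by (simp add: Suc_diff_le)
  finally have "card (E1 \<union> E2) \<le> (Suc y - Q) * B" .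
  moreover have "recip_sum (E1 \<union> E2) = recip_sum E1 + recip_sum E2"
    using recip_sum_Un E1(1) E2(1) dis by blast
  moreover have "a dvd 2 ^ e * odd_lcm (Suc y) \<and> \<not> a dvd 2 ^ e * odd_lcm Q" if "a \<in> E1 \<union> E2" for a
  proof -
    have m: "2 ^ e * odd_lcm Q dvd 2 ^ e * odd_lcm y" "2 ^ e * odd_lcm y dvd 2 ^ e * odd_lcm (Suc y)"
      using odd_lcm_mono[of Q y] odd_lcm_mono[of y "Suc y"] step.hyps by (auto simp del: odd_lcm.simps)
    show ?thesis using that E1(4) E2(4) m dvd_trans by blast
  qed
  ultimately show ?case using E1 E2 by (intro exI[of _ "E1 \<union> E2"]) (auto simp: algebra_simps)
qed

section \<open>Chebyshev estimates and the density of smooth numbers\<close>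

lemma multiples_up_to:
  fixes d n :: nat
  assumes d: "0 < d"
  shows "{k\<in>{1..n}. d dvd k} = (\<lambda>j. d * j) ` {1..n div d}"
proof (intro equalityI subsetI)
  fix k assume k: "k \<in> {k\<in>{1..n}. d dvd k}"
  then obtain j where j: "k = d * j" by auto
  then have "1 \<le> j" "j \<le> n div d" using k d by (auto simp: less_eq_div_iff_mult_less_eq mult.commute Suc_le_eq)
  then show "k \<in> (\<lambda>j. d * j) ` {1..n div d}" using j by auto
next
  fix k assume k: "k \<in> (\<lambda>j. d * j) ` {1..n div d}"
  then obtain j where "k = d * j" "j \<in> {1..n div d}" by (rule imageE)
  then have j: "k = d * j" "1 \<le> j" "j \<le> n div d" by simp_all
  then have "d * j \<le> n" using d by (simp add: less_eq_div_iff_mult_less_eq mult.commute)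
  then show "k \<in> {k\<in>{1..n}. d dvd k}" using j d by (auto simp: Suc_le_eq)
qed

lemma card_multiples: "0 < (d::nat) \<Longrightarrow> card {k\<in>{1..n}. d dvd k} = n div d"
  by (subst multiples_up_to) (auto simp: card_image inj_on_def)

lemma ln_fact_mangoldt: "ln (fact n) = (\<Sum>d\<in>{1..n}. mangoldt d * real (n div d))"
proof -
  have "ln (fact n :: real) = (\<Sum>k\<in>{1..n}. ln (real k))"
    unfolding fact_prod of_nat_prod by (subst ln_prod) auto
  also have "\<dots> = (\<Sum>k\<in>{1..n}. \<Sum>d\<in>{1..n}. if d dvd k then mangoldt d else 0)"
  proof (rule sum.cong)
    fix k assume k: "k \<in> {1..n}"
    have "(\<Sum>d\<in>{1..n}. if d dvd k then mangoldt d else 0) = (\<Sum>d\<in>{d\<in>{1..n}. d dvd k}. mangoldt d :: real)"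
      by (rule sum.inter_filter[symmetric]) simp
    also have "{d\<in>{1..n}. d dvd k} = {d. d dvd k}"
    proof -
      have "d \<in> {1..n}" if "d dvd k" for d
        using that k by (cases d) (auto dest: dvd_imp_le)
      then show ?thesis by blast
    qed
    also have "(\<Sum>d | d dvd k. mangoldt d) = ln (real k)" using mangoldt_sum[of k, where 'a = real] k by simp
    finally show "ln (real k) = (\<Sum>d\<in>{1..n}. if d dvd k then mangoldt d else 0)" by simp
  qed simp
  also have "\<dots> = (\<Sum>d\<in>{1..n}. \<Sum>k\<in>{1..n}. if d dvd k then mangoldt d else 0)"
    by (rule sum.swap)
  also have "\<dots> = (\<Sum>d\<in>{1..n}. mangoldt d * real (n div d))"
  proof (rule sum.cong)
    fix d assume "d \<in> {1..n}"
    then have "0 < d" by simp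
    have "(\<Sum>k\<in>{1..n}. if d dvd k then mangoldt d else 0) = (\<Sum>k\<in>{k\<in>{1..n}. d dvd k}. mangoldt d :: real)"
      by (rule sum.inter_filter[symmetric]) simp
    also have "\<dots> = mangoldt d * real (n div d)" using card_multiples[OF \<open>0 < d\<close>] by simp
    finally show "(\<Sum>k\<in>{1..n}. if d dvd k then mangoldt d else 0) = mangoldt d * real (n div d)" .
  qed simp
  finally show ?thesis .
qed

text \<open>By \<open>div_double_bounds\<close> every coefficient of \<open>mangoldt d\<close> is 0
  or 1, and it is 1 at the primes in (n, 2 * n]. The identity therefore serves both for the upper
  and for the lower estimate of primes.\<close>

lemma ln_central_binomial:
  "ln (real (2 * n choose n)) = (\<Sum>d\<in>{1..2 * n}. mangoldt d * (real (2 * n div d) - 2 * real (n div d)))"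
proof -
  have "real (2 * n choose n) = fact (2 * n) / (fact n * fact n)"
    using binomial_fact[of n "2 * n", where 'a = real] by (simp add: mult_2)
  then have "ln (real (2 * n choose n)) = ln (fact (2 * n)) - 2 * ln (fact n)"
    by (simp add: ln_div ln_mult)
  also have "ln (fact n) = (\<Sum>d\<in>{1..2 * n}. mangoldt d * real (n div d))"
    unfolding ln_fact_mangoldt by (rule sum.mono_neutral_left) auto
  finally show ?thesis unfolding ln_fact_mangoldt
    by (simp add: sum_subtractf sum_distrib_left right_diff_distrib mult_ac)
qed

lemma div_double_bounds:
  fixes n d :: nat
  shows "2 * real (n div d) \<le> real (2 * n div d)" "real (2 * n div d) \<le> 2 * real (n div d) + 1"
proof -
  have "2 * (n div d) \<le> 2 * n div d \<and> 2 * n div d \<le> 2 * (n div d) + 1"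
  proof (cases "d = 0")
    case False
    have "n div d * d \<le> n" by simp
    then have 1: "2 * (n div d) * d \<le> 2 * n" by linarith
    have "n < (n div d + 1) * d" using False by (metis Suc_eq_plus1 dividend_less_div_times mult.commute mult_Suc_right add.commute neq0_conv)
    then have 2: "2 * n < (2 * (n div d) + 2) * d" by (simp add: algebra_simps)
    show ?thesis using False less_mult_imp_div_less[OF 2] 1 by (simp add: less_eq_div_iff_mult_less_eq)
  qed simp
  then show "2 * real (n div d) \<le> real (2 * n div d)" "real (2 * n div d) \<le> 2 * real (n div d) + 1"
    by linarith+
qed

lemma sum_ln_primes_dyadic: "(\<Sum>p\<in>{p. prime p \<and> n < p \<and> p \<le> 2 * n}. ln (real p)) \<le> real n * ln 4"
proof -
  let ?P = "{p. prime p \<and> n < p \<and> p \<le> 2 * n}"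
  have "(\<Sum>p\<in>?P. ln (real p)) = (\<Sum>p\<in>?P. mangoldt p * (real (2 * n div p) - 2 * real (n div p)))"
  proof (rule sum.cong)
    fix p assume p: "p \<in> ?P"
    then have "2 * n div p = 1" by (intro div_nat_eqI) auto
    then show "ln (real p) = mangoldt p * (real (2 * n div p) - 2 * real (n div p))" using p by simp
  qed simp
  also have "\<dots> \<le> (\<Sum>d\<in>{1..2 * n}. mangoldt d * (real (2 * n div d) - 2 * real (n div d)))"
    using div_double_bounds by (intro sum_mono2 mult_nonneg_nonneg mangoldt_nonneg) (auto simp: prime_ge_1_nat Suc_le_eq prime_gt_0_nat)
  also have "\<dots> = ln (real (2 * n choose n))" by (rule ln_central_binomial[symmetric])
  also have "\<dots> \<le> ln (real (2 ^ (2 * n)))"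
  proof -
    have "2 * n choose n \<le> 2 ^ (2 * n)" by (rule binomial_le_pow2)
    then show ?thesis by (subst ln_le_cancel_iff) (auto simp del: of_nat_power)
  qed
  also have "\<dots> = real n * ln 4" by (simp add: ln_realpow power_mult)
  finally show ?thesis .
qed

lemma sum_inverse_primes_dyadic:
  assumes "2 \<le> n"
  shows "(\<Sum>p\<in>{p. prime p \<and> n < p \<and> p \<le> 2 * n}. 1 / real p) \<le> ln 4 / ln (real n)"
proof -
  let ?P = "{p. prime p \<and> n < p \<and> p \<le> 2 * n}"
  have n: "0 < real n" "0 < ln (real n)" using assms by auto
  have "(\<Sum>p\<in>?P. 1 / real p) \<le> (\<Sum>p\<in>?P. ln (real p) / (real n * ln (real n)))"
  proof (rule sum_mono)
    fix p assume p: "p \<in> ?P"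
    then have "ln (real n) \<le> ln (real p)" using n by simp
    then have "1 / real p \<le> 1 / real n" "1 \<le> ln (real p) / ln (real n)" using p n by (auto simp: field_simps)
    then have "1 / real p * 1 \<le> 1 / real n * (ln (real p) / ln (real n))" using n by (intro mult_mono) auto
    then show "1 / real p \<le> ln (real p) / (real n * ln (real n))" by simp
  qed
  also have "\<dots> = (\<Sum>p\<in>?P. ln (real p)) / (real n * ln (real n))" by (simp add: sum_divide_distrib)
  also have "\<dots> \<le> real n * ln 4 / (real n * ln (real n))"
    using sum_ln_primes_dyadic n by (intro divide_right_mono) auto
  finally show ?thesis using n by simp
qed

text \<open>A crude form of Mertens' estimate: I dyadic blocks, each contributing at most ln 4 / ln
  y. With 2 ^ I of order z ^ 5 and y = z ^ (D - 5) the bound is O(1/D).\<close>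

lemma sum_inverse_primes:
  assumes "2 \<le> y"
  shows "(\<Sum>p\<in>{p. prime p \<and> y < p \<and> p \<le> y * 2 ^ I}. 1 / real p) \<le> real I * ln 4 / ln (real y)"
proof (induction I)
  case 0
  have "{p. prime p \<and> y < p \<and> p \<le> y * 2 ^ 0} = {}" by auto
  then show ?case by (simp only: sum.empty)
next
  case (Suc I)
  let ?A = "{p. prime p \<and> y < p \<and> p \<le> y * 2 ^ I}"
  let ?B = "{p. prime p \<and> y * 2 ^ I < p \<and> p \<le> 2 * (y * 2 ^ I)}"
  have "{p. prime p \<and> y < p \<and> p \<le> y * 2 ^ Suc I} \<subseteq> ?A \<union> ?B" by auto
  then have "(\<Sum>p\<in>{p. prime p \<and> y < p \<and> p \<le> y * 2 ^ Suc I}. 1 / real p) \<le> (\<Sum>p\<in>?A \<union> ?B. 1 / real p)"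
    by (intro sum_mono2) auto
  also have "\<dots> = (\<Sum>p\<in>?A. 1 / real p) + (\<Sum>p\<in>?B. 1 / real p)" by (intro sum.union_disjoint) auto
  also have "(\<Sum>p\<in>?B. 1 / real p) \<le> ln 4 / ln (real (y * 2 ^ I))"
  proof (rule sum_inverse_primes_dyadic)
    have "2 * 1 \<le> y * 2 ^ I" using assms by (intro mult_mono) auto
    then show "2 \<le> y * 2 ^ I" by simp
  qed
  also have "ln 4 / ln (real (y * 2 ^ I)) \<le> ln 4 / ln (real y)"
  proof (rule divide_left_mono)
    have "real y * 1 \<le> real y * 2 ^ I" by (intro mult_left_mono) auto
    then have le: "real y \<le> real (y * 2 ^ I)" by simp
    show "ln (real y) \<le> ln (real (y * 2 ^ I))" by (rule ln_mono[OF le]) (use assms in simp)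
    have "1 < real y" "1 < real (y * 2 ^ I)" using le assms by linarith+
    then show "0 < ln (real (y * 2 ^ I)) * ln (real y)" by (intro mult_pos_pos ln_gt_zero)
  qed simp
  finally show ?case using Suc by (simp add: add_divide_distrib distrib_right)
qed

section \<open>Density of the numbers with a large odd prime power\<close>

lemma sum_inverse_squares: "0 < w \<Longrightarrow> (\<Sum>s\<in>{w<..x}. 1 / (real s)\<^sup>2) \<le> 1 / real w"
proof -
  assume w: "0 < w"
  have "(\<Sum>s\<in>{w<..x}. 1 / (real s)\<^sup>2) \<le> 1 / real w - 1 / real x" if "w \<le> x" for x
    using that
  proof (induction x rule: dec_induct)
    case (step x)
    have "{w<..Suc x} = insert (Suc x) {w<..x}" using step by auto
    then have "(\<Sum>s\<in>{w<..Suc x}. 1 / (real s)\<^sup>2) \<le> 1 / (real (Suc x))\<^sup>2 + (1 / real w - 1 / real x)"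
      using step by simp
    also have "1 / (real (Suc x))\<^sup>2 \<le> 1 / (real x * real (Suc x))" using w step
      by (intro divide_left_mono) (auto simp: power2_eq_square)
    also have "1 / (real x * real (Suc x)) = 1 / real x - 1 / real (Suc x)" using w step
      by (simp add: field_simps)
    finally show ?case by simp
  qed simp
  from this[of x] show ?thesis using w by (cases "w \<le> x") (auto intro: order_trans)
qed

text \<open>An offending prime power p ^ k > y is either a prime above y or has k \<ge> 2. In the
  second case s = p ^ (k div 2) has s^2 dividing a, and 3 * (k div 2) \<ge> k gives s^3 > y \<ge>
  w^3, so s > w. The multiples of such squares contribute the term 1 / w.\<close>

lemma card_non_smooth:
  assumes w: "0 < w" "w ^ 3 \<le> y" and y: "2 \<le> y" and I: "x \<le> y * 2 ^ I"
  shows "real (card {a\<in>{1..x}. \<not> smooth y a}) \<le> real x * (real I * ln 4 / ln (real y) + 1 / real w)"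
proof -
  let ?P = "{p. prime p \<and> y < p \<and> p \<le> y * 2 ^ I}"
  let ?S = "{w<..x}"
  let ?M = "\<lambda>d. {a\<in>{1..x}. d dvd a}"
  have sub: "{a\<in>{1..x}. \<not> smooth y a} \<subseteq> (\<Union>p\<in>?P. ?M p) \<union> (\<Union>s\<in>?S. ?M (s\<^sup>2))"
  proof
    fix a assume a: "a \<in> {a\<in>{1..x}. \<not> smooth y a}"
    then obtain p k where p: "prime p" "odd p" "p ^ k dvd a" "y < p ^ k"
      unfolding smooth_def by (auto simp: not_le)
    have k: "k \<noteq> 0" using p(4) y by (intro notI) simp
    have p0: "0 < p" using p(1) by (rule prime_gt_0_nat)
    show "a \<in> (\<Union>p\<in>?P. ?M p) \<union> (\<Union>s\<in>?S. ?M (s\<^sup>2))"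
    proof (cases "k = 1")
      case True
      then have "p \<le> a" using p a by (auto dest: dvd_imp_le)
      then have "p \<in> ?P" using True p a I by auto
      then show ?thesis using True p a by auto
    next
      case False
      define s where "s = p ^ (k div 2)"
      have "s\<^sup>2 dvd p ^ k" unfolding s_def by (simp add: le_imp_power_dvd flip: power_mult)
      then have sa: "s\<^sup>2 dvd a" using p(3) dvd_trans by blast
      have "k \<le> k div 2 * 3" using k False by linarith
      then have "p ^ k \<le> s ^ 3" unfolding s_def using p0 by (simp add: power_increasing flip: power_mult)
      then have "w ^ 3 < s ^ 3" using p(4) w by linarith
      then have "w < s" by (rule power_less_imp_less_base) simp
      moreover have "s \<le> x"
      proof -
        have "s \<le> s\<^sup>2" using \<open>w < s\<close> by (simp add: power2_eq_square)
        also have "\<dots> \<le> a" using sa a by (intro dvd_imp_le) auto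
        finally show ?thesis using a by simp
      qed
      ultimately show ?thesis using sa a by auto
    qed
  qed
  have finP: "finite ?P" by (rule finite_subset[of _ "{..y * 2 ^ I}"]) auto
  have M: "real (card (?M d)) \<le> real x * (1 / real d)" if "0 < d" for d
    using card_multiples[OF that, of x] of_nat_div_le_of_nat[of x d] by simp
  have "card {a\<in>{1..x}. \<not> smooth y a} \<le> card ((\<Union>p\<in>?P. ?M p) \<union> (\<Union>s\<in>?S. ?M (s\<^sup>2)))"
    by (rule card_mono[OF _ sub]) (use finP in auto)
  also have "\<dots> \<le> card (\<Union>p\<in>?P. ?M p) + card (\<Union>s\<in>?S. ?M (s\<^sup>2))" by (rule card_Un_le)
  also have "\<dots> \<le> (\<Sum>p\<in>?P. card (?M p)) + (\<Sum>s\<in>?S. card (?M (s\<^sup>2)))"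
    using finP by (intro add_mono card_UN_le) auto
  finally have "real (card {a\<in>{1..x}. \<not> smooth y a}) \<le> real ((\<Sum>p\<in>?P. card (?M p)) + (\<Sum>s\<in>?S. card (?M (s\<^sup>2))))"
    by (simp only: of_nat_le_iff)
  also have "\<dots> = (\<Sum>p\<in>?P. real (card (?M p))) + (\<Sum>s\<in>?S. real (card (?M (s\<^sup>2))))"
    by simp
  also have "\<dots> \<le> (\<Sum>p\<in>?P. real x * (1 / real p)) + (\<Sum>s\<in>?S. real x * (1 / real (s\<^sup>2)))"
    by (intro add_mono sum_mono M) (auto simp: prime_gt_0_nat)
  also have "\<dots> = real x * ((\<Sum>p\<in>?P. 1 / real p) + (\<Sum>s\<in>?S. 1 / (real s)\<^sup>2))"
    by (simp add: sum_distrib_left distrib_left)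
  also have "\<dots> \<le> real x * (real I * ln 4 / ln (real y) + 1 / real w)"
    using sum_inverse_primes[OF y] sum_inverse_squares[OF w(1)] by (intro mult_left_mono add_mono) auto
  finally show ?thesis .
qed

text \<open>The order of the quantifiers matters: the bound for the proportion of exceptions is
  O(1/D) however large z is, so D is chosen from \<theta> and C before z.\<close>

lemma eventually_few_non_smooth:
  fixes C :: nat and \<theta> :: real
  assumes C: "0 < C" and \<theta>: "0 < \<theta>"
  shows "\<exists>D0. \<forall>D\<ge>D0. \<exists>z0. \<forall>z\<ge>z0. \<forall>x \<le> C * z ^ D.
     real (card {a\<in>{1..x}. \<not> smooth (z ^ (D - 5)) a}) \<le> \<theta> * real z ^ D"
proof -
  \<comment> \<open>The primes contribute at most 20 / (D - 5), because (I0 + 1) * ln 4 \<le> 20 *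
    ln z and ln y = (D - 5) * ln z. This is to be at most \<theta> / (2 * C), half of the allowance;
    the squares take the other half.\<close>
  obtain D1 :: nat where D1: "80 * real C / \<theta> \<le> real D1" by (meson real_arch_simple)
  have "\<exists>z0. \<forall>z\<ge>z0. \<forall>x \<le> C * z ^ D. real (card {a\<in>{1..x}. \<not> smooth (z ^ (D - 5)) a}) \<le> \<theta> * real z ^ D"
    if D: "D1 + 9 \<le> D" for D
  proof -
    have ev: "\<forall>\<^sub>F z in sequentially. ln (real C) + 5 * ln (real z) + ln 2 \<le> 10 * ln (real z)"
      by real_asymp
    have ev2: "\<forall>\<^sub>F z in sequentially. 2 * real C / \<theta> \<le> real z" by real_asymp
    obtain z1 where z1: "\<And>z. z1 \<le> z \<Longrightarrow> ln (real C) + 5 * ln (real z) + ln 2 \<le> 10 * ln (real z)"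
        "\<And>z. z1 \<le> z \<Longrightarrow> 2 * real C / \<theta> \<le> real z"
      using eventually_conj[OF ev ev2] unfolding eventually_sequentially by auto
    have "real (card {a\<in>{1..x}. \<not> smooth (z ^ (D - 5)) a}) \<le> \<theta> * real z ^ D"
      if z: "max z1 2 \<le> z" and x: "x \<le> C * z ^ D" for z x
    proof -
      have z2: "2 \<le> z" using z by simp
      define y where "y = z ^ (D - 5)"
      have zD: "z ^ D = y * z ^ 5" unfolding y_def using D by (simp flip: power_add)
      have "1 \<le> C * z ^ 5" using C z2 by (simp add: Suc_le_eq)
      then obtain I0 where I0: "2 ^ I0 \<le> C * z ^ 5" "C * z ^ 5 < 2 ^ (I0 + 1)" using ex_power_ivl1[of 2 "C * z ^ 5"] by auto
      have "z ^ 3 \<le> y" unfolding y_def using D z2 by (intro power_increasing) auto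
      moreover have "2 \<le> y"
      proof -
        have "z ^ 1 \<le> y" unfolding y_def using D z2 by (intro power_increasing) auto
        then show ?thesis using z2 by simp
      qed
      moreover have "x \<le> y * 2 ^ (I0 + 1)"
      proof -
        have "x \<le> y * (C * z ^ 5)" using x zD by (simp add: mult_ac)
        also have "\<dots> \<le> y * 2 ^ (I0 + 1)" using I0 by (intro mult_left_mono) auto
        finally show ?thesis .
      qed
      ultimately have "real (card {a\<in>{1..x}. \<not> smooth y a}) \<le> real x * (real (I0 + 1) * ln 4 / ln (real y) + 1 / real z)"
        using card_non_smooth[of z y x "I0 + 1"] z2 by simp
      also have "\<dots> \<le> (real C * real z ^ D) * (\<theta> / (2 * real C) + \<theta> / (2 * real C))"
      proof (intro mult_mono add_mono)
        have "real x \<le> real (C * z ^ D)" using x by (simp only: of_nat_le_iff)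
        then show "real x \<le> real C * real z ^ D" by simp
        have lnz: "0 < ln (real z)" using z2 by simp
        have lny: "ln (real y) = real (D - 5) * ln (real z)" unfolding y_def using z2 by (simp add: ln_realpow)
        have "real (2 ^ I0) \<le> real (C * z ^ 5)" using I0 by (simp only: of_nat_le_iff)
        then have "ln (2 ^ I0) \<le> ln (real C * real z ^ 5)" using C z2 by (subst ln_le_cancel_iff) auto
        then have "real I0 * ln 2 \<le> ln (real C) + 5 * ln (real z)" using C z2 by (simp add: ln_realpow ln_mult)
        then have "real (I0 + 1) * ln 2 \<le> 10 * ln (real z)" using z1(1)[of z] z by (simp add: distrib_right)
        moreover have ln4: "ln (4::real) = 2 * ln 2" using ln_realpow[of "2::real" 2] by simp
        ultimately have "real (I0 + 1) * ln 4 \<le> 20 * ln (real z)" by simp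
        then have "real (I0 + 1) * ln 4 / ln (real y) \<le> 20 * ln (real z) / (real (D - 5) * ln (real z))"
          unfolding lny using D lnz by (intro divide_right_mono) auto
        also have "\<dots> = 20 / real (D - 5)" using lnz by simp
        also have "\<dots> \<le> \<theta> / (2 * real C)"
        proof -
          have "80 * real C / \<theta> \<le> real (D - 5)" using D1 D by linarith
          then have "80 * real C \<le> real (D - 5) * \<theta>" using \<theta> by (simp add: field_simps)
          moreover have "0 < real (D - 5)" using D by simp
          ultimately show ?thesis using C by (simp add: field_simps)
        qed
        finally show "real (I0 + 1) * ln 4 / ln (real y) \<le> \<theta> / (2 * real C)" .
        have "2 * real C / \<theta> \<le> real z" using z1(2)[of z] z by simp
        then show "1 / real z \<le> \<theta> / (2 * real C)" using C \<theta> z2 by (simp add: field_simps)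
        have "2 \<le> y" by fact
        then show "0 \<le> real (I0 + 1) * ln 4 / ln (real y) + 1 / real z" by (intro add_nonneg_nonneg divide_nonneg_nonneg) auto
      qed auto
      also have "\<dots> = \<theta> * real z ^ D" using C by simp
      finally show ?thesis unfolding y_def .
    qed
    then show ?thesis by blast
  qed
  then show ?thesis by blast
qed

section \<open>A lower bound for the number of primes\<close>

lemma sum_mangoldt_le: "(\<Sum>d\<in>{1..N}. mangoldt d) \<le> real (card {p. prime p \<and> p \<le> N}) * ln (real N)"
proof -
  let ?P = "{p. prime p \<and> p \<le> N}"
  let ?Q = "\<lambda>p. {d\<in>{1..N}. \<exists>k. d = p ^ Suc k}"
  have finP: "finite ?P" by (rule finite_subset[of _ "{..N}"]) auto
  have "(\<Sum>d\<in>{1..N}. mangoldt d :: real) \<le> (\<Sum>d\<in>{1..N}. \<Sum>p\<in>?P. if \<exists>k. d = p ^ Suc k then ln (real p) else 0)"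
  proof (rule sum_mono)
    fix d assume d: "d \<in> {1..N}"
    have nn: "0 \<le> (if \<exists>k. d = p ^ Suc k then ln (real p) else 0)" if "p \<in> ?P" for p
      using that prime_ge_1_nat[of p] by auto
    show "mangoldt d \<le> (\<Sum>p\<in>?P. if \<exists>k. d = p ^ Suc k then ln (real p) else 0)"
    proof (cases "primepow d")
      case True
      then obtain p k where pk: "prime p" "0 < k" "d = p ^ k" unfolding primepow_def by blast
      then obtain k' where k': "k = Suc k'" by (cases k) auto
      have "p ^ 1 \<le> p ^ k" using pk prime_gt_0_nat[OF pk(1)] by (intro power_increasing) auto
      then have "p \<in> ?P" using pk d by simp
      have "mangoldt d = (if \<exists>k. d = p ^ Suc k then ln (real p) else 0 :: real)"
        using pk k' by (auto simp: mangoldt_primepow simp del: power_Suc)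
      also have "\<dots> \<le> (\<Sum>p\<in>?P. if \<exists>k. d = p ^ Suc k then ln (real p) else 0)"
        using nn finP \<open>p \<in> ?P\<close> by (intro member_le_sum) auto
      finally show ?thesis .
    next
      case False
      have "0 \<le> (\<Sum>p\<in>?P. if \<exists>k. d = p ^ Suc k then ln (real p) else 0)" by (intro sum_nonneg nn)
      then show ?thesis using False by (simp only: mangoldt_def if_False)
    qed
  qed
  also have "\<dots> = (\<Sum>p\<in>?P. \<Sum>d\<in>{1..N}. if \<exists>k. d = p ^ Suc k then ln (real p) else 0)"
    by (rule sum.swap)
  also have "\<dots> \<le> (\<Sum>p\<in>?P. ln (real N))"
  proof (rule sum_mono)
    fix p assume p: "p \<in> ?P"
    have p2: "2 \<le> p" using p prime_ge_2_nat by auto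
    obtain K where K: "p ^ K \<le> N" "N < p ^ (K + 1)" using ex_power_ivl1[of p N] p p2 by auto
    have "?Q p \<subseteq> (\<lambda>k. p ^ k) ` {1..K}"
    proof
      fix d assume "d \<in> ?Q p"
      then obtain k where k: "d = p ^ Suc k" "d \<le> N" by auto
      then have "p ^ Suc k < p ^ (K + 1)" using K by linarith
      then have "Suc k < K + 1" using p2 by (metis power_less_imp_less_exp Suc_1 Suc_le_lessD)
      then show "d \<in> (\<lambda>k. p ^ k) ` {1..K}" using k by (intro image_eqI[of _ _ "Suc k"]) auto
    qed
    then have "card (?Q p) \<le> card ((\<lambda>k. p ^ k) ` {1..K})" by (intro card_mono) auto
    also have "\<dots> \<le> card {1..K}" by (rule card_image_le) simp
    finally have card: "card (?Q p) \<le> K" by simp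
    have "(\<Sum>d\<in>{1..N}. if \<exists>k. d = p ^ Suc k then ln (real p) else 0) = (\<Sum>d\<in>?Q p. ln (real p))"
      by (rule sum.inter_filter[symmetric]) simp
    also have "\<dots> = real (card (?Q p)) * ln (real p)" by simp
    also have "\<dots> \<le> real K * ln (real p)" using card p2 by (intro mult_right_mono) auto
    also have "\<dots> = ln (real (p ^ K))" using p2 by (simp add: ln_realpow)
    also have "\<dots> \<le> ln (real N)" using K(1) p2 by (intro ln_mono) (simp_all del: of_nat_power)
    finally show "(\<Sum>d\<in>{1..N}. if \<exists>k. d = p ^ Suc k then ln (real p) else 0) \<le> ln (real N)" .
  qed
  finally show ?thesis by simp
qed

lemma prime_count_lower_bound:
  assumes "0 < n"
  shows "real n * ln 4 - ln (2 * real n) \<le> real (card {p. prime p \<and> p \<le> 2 * n}) * ln (2 * real n)"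
proof -
  have "4 ^ n / (2 * real n) \<le> real (2 * n choose n)" using central_binomial_lower_bound[OF assms] by simp
  then have "ln (4 ^ n / (2 * real n)) \<le> ln (real (2 * n choose n))" using assms by (subst ln_le_cancel_iff) auto
  then have "real n * ln 4 - ln (2 * real n) \<le> ln (real (2 * n choose n))"
    using assms by (simp add: ln_div ln_realpow)
  also have "\<dots> \<le> (\<Sum>d\<in>{1..2 * n}. mangoldt d * 1)" unfolding ln_central_binomial
    using div_double_bounds by (intro sum_mono mult_left_mono mangoldt_nonneg) (simp add: algebra_simps)
  also have "\<dots> \<le> real (card {p. prime p \<and> p \<le> 2 * n}) * ln (real (2 * n))"
    using sum_mangoldt_le[of "2 * n"] by simp
  finally show ?thesis by simp
qed

section \<open>The lower bound and a reservoir of very smooth numbers\<close>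

lemma harmonic_upper:
  assumes "1 \<le> m" "m \<le> N"
  shows "(\<Sum>a\<in>{m..N}. 1 / real a) \<le> 1 / real m + ln (real N / real m)"
  using assms(2)
proof (induction N rule: dec_induct)
  case (step N)
  have N: "0 < real N" using step assms by simp
  have "ln (real N / (real N + 1)) \<le> real N / (real N + 1) - 1" using N by (intro ln_le_minus_one) simp
  also have "\<dots> = - (1 / real (Suc N))" using N by (simp add: field_simps)
  finally have "1 / real (Suc N) \<le> ln (real N + 1) - ln (real N)" using N by (simp add: ln_div)
  moreover have "(\<Sum>a\<in>{m..Suc N}. 1 / real a) = (\<Sum>a\<in>{m..N}. 1 / real a) + 1 / real (Suc N)"
    using step.hyps by simp
  ultimately show ?case using step N assms by (simp add: ln_div add.commute)
qed simp

lemma harmonic_lower: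
  assumes "1 \<le> m" "m \<le> N"
  shows "ln ((real N + 1) / real m) \<le> (\<Sum>a\<in>{m..N}. 1 / real a)"
  using assms(2)
proof (induction N rule: dec_induct)
  case base
  have "ln (1 + 1 / real m) \<le> 1 / real m" by (intro ln_add_one_self_le_self) simp
  also have "1 + 1 / real m = (real m + 1) / real m" using assms by (simp add: field_simps)
  finally show ?case by simp
next
  case (step N)
  have N: "0 < real N" using step assms by simp
  have "ln (1 + 1 / (real N + 1)) \<le> 1 / (real N + 1)" by (intro ln_add_one_self_le_self) simp
  moreover have "1 + 1 / (real N + 1) = (real N + 2) / (real N + 1)" using N by (simp add: field_simps)
  ultimately have "ln (real N + 2) - ln (real N + 1) \<le> 1 / (real N + 1)" using N by (simp add: ln_div)
  moreover have "(\<Sum>a\<in>{m..Suc N}. 1 / real a) = (\<Sum>a\<in>{m..N}. 1 / real a) + 1 / real (Suc N)"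
    using step.hyps by simp
  moreover have "ln ((real N + 1) / real m) = ln (real N + 1) - ln (real m)"
    "ln ((real (Suc N) + 1) / real m) = ln (real N + 2) - ln (real m)" using N assms by (simp_all add: ln_div add_ac)
  ultimately show ?case using step by (simp add: add_ac)
qed

lemma sum_interval: "m \<le> N \<Longrightarrow> 2 * (\<Sum>a\<in>{m..N}. real a) = real N * (real N + 1) - real m * (real m - 1)"
  by (induction N rule: dec_induct) (auto simp: algebra_simps)

lemma greedy_subset_sum:
  fixes f :: "'a \<Rightarrow> real"
  assumes "finite A" "\<And>a. a \<in> A \<Longrightarrow> 0 \<le> f a" "\<And>a. a \<in> A \<Longrightarrow> f a \<le> b" "0 < b" "0 \<le> t" "t \<le> sum f A"
  shows "\<exists>S\<subseteq>A. t - b < sum f S \<and> sum f S \<le> t"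
  using assms
proof (induction A arbitrary: t rule: finite_induct)
  case empty
  then show ?case by auto
next
  case (insert x A)
  show ?case
  proof (cases "t \<le> sum f A")
    case True
    have "\<exists>S\<subseteq>A. t - b < sum f S \<and> sum f S \<le> t"
      using insert True by (intro insert.IH) auto
    then obtain S where "S \<subseteq> A" "t - b < sum f S" "sum f S \<le> t" by blast
    then show ?thesis by (intro exI[of _ S]) auto
  next
    case False
    show ?thesis
    proof (cases "t < f x")
      case True
      \<comment> \<open>Here x does not fit but all the rest does: sum f A < t < f x \<le> b, so A
        itself is within b of t.\<close>
      have "0 \<le> sum f A" using insert by (intro sum_nonneg) auto
      then show ?thesis using False True insert.prems(2)[of x] by (intro exI[of _ A]) auto
    next
      case not: False
      have "\<exists>S\<subseteq>A. (t - f x) - b < sum f S \<and> sum f S \<le> t - f x"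
        using insert not by (intro insert.IH) auto
      then obtain S where S: "S \<subseteq> A" "(t - f x) - b < sum f S" "sum f S \<le> t - f x" by blast
      have "x \<notin> S" "finite S" using S insert.hyps finite_subset by auto
      then show ?thesis using S by (intro exI[of _ "insert x S"]) auto
    qed
  qed
qed

text \<open>
  With \<open>X = m e\<^sup>\<beta>\<close> every \<open>a\<close> contributes \<open>a = X\<^sup>2 / a + (a - X\<^sup>2 / a)\<close>, and the bracket is
  negative exactly for \<open>a < X\<close>; so the minimum is attained by a full interval starting at \<open>m\<close>.
\<close>

lemma sum_lower_bound:
  fixes A :: "nat set"
  assumes A: "finite A" "\<And>a. a \<in> A \<Longrightarrow> m \<le> a" and m: "1 \<le> m" and \<beta>: "recip_sum A = \<beta>"
  shows "(exp (2 * \<beta>) - 1) / 2 * (real m)\<^sup>2 - (exp \<beta> + exp (2 * \<beta>)) * real m \<le> real (\<Sum>A)"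
proof -
  define X where "X = real m * exp \<beta>"
  have \<beta>0: "0 \<le> \<beta>" unfolding \<beta>[symmetric] recip_sum_def by (intro sum_nonneg) auto
  have Xm: "real m \<le> X" unfolding X_def using \<beta>0 m by (simp add: mult_le_cancel_left1)
  define N where "N = nat \<lfloor>X\<rfloor>"
  have N: "real N \<le> X" "X < real N + 1" unfolding N_def using Xm by linarith+
  have mN: "m \<le> N" unfolding N_def using Xm by (simp add: le_nat_floor)
  have a0: "0 < real a" if "m \<le> a" for a using that m by simp
  let ?g = "\<lambda>a. real a - X\<^sup>2 / real a"
  have pos: "0 \<le> ?g a" if "N < a" for a
  proof -
    have "X \<le> real a" using that N by linarith
    then have "X\<^sup>2 \<le> real a * real a" using Xm by (auto simp: power2_eq_square intro!: mult_mono)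
    then show ?thesis using a0[of a] mN that by (simp add: field_simps)
  qed
  have neg: "?g a \<le> 0" if "m \<le> a" "a \<le> N" for a
  proof -
    have "real a \<le> X" using that N by linarith
    then have "real a * real a \<le> X\<^sup>2" by (auto simp: power2_eq_square intro!: mult_mono)
    then show ?thesis using a0[of a] that by (simp add: field_simps)
  qed
  have "sum ?g {m..N} \<le> sum ?g (A \<inter> {m..N})"
  proof -
    have "sum ?g {m..N} = sum ?g (A \<inter> {m..N}) + sum ?g ({m..N} - A)"
      by (subst sum.union_disjoint[symmetric]) (auto intro!: sum.cong)
    moreover have "sum ?g ({m..N} - A) \<le> 0" using neg by (intro sum_nonpos) auto
    ultimately show ?thesis by linarith
  qed
  also have "\<dots> \<le> sum ?g A"
  proof -
    have "sum ?g A = sum ?g (A \<inter> {m..N}) + sum ?g (A - {m..N})"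
      using A(1) by (subst sum.union_disjoint[symmetric]) (auto intro!: sum.cong)
    moreover have "0 \<le> sum ?g (A - {m..N})" using pos A(2) by (intro sum_nonneg) force
    ultimately show ?thesis by linarith
  qed
  also have "\<dots> = real (\<Sum>A) - X\<^sup>2 * \<beta>"
    unfolding \<beta>[symmetric] recip_sum_def by (simp add: sum_subtractf sum_distrib_left)
  finally have 1: "sum ?g {m..N} + X\<^sup>2 * \<beta> \<le> real (\<Sum>A)" by simp
  have g: "sum ?g {m..N} = (\<Sum>a\<in>{m..N}. real a) - X\<^sup>2 * (\<Sum>a\<in>{m..N}. 1 / real a)"
    by (simp add: sum_subtractf sum_distrib_left)
  \<comment> \<open>The error 1 / m of the harmonic sum, multiplied by X^2, is exp (2 * \<beta>) *
    m. This is one part of the linear term; the other, exp \<beta> * m, absorbs the rounding of X to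
    N.\<close>
  have "X\<^sup>2 * (\<Sum>a\<in>{m..N}. 1 / real a) \<le> X\<^sup>2 * (1 / real m + \<beta>)"
  proof (rule mult_left_mono)
    have "ln (real N / real m) \<le> ln (exp \<beta>)"
      using N(1) m mN unfolding X_def by (intro ln_mono) (auto simp: field_simps)
    then show "(\<Sum>a\<in>{m..N}. 1 / real a) \<le> 1 / real m + \<beta>" using harmonic_upper[OF m mN] by simp
  qed simp
  then have 2: "(\<Sum>a\<in>{m..N}. real a) - X\<^sup>2 * (1 / real m + \<beta>) \<le> sum ?g {m..N}" unfolding g by linarith
  have "(X - 1) * X \<le> real N * (real N + 1)" using N Xm m by (intro mult_mono) auto
  then have 3: "(X\<^sup>2 - X - (real m)\<^sup>2) / 2 \<le> (\<Sum>a\<in>{m..N}. real a)"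
    using sum_interval[OF mN] m by (simp add: power2_eq_square algebra_simps)
  define G where "G = exp (2 * \<beta>)"
  have X2: "X\<^sup>2 = G * (real m)\<^sup>2" unfolding X_def G_def
    by (simp add: power_mult_distrib mult.commute flip: exp_double)
  have X2m: "X\<^sup>2 * (1 / real m) = G * real m" unfolding X2 using m by (simp add: power2_eq_square)
  have "(\<Sum>a\<in>{m..N}. real a) - (G * real m + X\<^sup>2 * \<beta>) \<le> sum ?g {m..N}"
    using 2 unfolding distrib_left X2m .
  then have "(\<Sum>a\<in>{m..N}. real a) - G * real m \<le> real (\<Sum>A)" using 1 by argo
  moreover have "(G * (real m)\<^sup>2 - X - (real m)\<^sup>2) / 2 \<le> (\<Sum>a\<in>{m..N}. real a)" using 3 unfolding X2 .
  ultimately have "(G * (real m)\<^sup>2 - X - (real m)\<^sup>2) / 2 - G * real m \<le> real (\<Sum>A)"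
    by argo
  moreover have "0 \<le> X" using Xm by linarith
  moreover have "(G - 1) / 2 * (real m)\<^sup>2 - (exp \<beta> + G) * real m
      = (G * (real m)\<^sup>2 - (real m)\<^sup>2) / 2 - X - G * real m"
    unfolding X_def by (simp add: algebra_simps diff_divide_distrib)
  ultimately show ?thesis unfolding G_def[symmetric] by argo
qed

section \<open>Products of three primes\<close>

lemma prime_power_dvd_prod_primes:
  fixes T :: "nat set"
  assumes T: "finite T" "\<And>q. q \<in> T \<Longrightarrow> prime q" and p: "prime p" "p ^ k dvd \<Prod>T" "k \<noteq> 0"
  shows "k = 1 \<and> p \<in> T"
proof -
  obtain k' where k': "k = Suc k'" using p(3) by (cases k) auto
  then have "p dvd \<Prod>T" using p(2) dvd_trans[of p "p ^ k"] by simp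
  then have "\<exists>q\<in>T. p dvd q" using T(1) p(1) by (simp add: prime_dvd_prod_iff)
  then have pT: "p \<in> T" using T(2) p(1) primes_dvd_imp_eq by blast
  have "k = 1"
  proof (rule ccontr)
    assume "k \<noteq> 1"
    then obtain k'' where "k = Suc (Suc k'')" using k' by (cases k') auto
    then have "p * p dvd \<Prod>T" using p(2) dvd_trans[of "p * p" "p ^ k"] by (simp add: mult.assoc[symmetric])
    moreover have "\<Prod>T = p * \<Prod>(T - {p})" using T(1) pT by (simp add: prod.remove)
    ultimately have "p dvd \<Prod>(T - {p})" using prime_gt_0_nat[OF p(1)] by simp
    then have "\<exists>q\<in>T - {p}. p dvd q" using T(1) p(1) by (simp add: prime_dvd_prod_iff)
    then show False using T(2) p(1) primes_dvd_imp_eq by blast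
  qed
  then show ?thesis using pT by blast
qed

text \<open>Powers of two are excluded because they are reserved for the binary expansion of the
  last remainder; nice sets are then disjoint from it automatically.\<close>

definition nice :: "nat \<Rightarrow> nat \<Rightarrow> bool" where
  "nice y a \<longleftrightarrow> smooth y a \<and> (\<forall>l. a \<noteq> 2 ^ l)"

text \<open>Three distinct odd primes up to Y = z ^ d have a product of at most Y^3 \<le> N, which a
  power of two moves into [N, 2 * N]; the odd part recovers the three primes. There are at least of
  order (Y / ln Y)^3 such numbers, each of weight at least 1 / (2 * N) with N \<le> C * Y^3, so the
  mass is at least of order (ln z)^-3, more than 4 / z.\<close>

lemma smooth_reservoir:
  fixes d C :: nat
  assumes d: "0 < d" and C: "0 < C"
  shows "\<exists>z0. \<forall>z\<ge>z0. \<forall>N. z ^ (3 * d) \<le> N \<longrightarrow> N \<le> C * z ^ (3 * d) \<longrightarrow>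
     (\<exists>F\<subseteq>{N..2 * N}. (\<forall>a\<in>F. nice (z ^ d) a) \<and> 4 / real z \<le> recip_sum F)"
proof -
  have "\<forall>\<^sub>F Y :: real in at_top. Y / (4 * ln Y) + 2 \<le> ((Y / 2 - 1) - ln Y) / ln Y \<and> 3 \<le> Y / (4 * ln Y)"
    by (intro eventually_conj; real_asymp)
  then obtain Y0 :: real where Y0: "\<And>Y. Y0 \<le> Y \<Longrightarrow> Y / (4 * ln Y) + 2 \<le> ((Y / 2 - 1) - ln Y) / ln Y \<and> 3 \<le> Y / (4 * ln Y)"
    unfolding eventually_at_top_linorder by blast
  \<comment> \<open>13824 = 8 * 12^3. The 12 comes from (card P / 3)^3 with card P \<ge> Y / (4 * ln
    Y), and the 8 from asking for mass 4 / z at weight 1 / (2 * N).\<close>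
  define K where "K = 13824 * real C * real d ^ 3"
  have "\<forall>\<^sub>F z :: real in at_top. K * ln z ^ 3 \<le> z" by real_asymp
  then obtain z1 :: real where z1: "\<And>z. z1 \<le> z \<Longrightarrow> K * ln z ^ 3 \<le> z"
    unfolding eventually_at_top_linorder by blast
  define z0 where "z0 = nat \<lceil>max Y0 z1\<rceil> + 4"
  show ?thesis
  proof (intro exI[of _ z0] allI impI)
    fix z N assume z: "z0 \<le> z" and N: "z ^ (3 * d) \<le> N" "N \<le> C * z ^ (3 * d)"
    have zz: "4 \<le> z" "Y0 \<le> real z" "z1 \<le> real z" using z unfolding z0_def by linarith+
    define Y where "Y = z ^ d"
    have "z ^ 1 \<le> Y" unfolding Y_def using d zz by (intro power_increasing) auto
    then have zY: "z \<le> Y" by simp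
    then have Y4: "4 \<le> Y" "Y0 \<le> real Y" using zz by linarith+
    define P where "P = {p. prime p \<and> odd p \<and> p \<le> Y}"
    have finP: "finite P" unfolding P_def by (rule finite_subset[of _ "{..Y}"]) auto
    have P3: "real Y / (4 * ln (real Y)) \<le> real (card P)"
    proof -
      define n where "n = Y div 2"
      have n: "0 < n" "2 * n \<le> Y" "real Y / 2 - 1 \<le> real n" unfolding n_def using Y4 by linarith+
      have lnpos: "0 < ln (2 * real n)" using n Y4 by (simp add: n_def)
      have lnle: "ln (2 * real n) \<le> ln (real Y)" using n by (intro ln_mono) linarith+
      have "{p. prime p \<and> p \<le> 2 * n} \<subseteq> insert 2 P" unfolding P_def using n
        by (auto dest: primes_dvd_imp_eq[OF two_is_prime_nat])
      then have "card {p. prime p \<and> p \<le> 2 * n} \<le> card (insert 2 P)" using finP by (intro card_mono) auto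
      also have "\<dots> \<le> card P + 1" using finP by (simp add: card_insert_if)
      finally have c: "real (card {p. prime p \<and> p \<le> 2 * n}) \<le> real (card P) + 1" by linarith
      have "real n * ln 4 - ln (2 * real n) \<le> real (card {p. prime p \<and> p \<le> 2 * n}) * ln (2 * real n)"
        by (rule prime_count_lower_bound[OF n(1)])
      also have "\<dots> \<le> (real (card P) + 1) * ln (real Y)" using c lnle lnpos by (intro mult_mono) auto
      finally have "real n * ln 4 - ln (2 * real n) \<le> (real (card P) + 1) * ln (real Y)" .
      moreover have "real n * 1 \<le> real n * ln 4" using exp_le by (intro mult_left_mono) (auto simp: ln_ge_iff)
      ultimately have "(real Y / 2 - 1) - ln (real Y) \<le> (real (card P) + 1) * ln (real Y)"
        using lnle n(3) by linarith
      moreover have "0 < ln (real Y)" using lnle lnpos by linarith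
      ultimately have "((real Y / 2 - 1) - ln (real Y)) / ln (real Y) \<le> real (card P) + 1"
        by (simp add: divide_le_eq)
      then show ?thesis using Y0[OF Y4(2)] by linarith
    qed
    define TT where "TT = {T. T \<subseteq> P \<and> card T = 3}"
    have T: "finite T" "T \<subseteq> P" "card T = 3" if "T \<in> TT" for T
      using that finP finite_subset unfolding TT_def by auto
    have Todd: "odd (\<Prod>T)" if "T \<in> TT" for T
    proof
      assume "even (\<Prod>T)"
      then have "\<exists>q\<in>T. 2 dvd q" using prime_dvd_prod_iff[OF T(1)[OF that] two_is_prime_nat, of "\<lambda>q. q"] by simp
      then obtain q where q: "q \<in> T" "even q" by blast
      have "q \<in> P" using T(2)[OF that] q(1) by (rule subsetD)
      then show False using q(2) unfolding P_def by simp
    qed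
    have Tpos: "0 < \<Prod>T" if "T \<in> TT" for T using Todd[OF that] by (cases "\<Prod>T") auto
    have Tle: "\<Prod>T \<le> N" if "T \<in> TT" for T
    proof -
      have "\<Prod>T \<le> (\<Prod>q\<in>T. Y)" using T[OF that] unfolding P_def by (intro prod_mono) auto
      also have "\<dots> = z ^ (3 * d)" using T[OF that] unfolding Y_def by (simp add: mult.commute flip: power_mult)
      finally show ?thesis using N by linarith
    qed
    define i where "i T = (SOME i. N \<le> \<Prod>T * 2 ^ i \<and> \<Prod>T * 2 ^ i < 2 * N)" for T
    have i: "N \<le> \<Prod>T * 2 ^ i T \<and> \<Prod>T * 2 ^ i T < 2 * N" if "T \<in> TT" for T
      unfolding i_def by (rule someI_ex) (rule power2_scale[OF Tpos[OF that] Tle[OF that]])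
    define f where "f T = \<Prod>T * 2 ^ i T" for T
    have prodinj: "T \<subseteq> T'" if "T \<in> TT" "T' \<in> TT" "\<Prod>T = \<Prod>T'" for T T'
    proof
      fix q assume q: "q \<in> T"
      then have "prime q" using T(2)[OF that(1)] unfolding P_def by auto
      have "q ^ 1 dvd \<Prod>T'" using q T(1)[OF that(1)] that(3) by (metis dvd_prodI power_one_right)
      then show "q \<in> T'" using prime_power_dvd_prod_primes[OF T(1)[OF that(2)] _ \<open>prime q\<close>, of 1]
        T(2)[OF that(2)] unfolding P_def by auto
    qed
    have inj: "inj_on f TT"
    proof (rule inj_onI)
      fix T T' assume TT': "T \<in> TT" "T' \<in> TT" "f T = f T'"
      then have "\<Prod>T = \<Prod>T'" using odd_times_power2_eq[OF Todd Todd] unfolding f_def by blast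
      then show "T = T'" using prodinj TT' by (intro equalityI) auto
    qed
    define F where "F = f ` TT"
    have FN: "F \<subseteq> {N..2 * N}" unfolding F_def f_def using i by fastforce
    have nice: "nice (z ^ d) a" if aF: "a \<in> F" for a
    proof -
      obtain T where TT': "T \<in> TT" "a = \<Prod>T * 2 ^ i T" using aF unfolding F_def f_def by blast
      have "p ^ k \<le> z ^ d" if pk: "prime p" "odd p" "p ^ k dvd a" for p k
      proof (cases "k = 0")
        case True
        then show ?thesis using zz by simp
      next
        case False
        have "coprime (p ^ k) (2 ^ i T)" using pk by simp
        then have "p ^ k dvd \<Prod>T" using pk(3) unfolding TT'(2) by (simp only: coprime_dvd_mult_left_iff)
        then have "k = 1 \<and> p \<in> T" using prime_power_dvd_prod_primes[OF T(1)[OF TT'(1)] _ pk(1) _ False]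
          T(2)[OF TT'(1)] unfolding P_def by auto
        then show ?thesis using T(2)[OF TT'(1)] unfolding P_def Y_def by auto
      qed
      moreover have "a \<noteq> 2 ^ l" for l
      proof
        assume "a = 2 ^ l"
        then have "\<Prod>T = 1" using odd_times_power2_eq[OF Todd[OF TT'(1)], of 1 "i T" l] TT'(2) by simp
        moreover obtain q where "q \<in> T" using T(3)[OF TT'(1)] by fastforce
        moreover have "prime q" using \<open>q \<in> T\<close> T(2)[OF TT'(1)] unfolding P_def by auto
        moreover have "q dvd \<Prod>T" using dvd_prodI[OF T(1)[OF TT'(1)] \<open>q \<in> T\<close>, of "\<lambda>q. q"] by simp
        ultimately show False by auto
      qed
      ultimately show ?thesis unfolding nice_def smooth_def by blast
    qed
    have N0: "0 < N" using N(1) zz by (metis gr0I le_zero_eq power_eq_0_iff not_numeral_le_zero)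
    have "card F = card P choose 3" unfolding F_def TT_def[symmetric]
      using card_image[OF inj] n_subsets[OF finP, of 3] unfolding TT_def by simp
    have L: "0 < ln (real z)" using zz by simp
    have lnY: "ln (real Y) = real d * ln (real z)" unfolding Y_def using zz by (simp add: ln_realpow)
    have z3: "K * ln (real z) ^ 3 \<le> real z" using z1 zz by blast
    have Yl: "3 \<le> card P" using P3 Y0[OF Y4(2)] by linarith
    have "(real (card P) / 3) ^ 3 \<le> real (card F)"
      unfolding \<open>card F = card P choose 3\<close> using binomial_ge_n_over_k_pow_k[OF Yl, where 'a = real] by simp
    moreover have "(real Y / (4 * ln (real Y)) / 3) ^ 3 \<le> (real (card P) / 3) ^ 3"
      using P3 L lnY by (intro power_mono divide_right_mono) auto
    moreover have "(real Y / (4 * ln (real Y)) / 3) ^ 3 = real Y ^ 3 / (1728 * real d ^ 3 * ln (real z) ^ 3)"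
      unfolding lnY by (simp add: power_divide power_mult_distrib)
    moreover have "8 * real C * real Y ^ 3 / real z \<le> real Y ^ 3 / (1728 * real d ^ 3 * ln (real z) ^ 3)"
    proof -
      have "8 * real C * (1728 * real d ^ 3 * ln (real z) ^ 3) \<le> real z" using z3 unfolding K_def by simp
      then have "real Y ^ 3 * (8 * real C * (1728 * real d ^ 3 * ln (real z) ^ 3)) \<le> real Y ^ 3 * real z"
        by (rule mult_left_mono) simp
      then show ?thesis using L d zz by (simp add: field_simps)
    qed
    ultimately have cF: "8 * real C * real Y ^ 3 / real z \<le> real (card F)" by linarith
    have "real N \<le> real (C * z ^ (3 * d))" using N(2) by (simp only: of_nat_le_iff)
    also have "\<dots> = real C * real Y ^ 3" unfolding Y_def by (simp add: mult.commute flip: power_mult)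
    finally have NC: "real N \<le> real C * real Y ^ 3" .
    have "8 * real N / real z \<le> 8 * (real C * real Y ^ 3) / real z"
      using NC by (intro divide_right_mono mult_left_mono) auto
    then have cF2: "8 * real N / real z \<le> real (card F)" using cF by simp
    have "4 / real z = (8 * real N / real z) * (1 / (2 * real N))" using N0 zz by simp
    also have "\<dots> \<le> real (card F) * (1 / (2 * real N))" using cF2 by (intro mult_right_mono) auto
    also have "\<dots> = (\<Sum>a\<in>F. 1 / (2 * real N))" by simp
    also have "\<dots> \<le> recip_sum F" unfolding recip_sum_def
    proof (rule sum_mono)
      fix a assume "a \<in> F"
      then have "a \<le> 2 * N" "N \<le> a" using FN by auto
      then show "1 / (2 * real N) \<le> 1 / real a" using N0 by (intro divide_left_mono) auto
    qed
    finally show "\<exists>F\<subseteq>{N..2 * N}. (\<forall>a\<in>F. nice (z ^ d) a) \<and> 4 / real z \<le> recip_sum F"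
      using FN nice by blast
  qed
qed

section \<open>Completing a reciprocal sum\<close>

text \<open>Every reciprocal in the binary expansion is at most r < 1 / m, so its denominator
  exceeds m. The denominators are distinct powers of two up to 2 ^ e, which bounds their sum by a
  geometric series.\<close>

lemma denom_smooth_zero:
  fixes e m :: nat and r :: real
  assumes r: "denom_smooth e 0 r" "0 \<le> r" "r < 1 / real m" and m: "0 < m"
  shows "\<exists>E. finite E \<and> (\<forall>a\<in>E. m \<le> a \<and> (\<exists>l. a = 2 ^ l)) \<and> recip_sum E = r \<and> \<Sum>E \<le> 2 * 2 ^ e"
proof -
  obtain u where u: "2 ^ e * r = of_int u" using r(1) unfolding denom_smooth_def by (auto elim: Ints_cases)
  have "0 \<le> real_of_int u" using r(2) u by (metis mult_nonneg_nonneg zero_le_numeral zero_le_power)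
  then obtain s where s: "u = int s" by (metis nonneg_int_cases of_int_0_le_iff)
  have rs: "r = real s / 2 ^ e" using u unfolding s by (simp add: field_simps)
  show ?thesis
  proof (cases "s = 0")
    case True
    then show ?thesis using rs by (intro exI[of _ "{}"]) (auto simp: recip_sum_def)
  next
    case False
    then obtain l where l: "2 ^ l \<le> s" "s < 2 ^ (l + 1)" using ex_power_ivl1[of 2 s] by auto
    have "real s * real m < 2 ^ e" using r(3) m unfolding rs by (simp add: field_simps)
    then have "real (s * m) < real (2 ^ e)" by simp
    then have sm: "s * m < 2 ^ e" by (simp only: of_nat_less_iff)
    have "2 ^ l * 1 \<le> s * m" using l m by (intro mult_mono) auto
    then have "(2::nat) ^ l < 2 ^ e" using sm by linarith
    then have le: "l < e" by simp
    obtain E where E: "E \<subseteq> (\<lambda>i. 1 * 2 ^ i) ` {e - (l + 1)<..e}" "real s / (real 1 * 2 ^ e) = recip_sum E"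
      using binary_recip_sum[OF l(2), of e 1] le by auto
    have fin: "finite E" using finite_subset[OF E(1)] by simp
    have "m \<le> a \<and> (\<exists>l. a = 2 ^ l)" if "a \<in> E" for a
    proof -
      have "a \<in> (\<lambda>i. 1 * 2 ^ i) ` {e - (l + 1)<..e}" using E(1) that by blast
      then obtain i where i: "a = 2 ^ i" "e - (l + 1) < i" by auto
      then have "e \<le> l + i" by linarith
      then have "(2::nat) ^ e \<le> 2 ^ (l + i)" by (intro power_increasing) auto
      then have "s * m < 2 ^ l * 2 ^ i" using sm by (simp add: power_add)
      moreover have "2 ^ l * m \<le> s * m" using l by (intro mult_right_mono) auto
      ultimately have "2 ^ l * m < 2 ^ l * 2 ^ i" by linarith
      then show ?thesis using i by auto
    qed
    moreover have "\<Sum>E \<le> 2 * 2 ^ e"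
    proof -
      have "E \<subseteq> (\<lambda>i. 2 ^ i) ` {..e}" using E(1) by auto
      then have "\<Sum>E \<le> \<Sum>((\<lambda>i. 2 ^ i) ` {..e})" by (intro sum_mono2) auto
      also have "\<dots> = (\<Sum>i\<le>e. 2 ^ i)" by (subst sum.reindex) (auto simp: inj_on_def)
      also have "\<dots> < 2 * 2 ^ e" by (induction e) auto
      finally show ?thesis by simp
    qed
    ultimately show ?thesis using E(2) fin rs by (intro exI[of _ E]) auto
  qed
qed

lemma recip_sum_nonneg: "0 \<le> recip_sum E"
  unfolding recip_sum_def by (intro sum_nonneg) auto

lemma recip_sum_le:
  assumes "finite E" "\<And>a. a \<in> E \<Longrightarrow> V \<le> a" "0 < V" "card E \<le> c"
  shows "recip_sum E \<le> real c / real V"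
proof -
  have "recip_sum E \<le> (\<Sum>a\<in>E. 1 / real V)" unfolding recip_sum_def
  proof (rule sum_mono)
    fix a assume "a \<in> E"
    then have "V \<le> a" by (rule assms(2))
    then show "1 / real a \<le> 1 / real V" using assms(3) by (intro divide_left_mono) auto
  qed
  also have "\<dots> = real (card E) / real V" by simp
  also have "\<dots> \<le> real c / real V" using assms(4) by (intro divide_right_mono) auto
  finally show ?thesis .
qed

lemma sum_le_card_mult: "(\<And>a. a \<in> E \<Longrightarrow> a \<le> b) \<Longrightarrow> card E \<le> c \<Longrightarrow> \<Sum>E \<le> c * (b::nat)"
  using sum_bounded_above[of E "\<lambda>a. a" b] by (auto intro: order_trans mult_right_mono)

text \<open>The order of the stages is forced. Cancelling the prime powers above z ^ d perturbs r by
  up to z^-3, so r can be brought down to the order of 1 / m only afterwards, and only with elements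
  that bring no such prime power back: those of the reservoir. Cancelling the remaining prime powers
  perturbs r by at most 1 / (4 * m), after which r is below 1 / m with a power of two as
  denominator.\<close>

lemma completion:
  fixes d C z m N e :: nat and r :: real
  assumes d: "7 \<le> d" and z: "2 * C + 8 \<le> z"
    and cov: "\<And>p. prime p \<Longrightarrow> odd p \<Longrightarrow> p \<le> z ^ (3 * d) \<Longrightarrow> covers p z"
    and res: "\<exists>F\<subseteq>{N..2 * N}. (\<forall>a\<in>F. nice (z ^ d) a) \<and> 4 / real z \<le> recip_sum F"
    and m: "z ^ (3 * d) \<le> m" "m \<le> 2 * z ^ (3 * d)"
    and N: "4 * m \<le> N" "N \<le> C * z ^ (3 * d)"
    and e: "2 * z ^ (4 * d + 4) \<le> 2 ^ e" "2 ^ e \<le> 4 * z ^ (4 * d + 4)"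
    and r: "denom_smooth e (z ^ (3 * d - 4)) r" "1 / real z \<le> r" "r \<le> 2 / real z"
  shows "\<exists>E. finite E \<and> (\<forall>a\<in>E. m \<le> a \<and> (N \<le> a \<or> (\<exists>l. a = 2 ^ l))) \<and> recip_sum E = r \<and>
     \<Sum>E * z \<le> (8 * C\<^sup>2 + 4 * C + 12) * z ^ (6 * d)"
proof -
  define Z where "Z = z ^ (3 * d - 4)"
  define Y where "Y = z ^ (3 * d)"
  have z8: "8 \<le> z" using z by simp
  have YZ: "Y = Z * z ^ 4" unfolding Y_def Z_def using d by (simp flip: power_add)
  have Z0: "0 < Z" unfolding Z_def using z8 by simp
  have Y0: "0 < Y" unfolding Y_def using z8 by simp
  have m0: "0 < m" using m(1) Y0 unfolding Y_def by linarith
  have mN: "m \<le> N" using N by linarith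
  have N0: "0 < N" using m0 mN by linarith
  have powle: "z ^ i \<le> z ^ j" if "i \<le> j" for i j using that z8 by (intro power_increasing) auto
  have "Z \<le> Y" unfolding Z_def Y_def by (intro powle) simp
  have YN: "Y \<le> N" using m mN unfolding Y_def by linarith
  \<comment> \<open>Just beyond the reservoir {N..2 * N}. At most Z * z elements above Y = Z * z ^ 4
    have mass at most z^-3.\<close>
  define V1 where "V1 = 2 * N + 1"
  have v1: "2 * V1 * z \<le> 2 ^ e"
  proof -
    have "V1 \<le> (2 * C + 1) * Y" using N(2) Y0 unfolding V1_def Y_def[symmetric] by (simp add: algebra_simps)
    also have "\<dots> \<le> z * Y" using z by (intro mult_right_mono) auto
    finally have "2 * V1 * z \<le> 2 * (z * Y) * z" by simp
    also have "\<dots> = 2 * z ^ (3 * d + 2)" unfolding Y_def by (simp add: power_add power2_eq_square mult_ac)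
    also have "\<dots> \<le> 2 * z ^ (4 * d + 4)" by (intro mult_left_mono powle) auto
    finally show ?thesis using e(1) by linarith
  qed
  have "\<exists>E. finite E \<and> card E \<le> (Z - z ^ d) * z \<and> E \<subseteq> {V1..2 * V1 * z} \<and>
     (\<forall>a\<in>E. a dvd 2 ^ e * odd_lcm Z \<and> \<not> a dvd 2 ^ e * odd_lcm (z ^ d)) \<and>
     denom_smooth e (z ^ d) (r - recip_sum E)"
  proof (rule remove_prime_powers)
    show "z ^ d \<le> Z" unfolding Z_def using d by (intro powle) simp
    show "Z \<le> V1" using \<open>Z \<le> Y\<close> YN unfolding V1_def by linarith
    show "covers p z" if "prime p" "odd p" "p \<le> Z" for p
      using that \<open>Z \<le> Y\<close> unfolding Y_def by (intro cov) auto
  qed (use r(1) v1 z8 in \<open>auto simp: Z_def\<close>)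
  then obtain E1 where E1: "finite E1" "card E1 \<le> (Z - z ^ d) * z" "E1 \<subseteq> {V1..2 * V1 * z}"
     "\<forall>a\<in>E1. a dvd 2 ^ e * odd_lcm Z \<and> \<not> a dvd 2 ^ e * odd_lcm (z ^ d)"
     "denom_smooth e (z ^ d) (r - recip_sum E1)" by (elim exE conjE)
  define r1 where "r1 = r - recip_sum E1"
  have cE1: "card E1 \<le> Z * z" using E1(2) by (meson diff_le_self le_trans mult_le_mono1)
  have "recip_sum E1 \<le> real (Z * z) / real V1" using E1(1,3) cE1 by (intro recip_sum_le) (auto simp: V1_def)
  also have "\<dots> \<le> real (Z * z) / real Y" using YN Y0 unfolding V1_def by (intro divide_left_mono) auto
  also have "\<dots> = 1 / real z ^ 3" using Z0 z8 unfolding YZ by (simp add: power4_eq_xxxx power3_eq_cube)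
  finally have rE1: "recip_sum E1 \<le> 1 / real z ^ 3" .
  have z3: "1 / real z ^ 3 \<le> 1 / (2 * real z)"
  proof -
    have "2 * real z \<le> real z * real z" using z8 by (intro mult_right_mono) auto
    also have "\<dots> * 1 \<le> real z * real z * real z" using z8 by (intro mult_left_mono) auto
    finally show ?thesis using z8 by (intro divide_left_mono) (auto simp: power3_eq_cube)
  qed
  have r1l: "1 / (2 * real z) \<le> r1"
  proof -
    have "1 / real z = 1 / (2 * real z) + 1 / (2 * real z)" by simp
    then show ?thesis unfolding r1_def using rE1 z3 r(2) by linarith
  qed
  have r1u: "r1 \<le> 2 / real z" unfolding r1_def using r(3) recip_sum_nonneg[of E1] by linarith
  obtain F0 where F0: "F0 \<subseteq> {N..2 * N}" "\<forall>a\<in>F0. nice (z ^ d) a" "4 / real z \<le> recip_sum F0"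
    using res by blast
  \<comment> \<open>The reserve 1 / (4 * m) pays for E2, so that the remainder r3 stays nonnegative;
    since 1 / N \<le> 1 / (4 * m), the greedy error keeps r2 below 1 / m.\<close>
  define t where "t = r1 - 1 / (4 * real m)"
  have zY: "z \<le> Y" using powle[of 1 "3 * d"] d unfolding Y_def by simp
  have zm: "z \<le> m" using zY m(1) unfolding Y_def by linarith
  have t0: "0 \<le> t"
  proof -
    have "1 / (4 * real m) \<le> 1 / (2 * real z)" using zm z8 by (intro divide_left_mono) auto
    then show ?thesis unfolding t_def using r1l by linarith
  qed
  have tu: "t \<le> recip_sum F0"
  proof -
    have "t \<le> 2 / real z" unfolding t_def using r1u by (smt (verit) divide_nonneg_nonneg of_nat_0_le_iff)
    also have "\<dots> \<le> 4 / real z" by (intro divide_right_mono) auto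
    finally show ?thesis using F0(3) by linarith
  qed
  have "\<exists>F\<subseteq>F0. t - 1 / real N < (\<Sum>a\<in>F. 1 / real a) \<and> (\<Sum>a\<in>F. 1 / real a) \<le> t"
  proof (rule greedy_subset_sum)
    show "finite F0" using finite_subset[OF F0(1)] by simp
    show "1 / real a \<le> 1 / real N" if "a \<in> F0" for a
      using that F0(1) N0 by (intro divide_left_mono) auto
    show "t \<le> (\<Sum>a\<in>F0. 1 / real a)" using tu unfolding recip_sum_def .
  qed (use N0 t0 in auto)
  then obtain F where F: "F \<subseteq> F0" "t - 1 / real N < recip_sum F" "recip_sum F \<le> t"
    unfolding recip_sum_def by blast
  have finF: "finite F" using finite_subset[OF subset_trans[OF F(1) F0(1)]] by simp
  have FN: "N \<le> a \<and> a \<le> 2 * N" if "a \<in> F" for a using that F(1) F0(1) by auto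
  define r2 where "r2 = r1 - recip_sum F"
  have r2l: "1 / (4 * real m) \<le> r2" unfolding r2_def using F(3) unfolding t_def by linarith
  have r2u: "r2 < 1 / real m"
  proof -
    have "1 / real N \<le> 1 / (4 * real m)" using N(1) m0 by (intro divide_left_mono) auto
    then have "r2 < 1 / (4 * real m) + 1 / (4 * real m)" unfolding r2_def using F(2) unfolding t_def by linarith
    also have "\<dots> \<le> 1 / real m" using m0 by (simp add: field_simps)
    finally show ?thesis .
  qed
  have NE: "2 * N \<le> 2 ^ e"
  proof -
    have "2 * N * 1 \<le> 2 * V1 * z" using z8 unfolding V1_def by (intro mult_mono) auto
    then show ?thesis using v1 by linarith
  qed
  have Fdvd: "a dvd 2 ^ e * odd_lcm (z ^ d)" if "a \<in> F" for a
  proof (rule smooth_dvd)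
    show "smooth (z ^ d) a" using F0(2) F(1) that unfolding nice_def by blast
    show "0 < a" "a \<le> 2 ^ e" using FN[OF that] N0 NE by linarith+
  qed
  have d2: "denom_smooth e (z ^ d) r2"
    unfolding r2_def r1_def by (intro denom_smooth_diff E1(5) denom_smooth_recip_sum Fdvd)
  \<comment> \<open>At most z ^ (d + 1) elements of this size have mass at most z ^ -(3 * d + 2)
    \<le> 1 / (4 * m), and their sum is at most 2 * z ^ (5 * d + 5), of lower order than z ^ (6 *
    d). The bound 2 * V2 * z accounts for the size of 2 ^ e.\<close>
  define V2 where "V2 = z ^ (4 * d + 3)"
  have v2: "2 * V2 * z \<le> 2 ^ e" using e(1) unfolding V2_def by (simp add: power_add eval_nat_numeral mult_ac)
  have "\<exists>E. finite E \<and> card E \<le> (z ^ d - 0) * z \<and> E \<subseteq> {V2..2 * V2 * z} \<and>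
     (\<forall>a\<in>E. a dvd 2 ^ e * odd_lcm (z ^ d) \<and> \<not> a dvd 2 ^ e * odd_lcm 0) \<and>
     denom_smooth e 0 (r2 - recip_sum E)"
  proof (rule remove_prime_powers)
    show "z ^ d \<le> V2" unfolding V2_def by (intro powle) simp
    show "covers p z" if "prime p" "odd p" "p \<le> z ^ d" for p
      using that powle[of d "3 * d"] by (intro cov) auto
  qed (use d2 v2 z8 in auto)
  then obtain E2 where E2: "finite E2" "card E2 \<le> z ^ d * z" "E2 \<subseteq> {V2..2 * V2 * z}"
     "\<forall>a\<in>E2. a dvd 2 ^ e * odd_lcm (z ^ d) \<and> \<not> a dvd 2 ^ e * odd_lcm 0"
     "denom_smooth e 0 (r2 - recip_sum E2)" by (auto elim!: exE conjE)
  define r3 where "r3 = r2 - recip_sum E2"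
  have V20: "0 < V2" unfolding V2_def using z8 by simp
  have rE2: "recip_sum E2 \<le> 1 / (4 * real m)"
  proof -
    have "recip_sum E2 \<le> real (z ^ d * z) / real V2" using E2(1,2,3) V20 by (intro recip_sum_le) auto
    also have "real V2 = real (z ^ d * z) * real (z ^ (3 * d) * z\<^sup>2)"
      proof -
      have "4 * d + 3 = (d + 1) + (3 * d + 2)" by simp
      then show ?thesis unfolding V2_def by (simp only: power_add power_one_right of_nat_mult)
    qed
    also have "real (z ^ d * z) / (real (z ^ d * z) * real (z ^ (3 * d) * z\<^sup>2)) = 1 / real (z ^ (3 * d) * z\<^sup>2)"
      using z8 by simp
    also have "\<dots> \<le> 1 / (4 * real m)"
    proof -
      have "4 * m \<le> 8 * z ^ (3 * d)" using m(2) by simp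
      also have "\<dots> \<le> z\<^sup>2 * z ^ (3 * d)" using z8 by (intro mult_right_mono) (auto simp: power2_eq_square intro: order_trans[of 8 "8 * 8"] mult_mono)
      finally have "4 * m \<le> z ^ (3 * d) * z\<^sup>2" by (simp add: mult.commute)
      then have "real (4 * m) \<le> real (z ^ (3 * d) * z\<^sup>2)" by (simp only: of_nat_le_iff)
      then show ?thesis using m0 by (intro divide_left_mono) auto
    qed
    finally show ?thesis .
  qed
  have r3: "0 \<le> r3" "r3 < 1 / real m" unfolding r3_def using rE2 r2l r2u recip_sum_nonneg[of E2] by linarith+
  have "denom_smooth e 0 r3" unfolding r3_def by (rule E2(5))
  then obtain E3 where E3: "finite E3" "\<forall>a\<in>E3. m \<le> a \<and> (\<exists>l. a = 2 ^ l)" "recip_sum E3 = r3" "\<Sum>E3 \<le> 2 * 2 ^ e"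
    using denom_smooth_zero[OF _ r3 m0] by blast
  have V1V2: "2 * N < V2"
  proof -
    have "2 * N \<le> 2 * C * Y" using N(2) unfolding Y_def by simp
    also have "\<dots> < z * Y" using z Y0 by (intro mult_strict_right_mono) auto
    also have "\<dots> \<le> V2" using powle[of "3 * d + 1" "4 * d + 3"] unfolding Y_def V2_def by simp
    finally show ?thesis .
  qed
  have dis1: "E1 \<inter> F = {}" using E1(3) FN unfolding V1_def by fastforce
  have dis2: "E1 \<inter> E2 = {}" using E1(4) E2(4) by blast
  have dis3: "F \<inter> E2 = {}" using E2(3) FN V1V2 by fastforce
  \<comment> \<open>A power of two up to 2 ^ e divides every modulus, whereas no element of E1 or E2
    divides the lower modulus of its round; so E1 and E2 contain no power of two.\<close>
  have pow: "2 ^ l dvd 2 ^ e * odd_lcm x" if "(2::nat) ^ l \<le> 2 ^ e" for l x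
  proof -
    have "l \<le> e" using that by simp
    then show ?thesis by (intro dvd_mult2 le_imp_power_dvd)
  qed
  have dis4: "E1 \<inter> E3 = {}"
  proof -
    have False if "a \<in> E1" "a \<in> E3" for a
    proof -
      obtain l where "a = 2 ^ l" using E3(2) \<open>a \<in> E3\<close> by blast
      moreover have "a \<le> 2 ^ e" using E1(3) \<open>a \<in> E1\<close> v1 by auto
      ultimately show False using pow E1(4) \<open>a \<in> E1\<close> by blast
    qed
    then show ?thesis by blast
  qed
  have dis5: "E2 \<inter> E3 = {}"
  proof -
    have False if "a \<in> E2" "a \<in> E3" for a
    proof -
      obtain l where "a = 2 ^ l" using E3(2) \<open>a \<in> E3\<close> by blast
      moreover have "a \<le> 2 ^ e" using E2(3) \<open>a \<in> E2\<close> v2 by auto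
      ultimately show False using pow E2(4) \<open>a \<in> E2\<close> by blast
    qed
    then show ?thesis by blast
  qed
  have dis6: "F \<inter> E3 = {}" using F0(2) F(1) E3(2) unfolding nice_def by blast
  define E where "E = E1 \<union> (F \<union> (E2 \<union> E3))"
  have finE: "finite E" unfolding E_def using E1(1) finF E2(1) E3(1) by simp
  have disj: "E2 \<inter> E3 = {}" "F \<inter> (E2 \<union> E3) = {}" "E1 \<inter> (F \<union> (E2 \<union> E3)) = {}"
    using dis1 dis2 dis3 dis4 dis5 dis6 by blast+
  have "recip_sum E = recip_sum E1 + (recip_sum F + (recip_sum E2 + recip_sum E3))"
    unfolding E_def using E1(1) finF E2(1) E3(1) disj by (simp add: recip_sum_Un)
  then have rE: "recip_sum E = r" using E3(3) unfolding r3_def r2_def r1_def by simp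
  have "\<Sum>E = \<Sum>E1 + (\<Sum>F + (\<Sum>E2 + \<Sum>E3))"
    unfolding E_def using E1(1) finF E2(1) E3(1) disj by (simp add: sum.union_disjoint)
  have sE1: "\<Sum>E1 * z \<le> (4 * C + 2) * z ^ (6 * d)"
  proof -
    have "\<Sum>E1 \<le> (Z * z) * (2 * V1 * z)" using E1(3) cE1 by (intro sum_le_card_mult) auto
    also have "\<dots> \<le> (Z * z) * (2 * ((2 * C + 1) * Y) * z)"
      using N(2) Y0 unfolding V1_def Y_def[symmetric] by (intro mult_left_mono mult_right_mono) (auto simp: algebra_simps)
    finally have "\<Sum>E1 * z \<le> (Z * z) * (2 * ((2 * C + 1) * Y) * z) * z" by (rule mult_right_mono) simp
    also have "\<dots> = (4 * C + 2) * (Y * (Z * z ^ 3))" by (simp add: algebra_simps power3_eq_cube)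
    also have "\<dots> \<le> (4 * C + 2) * (Y * (Z * z ^ 4))" using powle[of 3 4] by (intro mult_left_mono) auto
    also have "\<dots> = (4 * C + 2) * z ^ (6 * d)" unfolding YZ[symmetric] unfolding Y_def by (simp flip: power_add)
    finally show ?thesis .
  qed
  have sF: "\<Sum>F * z \<le> 8 * C\<^sup>2 * z ^ (6 * d)"
  proof -
    have "real (card F) / (2 * real N) = (\<Sum>a\<in>F. 1 / (2 * real N))" by simp
    also have "\<dots> \<le> recip_sum F" unfolding recip_sum_def
    proof (rule sum_mono)
      fix a assume "a \<in> F"
      then have "a \<le> 2 * N" "N \<le> a" using FN by auto
      then show "1 / (2 * real N) \<le> 1 / real a" using N0 by (intro divide_left_mono) auto
    qed
    also have "\<dots> \<le> 2 / real z" using F(3) r1u unfolding t_def by (smt (verit) divide_nonneg_nonneg of_nat_0_le_iff)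
    finally have "real (card F) * real z \<le> 4 * real N" using N0 z8 by (simp add: field_simps)
    then have "real (card F * z) \<le> real (4 * N)" by simp
    then have cF: "card F * z \<le> 4 * N" by (simp only: of_nat_le_iff)
    have "\<Sum>F \<le> card F * (2 * N)" using FN by (intro sum_le_card_mult) auto
    then have "\<Sum>F * z \<le> card F * (2 * N) * z" by (rule mult_right_mono) simp
    also have "\<dots> = (card F * z) * (2 * N)" by (simp add: mult_ac)
    also have "\<dots> \<le> (4 * N) * (2 * N)" using cF by (rule mult_right_mono) simp
    also have "\<dots> \<le> (4 * (C * Y)) * (2 * (C * Y))" using N(2) unfolding Y_def by (intro mult_mono) auto
    also have "\<dots> = 8 * C\<^sup>2 * z ^ (6 * d)" unfolding Y_def by (simp add: power2_eq_square mult_ac flip: power_add)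
    finally show ?thesis .
  qed
  have sE2: "\<Sum>E2 * z \<le> 2 * z ^ (6 * d)"
  proof -
    have "\<Sum>E2 \<le> (z ^ d * z) * (2 * V2 * z)" using E2(2,3) by (intro sum_le_card_mult) auto
    then have "\<Sum>E2 * z \<le> (z ^ d * z) * (2 * V2 * z) * z" by (rule mult_right_mono) simp
    also have "\<dots> = 2 * z ^ (d + (4 * d + 3) + 3)" unfolding V2_def power_add[of z "d + (4 * d + 3)" 3] power_add[of z d] power3_eq_cube
      by (simp only: mult_ac)
    also have "\<dots> \<le> 2 * z ^ (6 * d)" using d by (intro mult_left_mono powle) auto
    finally show ?thesis .
  qed
  have sE3: "\<Sum>E3 * z \<le> 8 * z ^ (6 * d)"
  proof -
    have "\<Sum>E3 \<le> 8 * z ^ (4 * d + 4)" using E3(4) e(2) by linarith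
    then have "\<Sum>E3 * z \<le> 8 * z ^ (4 * d + 4) * z" by (rule mult_right_mono) simp
    also have "\<dots> = 8 * z ^ (4 * d + 5)" by (simp add: power_add eval_nat_numeral mult_ac)
    also have "\<dots> \<le> 8 * z ^ (6 * d)" using d by (intro mult_left_mono powle) auto
    finally show ?thesis .
  qed
  have "\<Sum>E * z = \<Sum>E1 * z + \<Sum>F * z + \<Sum>E2 * z + \<Sum>E3 * z"
    unfolding \<open>\<Sum>E = \<Sum>E1 + (\<Sum>F + (\<Sum>E2 + \<Sum>E3))\<close> by (simp add: algebra_simps)
  also have "\<dots> \<le> (4 * C + 2) * z ^ (6 * d) + 8 * C\<^sup>2 * z ^ (6 * d) + 2 * z ^ (6 * d) + 8 * z ^ (6 * d)"
    using sE1 sF sE2 sE3 by (intro add_mono)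
  also have "\<dots> = (8 * C\<^sup>2 + 4 * C + 12) * z ^ (6 * d)" by (simp add: algebra_simps)
  finally have "\<Sum>E * z \<le> (8 * C\<^sup>2 + 4 * C + 12) * z ^ (6 * d)" .
  moreover have "m \<le> a \<and> (N \<le> a \<or> (\<exists>l. a = 2 ^ l))" if "a \<in> E" for a
  proof -
    from that consider "a \<in> E1" | "a \<in> F" | "a \<in> E2" | "a \<in> E3" unfolding E_def by blast
    then show ?thesis
    proof cases
      case 1
      then have "V1 \<le> a" using E1(3) by auto
      then show ?thesis using mN unfolding V1_def by linarith
    next
      case 2
      then show ?thesis using FN mN by (meson le_trans)
    next
      case 3
      then have "V2 \<le> a" using E2(3) by auto
      then show ?thesis using V1V2 mN by linarith
    next
      case 4
      then show ?thesis using E3(2) by blast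
    qed
  qed
  ultimately show ?thesis using finE rE by blast
qed

section \<open>Adjusting the sum at constant reciprocal sum\<close>

text \<open>F is a union of n pairs k, k + 2 ^ i with i < n, and K takes exactly one member of each
  pair: the choices are the binary digits of j, and a is the sum of the smaller members. A new pair
  exists by counting, since bad and used numbers rule out at most 2 * (b + 2 * i) values of
  k.\<close>

lemma pair_subset_sums:
  fixes G :: "nat set" and N T b n :: nat
  assumes bad: "card ({N..N + 2 * T} - G) \<le> b" and T: "2 * b + 4 * n \<le> T" and n: "2 ^ n \<le> 2 * T"
  shows "\<exists>F a. finite F \<and> F \<subseteq> G \<inter> {N..N + 2 * T} \<and> card F \<le> 2 * n \<and> (\<forall>j<2 ^ n. \<exists>K\<subseteq>F. \<Sum>K = a + j)"
proof -
  have "\<exists>F a. finite F \<and> F \<subseteq> G \<inter> {N..N + 2 * T} \<and> card F \<le> 2 * i \<and> (\<forall>j<2 ^ i. \<exists>K\<subseteq>F. \<Sum>K = a + j)"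
    if "i \<le> n" for i
    using that
  proof (induction i)
    case 0
    then show ?case by (intro exI[of _ "{}"] exI[of _ 0]) auto
  next
    case (Suc i)
    then obtain F a where F: "finite F" "F \<subseteq> G \<inter> {N..N + 2 * T}" "card F \<le> 2 * i"
      "\<forall>j<2 ^ i. \<exists>K\<subseteq>F. \<Sum>K = a + j" by (meson Suc_leD)
    have "(2::nat) ^ Suc i \<le> 2 ^ n" using Suc.prems by (intro power_increasing) auto
    then have iT: "2 ^ i \<le> T" using n by simp
    define Bd where "Bd = ({N..N + 2 * T} - G) \<union> F"
    have finB: "finite Bd" unfolding Bd_def using F by simp
    have cB: "card Bd \<le> b + 2 * i" unfolding Bd_def using bad F(3) card_Un_le[of "{N..N + 2 * T} - G" F] by linarith
    \<comment> \<open>The values of k for which k + 2 ^ i would be bad or used. Truncated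
      subtraction can only add the value 0, which excludes more than necessary and does no
      harm.\<close>
    define Sh where "Sh = (\<lambda>x. x - 2 ^ i) ` Bd"
    have "card Sh \<le> card Bd" unfolding Sh_def using finB by (rule card_image_le)
    then have "card (Bd \<union> Sh) \<le> card Bd + card Bd" using card_Un_le[of Bd Sh] by linarith
    also have "\<dots> \<le> (b + 2 * i) + (b + 2 * i)" using cB by (intro add_mono)
    also have "\<dots> = 2 * (b + 2 * i)" by simp
    finally have "card (Bd \<union> Sh) \<le> 2 * (b + 2 * i)" .
    also have "2 * (b + 2 * i) < card {N..N + T}" using T Suc.prems by simp
    finally have "\<not> {N..N + T} \<subseteq> Bd \<union> Sh"
      using finB card_mono[of "Bd \<union> Sh" "{N..N + T}"] unfolding Sh_def by auto
    then obtain k where k: "k \<in> {N..N + T}" "k \<notin> Bd" "k \<notin> (\<lambda>x. x - 2 ^ i) ` Bd" unfolding Sh_def by blast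
    define k' where "k' = k + 2 ^ i"
    have k'B: "k' \<notin> Bd"
    proof
      assume "k' \<in> Bd"
      then have "k' - 2 ^ i \<in> (\<lambda>x. x - 2 ^ i) ` Bd" by (rule imageI)
      then show False using k(3) unfolding k'_def by simp
    qed
    have kN: "k \<in> {N..N + 2 * T}" "k' \<in> {N..N + 2 * T}" using k(1) iT unfolding k'_def by auto
    have kG: "k \<in> G" "k' \<in> G" "k \<notin> F" "k' \<notin> F" using k(2) k'B kN unfolding Bd_def by auto
    have "\<exists>K\<subseteq>insert k (insert k' F). \<Sum>K = a + k + j" if j: "j < 2 ^ Suc i" for j
    proof (cases "j < 2 ^ i")
      case True
      then obtain K where K: "K \<subseteq> F" "\<Sum>K = a + j" using F(4) by blast
      have "finite K" "k \<notin> K" using K(1) F(1) kG(3) finite_subset by auto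
      then have "\<Sum>(insert k K) = a + k + j" using K(2) by simp
      then show ?thesis using K(1) by (intro exI[of _ "insert k K"]) auto
    next
      case False
      then have "j - 2 ^ i < 2 ^ i" using j by simp
      then obtain K where K: "K \<subseteq> F" "\<Sum>K = a + (j - 2 ^ i)" using F(4) by blast
      have "finite K" "k' \<notin> K" using K(1) F(1) kG(4) finite_subset by auto
      then have "\<Sum>(insert k' K) = a + k + j" using K(2) False unfolding k'_def by simp
      then show ?thesis using K(1) by (intro exI[of _ "insert k' K"]) auto
    qed
    moreover have "card (insert k (insert k' F)) \<le> 2 * Suc i"
      using F(1,3) card_insert_le_m1[of "2 * i + 2" "insert k' F" k] card_insert_le_m1[of "2 * i + 1" F k'] by simp
    ultimately show ?case using F(1,2) kG kN
      by (intro exI[of _ "insert k (insert k' F)"] exI[of _ "a + k"]) auto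
  qed
  from this[OF order.refl] show ?thesis .
qed

text \<open>K' is a switch: its members are multiplied by V, the others by U. If U and V have equal
  reciprocal sums, the switch is invisible to reciprocals and moves the sum by
  \<open>\<Sum>V - \<Sum>U\<close> times \<open>\<Sum>K'\<close>.\<close>

definition toggle :: "nat set \<Rightarrow> nat set \<Rightarrow> nat set \<Rightarrow> nat set \<Rightarrow> nat set" where
  "toggle U V K K' = (\<lambda>(u, k). u * k) ` (U \<times> (K - K') \<union> V \<times> K')"

text \<open>Dilates of a short interval by distinct factors are disjoint, so no product is counted
  twice in a toggle. The later intervals have ratios at most 5/4 and 1.01, below the least quotients
  3/2 in {2, 3, 6} and 4/3 in {3, 6, 8, 12, 24}.\<close>

lemma inj_on_mult_narrow:
  fixes W :: "nat set"
  assumes W: "\<forall>u\<in>W. \<forall>v\<in>W. u < v \<longrightarrow> u * N' < v * N" and W0: "0 \<notin> W"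
  shows "inj_on (\<lambda>(u, k). u * k) (W \<times> {N..N'})"
proof -
  have less: False if "u \<in> W" "v \<in> W" "k \<in> {N..N'}" "l \<in> {N..N'}" "u * k = v * l" "u < v" for u v k l
  proof -
    have "u * k \<le> u * N'" using that(3) by (intro mult_left_mono) auto
    moreover have "v * N \<le> v * l" using that(4) by (intro mult_left_mono) auto
    ultimately show False using W[rule_format, OF that(1,2,6)] that(5) by linarith
  qed
  show ?thesis
  proof (rule inj_onI, clarify)
    fix u k v l assume *: "u \<in> W" "v \<in> W" "k \<in> {N..N'}" "l \<in> {N..N'}" "u * k = v * l"
    then have "u = v" using less[of u v k l] less[of v u l k] by (metis linorder_neqE_nat)
    then show "u = v \<and> k = l" using * W0 by (cases "v = 0") auto
  qed
qed

lemma
  fixes U V K K' :: "nat set"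
  assumes fin: "finite U" "finite V" "finite K" and K': "K' \<subseteq> K" and KN: "K \<subseteq> {N..N'}"
    and W: "\<forall>u\<in>U \<union> V. \<forall>v\<in>U \<union> V. u < v \<longrightarrow> u * N' < v * N" and W0: "0 \<notin> U \<union> V"
  shows recip_sum_toggle: "recip_sum U = recip_sum V \<Longrightarrow> recip_sum (toggle U V K K') = recip_sum U * recip_sum K"
    and sum_toggle: "\<Sum>(toggle U V K K') + \<Sum>U * \<Sum>K' = \<Sum>U * \<Sum>K + \<Sum>V * \<Sum>K'"
    and finite_toggle: "finite (toggle U V K K')"
    and toggle_mem: "a \<in> toggle U V K K' \<Longrightarrow> \<exists>u\<in>U \<union> V. \<exists>k\<in>K. a = u * k"
proof -
  have finK': "finite K'" using K' fin(3) by (rule finite_subset)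
  have inj: "inj_on (\<lambda>(u, k). u * k) (U \<times> (K - K') \<union> V \<times> K')"
    using inj_on_mult_narrow[OF W W0] by (rule inj_on_subset) (use K' KN in auto)
  have S: "sum f (toggle U V K K') = (\<Sum>u\<in>U. \<Sum>k\<in>K - K'. f (u * k)) + (\<Sum>u\<in>V. \<Sum>k\<in>K'. f (u * k))"
    for f :: "nat \<Rightarrow> 'b :: comm_monoid_add"
  proof -
    have "sum f (toggle U V K K') = (\<Sum>x\<in>U \<times> (K - K') \<union> V \<times> K'. f (case x of (u, k) \<Rightarrow> u * k))"
      unfolding toggle_def using inj by (simp add: sum.reindex o_def)
    also have "\<dots> = (\<Sum>x\<in>U \<times> (K - K'). f (case x of (u, k) \<Rightarrow> u * k)) + (\<Sum>x\<in>V \<times> K'. f (case x of (u, k) \<Rightarrow> u * k))"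
      using fin finK' by (intro sum.union_disjoint) auto
    finally show ?thesis by (simp add: sum.cartesian_product case_prod_unfold)
  qed
  have rm: "(\<Sum>u\<in>U. \<Sum>k\<in>K. 1 / real (u * k)) = recip_sum U * recip_sum K" for U K
    unfolding recip_sum_def by (simp add: sum_product)
  have sm: "(\<Sum>u\<in>U. \<Sum>k\<in>K. u * k) = \<Sum>U * \<Sum>K" for U K :: "nat set"
    by (simp add: sum_product)
  have dK: "recip_sum K = recip_sum (K - K') + recip_sum K'" "\<Sum>K = \<Sum>(K - K') + \<Sum>K'"
    unfolding recip_sum_def using sum.subset_diff[OF K' fin(3)] by auto
  show "recip_sum U = recip_sum V \<Longrightarrow> recip_sum (toggle U V K K') = recip_sum U * recip_sum K"
    unfolding recip_sum_def[of "toggle U V K K'"] S rm dK(1) by (simp add: distrib_left)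
  show "\<Sum>(toggle U V K K') + \<Sum>U * \<Sum>K' = \<Sum>U * \<Sum>K + \<Sum>V * \<Sum>K'"
    unfolding S sm dK(2) by (simp add: distrib_left)
  show "finite (toggle U V K K')" unfolding toggle_def using fin finK' by simp
  show "a \<in> toggle U V K K' \<Longrightarrow> \<exists>u\<in>U \<union> V. \<exists>k\<in>K. a = u * k" unfolding toggle_def using K' by auto
qed

lemma nice_mult:
  assumes "nice y k" "0 < u" "u * y \<le> y'"
  shows "nice y' (u * k)"
proof -
  have k0: "0 < k"
  proof (rule ccontr)
    assume "\<not> 0 < k"
    \<comment> \<open>The number 0 is divisible by every power of 3, so smoothness rules it
      out.\<close>
    then have "3 ^ y dvd k" by simp
    moreover have "prime (3::nat)" by simp
    ultimately have "3 ^ y \<le> y" using assms(1) unfolding nice_def smooth_def by (metis odd_numeral)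
    moreover have "y < 2 ^ y" by (rule less_exp)
    moreover have "(2::nat) ^ y \<le> 3 ^ y" by (intro power_mono) auto
    ultimately show False by linarith
  qed
  have "smooth y' (u * k)"
    using smooth_mono[OF smooth_mult[of y k u]] assms k0 unfolding nice_def by blast
  moreover have "u * k \<noteq> 2 ^ l" for l
  proof
    assume "u * k = 2 ^ l"
    then have "k dvd 2 ^ l" by (metis dvd_triv_right)
    then obtain j where "k = 2 ^ j" using divides_primepow_nat[OF two_is_prime_nat, of k l] by auto
    then show False using assms(1) unfolding nice_def by blast
  qed
  ultimately show ?thesis unfolding nice_def by blast
qed

lemma real_card_Un_le: "real (card (A \<union> B)) \<le> real (card A) + real (card B)"
  using card_Un_le[of A B] by linarith

text \<open>Only the powers of two are added to the exceptions, and there are O(log z) of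
  them.\<close>

lemma eventually_few_non_nice:
  fixes C :: nat and \<theta> :: real
  assumes C: "0 < C" and \<theta>: "0 < \<theta>"
  shows "\<exists>D0. \<forall>D\<ge>D0. \<exists>z0. \<forall>z\<ge>z0. \<forall>x \<le> C * z ^ D.
     real (card {a\<in>{1..x}. \<not> nice (z ^ (D - 5)) a}) \<le> \<theta> * real z ^ D"
proof -
  obtain D1 where D1: "\<forall>D\<ge>D1. \<exists>z0. \<forall>z\<ge>z0. \<forall>x \<le> C * z ^ D.
     real (card {a\<in>{1..x}. \<not> smooth (z ^ (D - 5)) a}) \<le> \<theta> / 2 * real z ^ D"
    using eventually_few_non_smooth[OF C half_gt_zero[OF \<theta>]] by (rule exE)
  have "\<exists>z0. \<forall>z\<ge>z0. \<forall>x \<le> C * z ^ D. real (card {a\<in>{1..x}. \<not> nice (z ^ (D - 5)) a}) \<le> \<theta> * real z ^ D"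
    if D: "max D1 1 \<le> D" for D
  proof -
    obtain z1 where z1: "\<forall>z\<ge>z1. \<forall>x \<le> C * z ^ D.
      real (card {a\<in>{1..x}. \<not> smooth (z ^ (D - 5)) a}) \<le> \<theta> / 2 * real z ^ D"
      using D1 D by (meson max.boundedE)
    have "\<forall>\<^sub>F z :: real in at_top. (ln (real C) + real D * ln z) / ln 2 + 1 \<le> \<theta> / 2 * z"
      using \<theta> by real_asymp
    then obtain z2 :: real where z2: "\<And>z. z2 \<le> z \<Longrightarrow> (ln (real C) + real D * ln z) / ln 2 + 1 \<le> \<theta> / 2 * z"
      unfolding eventually_at_top_linorder by blast
    have "real (card {a\<in>{1..x}. \<not> nice (z ^ (D - 5)) a}) \<le> \<theta> * real z ^ D"
      if z: "max z1 (nat \<lceil>z2\<rceil> + 2) \<le> z" and x: "x \<le> C * z ^ D" for z x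
    proof -
      have zz: "z1 \<le> z" "z2 \<le> real z" "2 \<le> z" using z by linarith+
      have sub: "{a\<in>{1..x}. \<not> nice (z ^ (D - 5)) a} \<subseteq> {a\<in>{1..x}. \<not> smooth (z ^ (D - 5)) a} \<union> {a\<in>{1..x}. \<exists>l. a = 2 ^ l}"
        unfolding nice_def by blast
      have "real (card {a\<in>{1..x}. \<not> nice (z ^ (D - 5)) a})
        \<le> real (card ({a\<in>{1..x}. \<not> smooth (z ^ (D - 5)) a} \<union> {a\<in>{1..x}. \<exists>l. a = 2 ^ l}))"
        using card_mono[OF _ sub] by simp
      also have "\<dots> \<le> real (card {a\<in>{1..x}. \<not> smooth (z ^ (D - 5)) a}) + real (card {a\<in>{1..x}. \<exists>l. a = 2 ^ l})"
        by (rule real_card_Un_le)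
      also have "real (card {a\<in>{1..x}. \<exists>l. a = 2 ^ l}) \<le> \<theta> / 2 * real z ^ D"
      proof (cases "x = 0")
        case True
        then show ?thesis using \<theta> by simp
      next
        case False
        then obtain L where L: "2 ^ L \<le> x" "x < 2 ^ (L + 1)" using ex_power_ivl1[of 2 x] by auto
        have "{a\<in>{1..x}. \<exists>l. a = 2 ^ l} \<subseteq> (\<lambda>l. 2 ^ l) ` {..L}"
        proof
          fix a assume "a \<in> {a\<in>{1..x}. \<exists>l. a = 2 ^ l}"
          then obtain l where l: "a = 2 ^ l" "a \<le> x" by auto
          then have "(2::nat) ^ l < 2 ^ (L + 1)" using L by linarith
          then have "l < L + 1" by (rule power_less_imp_less_exp[rotated]) simp
          then show "a \<in> (\<lambda>l. 2 ^ l) ` {..L}" using l by auto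
        qed
        then have "card {a\<in>{1..x}. \<exists>l. a = 2 ^ l} \<le> card ((\<lambda>l. (2::nat) ^ l) ` {..L})" by (intro card_mono) auto
        also have "\<dots> \<le> card {..L}" by (rule card_image_le) simp
        finally have "real (card {a\<in>{1..x}. \<exists>l. a = 2 ^ l}) \<le> real L + 1" by simp
        also have "real L \<le> (ln (real C) + real D * ln (real z)) / ln 2"
        proof -
          have "real (2 ^ L) \<le> real (C * z ^ D)" using L x by (simp only: of_nat_le_iff)
          then have "ln (real (2 ^ L)) \<le> ln (real (C * z ^ D))" by (rule ln_mono) simp
          then have "real L * ln 2 \<le> ln (real C) + real D * ln (real z)"
            using C zz by (simp add: ln_mult ln_realpow)
          then show ?thesis by (simp add: field_simps)
        qed
        also have "(ln (real C) + real D * ln (real z)) / ln 2 + 1 \<le> \<theta> / 2 * real z" by (rule z2[OF zz(2)])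
        also have "\<dots> \<le> \<theta> / 2 * real z ^ D"
          using \<theta> zz D power_increasing[of 1 D "real z"] by (intro mult_left_mono) auto
        finally show ?thesis by simp
      qed
      also have "real (card {a\<in>{1..x}. \<not> smooth (z ^ (D - 5)) a}) \<le> \<theta> / 2 * real z ^ D"
        using z1 zz(1) x by blast
      finally show ?thesis by simp
    qed
    then show ?thesis by blast
  qed
  then show ?thesis by blast
qed

section \<open>All integers in a window\<close>

text \<open>Everything that costs reciprocal mass is fixed before the target n is looked at: S, the
  toggles and the completion E. Only the switches K and L depend on n. The pieces lie in separate
  ranges: S in [m, X], the coarse toggle in [2 * X, 8 * X), the fine one in [8 * X, N), and E above
  N apart from powers of two.\<close>

lemma window_core:
  fixes \<alpha> \<epsilon> :: real and d z m X b C e n :: nat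
  assumes d: "7 \<le> d" and z: "2 * C + 24 \<le> z"
    and \<epsilon>: "0 < \<epsilon>" "\<epsilon> \<le> 1 / 4" "\<epsilon> / 4 + 2 / real z \<le> \<alpha>"
    and m: "z ^ (3 * d) \<le> m" "m \<le> 2 * z ^ (3 * d)"
    and X: "m \<le> X" "100000 * X \<le> C * z ^ (3 * d)" "32 * X < 2 ^ (z + 1)"
    and X\<alpha>: "real b / real m \<le> ln ((real X + 1) / real m) - \<alpha>"
    and b: "card {a\<in>{1..3232 * X}. \<not> nice (z ^ (3 * d - 5)) a} \<le> b" "16 * b \<le> X"
    and cov: "\<And>p. prime p \<Longrightarrow> odd p \<Longrightarrow> p \<le> z ^ (3 * d) \<Longrightarrow> covers p z"
    and res: "\<And>N. z ^ (3 * d) \<le> N \<Longrightarrow> N \<le> C * z ^ (3 * d) \<Longrightarrow>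
       \<exists>F\<subseteq>{N..2 * N}. (\<forall>a\<in>F. nice (z ^ d) a) \<and> 4 / real z \<le> recip_sum F"
    and e: "2 * z ^ (4 * d + 4) \<le> 2 ^ e" "2 ^ e \<le> 4 * z ^ (4 * d + 4)"
    and \<alpha>d: "denom_smooth e (z ^ (3 * d - 4)) \<alpha>"
    and n_lower: "(real X * (real X + 1) - real m * (real m - 1)) / 2 + \<epsilon> * (real m)\<^sup>2
        + 174528 * real z * real X + real (8 * C\<^sup>2 + 4 * C + 12) * (real m)\<^sup>2 / real z \<le> real n"
    and n_upper: "real n \<le> (exp (2 * \<alpha>) - 1) / 2 * (real m)\<^sup>2 - (exp \<alpha> + exp (2 * \<alpha>)) * real m
        + 7 * (\<epsilon> * (real m)\<^sup>2 / 2 - 2 * real X)"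
  shows "\<exists>A. finite A \<and> (\<forall>a\<in>A. m \<le> a) \<and> recip_sum A = \<alpha> \<and> \<Sum>A = n"
proof -
  \<comment> \<open>Two smoothness levels: the numbers k in the toggles are smooth at y0, so that
    their multiples by factors up to 24 \<le> z are still smooth at y = y0 * z.\<close>
  define y0 where "y0 = z ^ (3 * d - 5)"
  define y where "y = z ^ (3 * d - 4)"
  have z24: "24 \<le> z" using z by simp
  have yy: "y = y0 * z"
  proof -
    have "3 * d - 4 = Suc (3 * d - 5)" using d by simp
    then show ?thesis unfolding y_def y0_def by simp
  qed
  have y24: "24 * y0 \<le> y" unfolding yy using z24 by simp
  have powle: "z ^ i \<le> z ^ j" if "i \<le> j" for i j using that z24 by (intro power_increasing) auto
  have z2m: "z\<^sup>2 \<le> m" using powle[of 2 "3 * d"] d m(1) by linarith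
  have "z * 1 \<le> z\<^sup>2" unfolding power2_eq_square using z24 by (intro mult_left_mono) auto
  then have zm: "z \<le> m" using z2m by linarith
  have m24: "24 \<le> m" using zm z24 by linarith
  then have m0: "0 < m" "1 \<le> m" by linarith+
  have X0: "0 < X" using X(1) m0 by linarith
  \<comment> \<open>Beyond every toggled element, since 24 * 3232 = 77568 < 100000.\<close>
  define N where "N = 100000 * X"
  have Ne: "N \<le> 2 ^ e"
  proof -
    have "N \<le> C * z ^ (3 * d)" unfolding N_def by (rule X(2))
    also have "\<dots> \<le> z * z ^ (3 * d)" using z by (intro mult_right_mono) auto
    also have "\<dots> \<le> 2 * z ^ (4 * d + 4)" using powle[of "3 * d + 1" "4 * d + 4"] by simp
    finally show ?thesis using e(1) by linarith
  qed
  have nonnice: "card ({A..B} - {a. nice y0 a}) \<le> b" if "1 \<le> A" "B \<le> 3232 * X" for A B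
  proof -
    have "{A..B} - {a. nice y0 a} \<subseteq> {a\<in>{1..3232 * X}. \<not> nice y0 a}" using that by auto
    then have "card ({A..B} - {a. nice y0 a}) \<le> card {a\<in>{1..3232 * X}. \<not> nice y0 a}" by (intro card_mono) auto
    then show ?thesis using b(1) unfolding y0_def by linarith
  qed
  define X' where "X' = X + X div 4"
  define G1 where "G1 = {X..X'} \<inter> {a. nice y0 a}"
  have cG1: "real X / 8 \<le> real (card G1)"
  proof -
    have "card {X..X'} = card G1 + card ({X..X'} - {a. nice y0 a})" unfolding G1_def
      by (rule card_Int_Diff) simp
    moreover have "card ({X..X'} - {a. nice y0 a}) \<le> b" using X0 unfolding X'_def by (intro nonnice) auto
    moreover have "card {X..X'} = X div 4 + 1" unfolding X'_def by simp
    moreover have "real X / 4 \<le> real (X div 4 + 1)" by linarith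
    moreover have "real b \<le> real X / 16" using b(2) by linarith
    ultimately have "real X / 4 \<le> real (card G1) + real X / 16" by linarith
    then show ?thesis by linarith
  qed
  have mX2: "(real m)\<^sup>2 \<le> (real X)\<^sup>2" using X(1) by (intro power_mono) auto
  \<comment> \<open>K1 will have sum close to \<tau>. It adds 2 * \<tau> = \<epsilon> * m^2 to the
    base, while its switches gain up to 7 * \<tau>; the excess of 7 over 2 is what leaves a
    window.\<close>
  define \<tau> where "\<tau> = \<epsilon> * (real m)\<^sup>2 / 2"
  have \<tau>: "0 \<le> \<tau>" "\<tau> \<le> sum real G1" "\<tau> \<le> \<epsilon> / 2 * (real X)\<^sup>2"
  proof -
    show "0 \<le> \<tau>" unfolding \<tau>_def using \<epsilon> by simp
    have "\<epsilon> * (real m)\<^sup>2 \<le> \<epsilon> * (real X)\<^sup>2" using mX2 \<epsilon> by (intro mult_left_mono) auto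
    then show t3: "\<tau> \<le> \<epsilon> / 2 * (real X)\<^sup>2" unfolding \<tau>_def by simp
    have "\<epsilon> / 2 * (real X)\<^sup>2 \<le> 1 / 8 * (real X)\<^sup>2" using \<epsilon> by (intro mult_right_mono) auto
    also have "\<dots> = real X / 8 * real X" by (simp add: power2_eq_square)
    also have "\<dots> \<le> real (card G1) * real X" using cG1 by (intro mult_right_mono) auto
    also have "\<dots> = (\<Sum>a\<in>G1. real X)" by simp
    also have "\<dots> \<le> sum real G1" unfolding G1_def by (intro sum_mono) auto
    finally show "\<tau> \<le> sum real G1" using t3 by linarith
  qed
  have G1le: "real a \<le> 2 * real X" if "a \<in> G1" for a
  proof -
    have "a \<le> X'" using that unfolding G1_def by simp
    then have "a \<le> 2 * X" unfolding X'_def by linarith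
    then show ?thesis by linarith
  qed
  have "\<exists>K\<subseteq>G1. \<tau> - 2 * real X < sum real K \<and> sum real K \<le> \<tau>"
    using \<tau>(1,2) G1le X0 by (intro greedy_subset_sum) (auto simp: G1_def)
  then obtain K1 where K1: "K1 \<subseteq> G1" "\<tau> - 2 * real X < sum real K1" "sum real K1 \<le> \<tau>" by blast
  have finK1: "finite K1" using finite_subset[OF K1(1)] unfolding G1_def by simp
  have K1X: "K1 \<subseteq> {X..X'}" using K1(1) unfolding G1_def by blast
  define U1 V1 :: "nat set" where "U1 = {2}" and "V1 = {3, 6}"
  have UV1: "recip_sum U1 = 1 / 2" "recip_sum V1 = 1 / 2" "\<Sum>U1 = 2" "\<Sum>V1 = 9"
    "finite U1" "finite V1" "0 \<notin> U1 \<union> V1" unfolding U1_def V1_def recip_sum_def by simp_all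
  have W1: "\<forall>u\<in>U1 \<union> V1. \<forall>v\<in>U1 \<union> V1. u < v \<longrightarrow> u * X' < v * X"
    using X0 unfolding U1_def V1_def X'_def by auto
  have rK1: "recip_sum K1 \<le> \<epsilon> / 2"
  proof -
    have "recip_sum K1 \<le> (\<Sum>k\<in>K1. real k / (real X)\<^sup>2)" unfolding recip_sum_def
    proof (rule sum_mono)
      fix k assume "k \<in> K1"
      then have "X \<le> k" using K1X by auto
      then have "(real X)\<^sup>2 \<le> real k * real k" unfolding power2_eq_square by (intro mult_mono) auto
      then show "1 / real k \<le> real k / (real X)\<^sup>2" using X0 \<open>X \<le> k\<close> by (simp add: field_simps)
    qed
    also have "\<dots> = sum real K1 / (real X)\<^sup>2" by (simp add: sum_divide_distrib)
    also have "\<dots> \<le> \<epsilon> / 2 * (real X)\<^sup>2 / (real X)\<^sup>2" using K1(3) \<tau>(3) by (intro divide_right_mono) auto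
    finally show ?thesis using X0 by simp
  qed
  \<comment> \<open>Thus 2 ^ l exceeds 16 * X, hence every remainder of the coarse steps, which is
    below 14 * X, and it is at most 2 * T for T = 16 * X. As l \<le> z, the fine set has at most 2 *
    z elements and a sum O(z * X).\<close>
  obtain l where l: "2 ^ l \<le> 32 * X" "32 * X < 2 ^ (l + 1)" using ex_power_ivl1[of 2 "32 * X"] X0 by auto
  have lz: "l \<le> z"
  proof -
    have "(2::nat) ^ l < 2 ^ (z + 1)" using l(1) X(3) by linarith
    then have "l < z + 1" by (rule power_less_imp_less_exp[rotated]) simp
    then show ?thesis by simp
  qed
  define N2 where "N2 = 3200 * X"
  have "\<exists>F a. finite F \<and> F \<subseteq> {a. nice y0 a} \<inter> {N2..N2 + 2 * (16 * X)} \<and> card F \<le> 2 * l \<and>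
      (\<forall>j<2 ^ l. \<exists>K\<subseteq>F. \<Sum>K = a + j)"
  proof (rule pair_subset_sums)
    show "card ({N2..N2 + 2 * (16 * X)} - {a. nice y0 a}) \<le> b" unfolding N2_def using X0 by (intro nonnice) auto
    show "2 * b + 4 * l \<le> 16 * X" using b(2) lz zm X(1) by linarith
    show "2 ^ l \<le> 2 * (16 * X)" using l(1) by simp
  qed
  then obtain K2 a0 where K2: "finite K2" "K2 \<subseteq> {a. nice y0 a} \<inter> {N2..N2 + 2 * (16 * X)}" "card K2 \<le> 2 * l"
    "\<forall>j<2 ^ l. \<exists>K\<subseteq>K2. \<Sum>K = a0 + j" by (elim exE conjE)
  define N2' where "N2' = 3232 * X"
  have K2X: "K2 \<subseteq> {N2..N2'}" using K2(2) unfolding N2_def N2'_def by auto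
  define U2 V2 :: "nat set" where "U2 = {6, 8, 12}" and "V2 = {3, 24}"
  have UV2: "recip_sum U2 = 3 / 8" "recip_sum V2 = 3 / 8" "\<Sum>U2 = 26" "\<Sum>V2 = 27"
    "finite U2" "finite V2" "0 \<notin> U2 \<union> V2" unfolding U2_def V2_def recip_sum_def by simp_all
  have W2: "\<forall>u\<in>U2 \<union> V2. \<forall>v\<in>U2 \<union> V2. u < v \<longrightarrow> u * N2' < v * N2"
    using X0 unfolding U2_def V2_def N2_def N2'_def by auto
  have rK2: "recip_sum K2 \<le> 1 / real z"
  proof -
    have "recip_sum K2 \<le> real (2 * l) / real N2" using K2(1,3) K2X X0 by (intro recip_sum_le) (auto simp: N2_def)
    also have "\<dots> \<le> real z / (real z * real z)"
    proof -
      have "z * z \<le> X" using z2m X(1) unfolding power2_eq_square by linarith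
      then have "real (z * z) \<le> real X" by (simp only: of_nat_le_iff)
      then have zX: "real z * real z \<le> real X" by simp
      have "real (2 * l) \<le> 2 * real z" using lz by simp
      then have "real (2 * l) / real N2 \<le> 2 * real z / (3200 * real X)"
        unfolding N2_def using X0 by (simp add: divide_right_mono)
      also have "\<dots> = real z / (1600 * real X)" by simp
      also have "\<dots> \<le> real z / (real z * real z)" using zX z24 X0 by (intro divide_left_mono) auto
      finally show ?thesis .
    qed
    finally show ?thesis using z24 by simp
  qed
  have sK2: "\<Sum>K2 \<le> 6464 * z * X"
  proof -
    have "\<Sum>K2 \<le> (2 * l) * N2'" using K2X K2(3) by (intro sum_le_card_mult) auto
    also have "\<dots> \<le> (2 * z) * N2'" using lz by (intro mult_right_mono) auto
    finally show ?thesis unfolding N2'_def by simp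
  qed
  have a0: "a0 \<le> \<Sum>K2"
  proof -
    have "\<exists>K\<subseteq>K2. \<Sum>K = a0 + 0" using K2(4)[rule_format, of 0] by simp
    then obtain K where K: "K \<subseteq> K2" "\<Sum>K = a0 + 0" by blast
    have "\<Sum>K \<le> \<Sum>K2" using K(1) K2(1) by (intro sum_mono2) auto
    then show ?thesis using K(2) by simp
  qed
  define \<rho> where "\<rho> = 1 / 2 * recip_sum K1 + 3 / 8 * recip_sum K2"
  have \<rho>: "0 \<le> \<rho>" "\<rho> \<le> \<epsilon> / 4 + 1 / real z"
  proof -
    show "0 \<le> \<rho>" unfolding \<rho>_def using recip_sum_nonneg[of K1] recip_sum_nonneg[of K2] by linarith
    have "0 \<le> 1 / real z" by simp
    then show "\<rho> \<le> \<epsilon> / 4 + 1 / real z" unfolding \<rho>_def using rK1 rK2 by linarith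
  qed
  define S0 where "S0 = {m..X} \<inter> {a. nice y0 a}"
  \<comment> \<open>S is to leave between 1 / z and 1 / z + 1 / m \<le> 2 / z of reciprocal mass,
    the range that \<open>completion\<close> accepts.\<close>
  define t where "t = \<alpha> - \<rho> - 1 / real z"
  have t0: "0 \<le> t"
  proof -
    have "2 / real z = 1 / real z + 1 / real z" by simp
    then show ?thesis unfolding t_def using \<rho>(2) \<epsilon>(3) by linarith
  qed
  have tS: "t \<le> (\<Sum>a\<in>S0. 1 / real a)"
  proof -
    have "(\<Sum>a\<in>{m..X}. 1 / real a) = (\<Sum>a\<in>S0. 1 / real a) + recip_sum ({m..X} - {a. nice y0 a})"
      unfolding S0_def recip_sum_def by (subst sum.union_disjoint[symmetric]) (auto intro!: sum.cong)
    moreover have "recip_sum ({m..X} - {a. nice y0 a}) \<le> real b / real m"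
      using m0 X0 by (intro recip_sum_le nonnice) auto
    moreover have "ln ((real X + 1) / real m) \<le> (\<Sum>a\<in>{m..X}. 1 / real a)" using m0 X(1) by (intro harmonic_lower) auto
    moreover have "0 \<le> 1 / real z" by simp
    ultimately show ?thesis unfolding t_def using X\<alpha> \<rho>(1) by linarith
  qed
  have "\<exists>S\<subseteq>S0. t - 1 / real m < (\<Sum>a\<in>S. 1 / real a) \<and> (\<Sum>a\<in>S. 1 / real a) \<le> t"
  proof (rule greedy_subset_sum)
    show "1 / real a \<le> 1 / real m" if "a \<in> S0" for a
      using that m0 unfolding S0_def by (intro divide_left_mono) auto
  qed (use t0 tS m0 in \<open>auto simp: S0_def\<close>)
  then obtain S where S: "S \<subseteq> S0" "t - 1 / real m < recip_sum S" "recip_sum S \<le> t"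
    unfolding recip_sum_def by blast
  have Sm: "S \<subseteq> {m..X}" using S(1) unfolding S0_def by blast
  have finS: "finite S" using finite_subset[OF Sm] by simp
  have sS: "real (\<Sum>S) \<le> (real X * (real X + 1) - real m * (real m - 1)) / 2"
  proof -
    have "\<Sum>S \<le> \<Sum>{m..X}" using Sm by (intro sum_mono2) auto
    then have "real (\<Sum>S) \<le> real (\<Sum>{m..X})" by (simp only: of_nat_le_iff)
    also have "\<dots> = (\<Sum>a\<in>{m..X}. real a)" by simp
    finally show ?thesis using sum_interval[OF X(1)] by simp
  qed
  have Snice: "nice y a" if "a \<in> S" for a
    using nice_mult[of y0 a 1 y] that S(1) y24 unfolding S0_def by auto
  define tog1 where "tog1 = toggle U1 V1 K1"
  define tog2 where "tog2 = toggle U2 V2 K2"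
  note T1 = recip_sum_toggle[OF UV1(5,6) finK1 _ K1X W1 UV1(7), folded tog1_def]
    sum_toggle[OF UV1(5,6) finK1 _ K1X W1 UV1(7), folded tog1_def]
    finite_toggle[OF UV1(5,6) finK1 _ K1X W1 UV1(7), folded tog1_def]
    toggle_mem[OF UV1(5,6) finK1 _ K1X W1 UV1(7), folded tog1_def]
  note T2 = recip_sum_toggle[OF UV2(5,6) K2(1) _ K2X W2 UV2(7), folded tog2_def]
    sum_toggle[OF UV2(5,6) K2(1) _ K2X W2 UV2(7), folded tog2_def]
    finite_toggle[OF UV2(5,6) K2(1) _ K2X W2 UV2(7), folded tog2_def]
    toggle_mem[OF UV2(5,6) K2(1) _ K2X W2 UV2(7), folded tog2_def]
  have t1: "nice y a \<and> 2 * X \<le> a \<and> a < 8 * X" if aK: "a \<in> tog1 K" and KK: "K \<subseteq> K1" for a K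
  proof -
    obtain u k where uk: "u \<in> U1 \<union> V1" "k \<in> K1" "a = u * k" using T1(4)[OF KK aK] by blast
    have u: "2 \<le> u" "u \<le> 6" using uk(1) unfolding U1_def V1_def by auto
    have k: "X \<le> k" "k \<le> X'" "nice y0 k" using uk(2) K1(1) unfolding G1_def by auto
    have "u * y0 \<le> y" using mult_right_mono[of u 24 y0] u y24 by linarith
    then have "nice y a" unfolding uk(3) using k(3) u by (intro nice_mult) auto
    moreover have "2 * X \<le> u * k" using u k by (intro mult_mono) auto
    moreover have "u * k \<le> 6 * X'" using u k by (intro mult_mono) auto
    moreover have "6 * X + 6 * (X div 4) < 8 * X" using X0 div_times_less_eq_dividend[of X 4] by linarith
    then have "6 * X' < 8 * X" unfolding X'_def distrib_left .
    ultimately show ?thesis using \<open>6 * X' < 8 * X\<close> unfolding uk(3) by linarith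
  qed
  have t2: "nice y a \<and> 8 * X \<le> a \<and> a < N" if aK: "a \<in> tog2 K" and KK: "K \<subseteq> K2" for a K
  proof -
    obtain u k where uk: "u \<in> U2 \<union> V2" "k \<in> K2" "a = u * k" using T2(4)[OF KK aK] by blast
    have u: "3 \<le> u" "u \<le> 24" using uk(1) unfolding U2_def V2_def by auto
    have k: "N2 \<le> k" "k \<le> N2'" "nice y0 k" using uk(2) K2(2) unfolding N2_def N2'_def by auto
    have "u * y0 \<le> y" using mult_right_mono[of u 24 y0] u y24 by linarith
    then have "nice y a" unfolding uk(3) using k(3) u by (intro nice_mult) auto
    moreover have "3 * N2 \<le> u * k" using u k by (intro mult_mono) auto
    moreover have "u * k \<le> 24 * N2'" using u k by (intro mult_mono) auto
    ultimately show ?thesis unfolding uk(3) N2_def N2'_def N_def using X0 by linarith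
  qed
  have dvd_y: "a dvd 2 ^ e * odd_lcm y" if "nice y a" "0 < a" "a < N" for a
    using that Ne unfolding nice_def by (intro smooth_dvd) auto
  \<comment> \<open>The toggles enter with empty switches; other switches have the same reciprocal
    sum, so one completion E serves all of them.\<close>
  define r where "r = \<alpha> - recip_sum S - recip_sum (tog1 {}) - recip_sum (tog2 {})"
  have rr: "recip_sum (tog1 K) = 1 / 2 * recip_sum K1" if "K \<subseteq> K1" for K
    using T1(1)[OF that] UV1 by simp
  have rr2: "recip_sum (tog2 K) = 3 / 8 * recip_sum K2" if "K \<subseteq> K2" for K
    using T2(1)[OF that] UV2 by simp
  have r_eq: "r = \<alpha> - recip_sum S - \<rho>" unfolding r_def \<rho>_def using rr[of "{}"] rr2[of "{}"] by simp
  have r1: "1 / real z \<le> r" using S(3) unfolding r_eq t_def by linarith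
  have r2: "r \<le> 2 / real z"
  proof -
    have "1 / real m \<le> 1 / real z" using zm z24 by (intro divide_left_mono) auto
    moreover have "2 / real z = 1 / real z + 1 / real z" by simp
    ultimately show ?thesis using S(2) unfolding r_eq t_def by linarith
  qed
  have rd: "denom_smooth e y r" unfolding r_def
  proof (intro denom_smooth_diff denom_smooth_recip_sum)
    show "denom_smooth e y \<alpha>" using \<alpha>d unfolding y_def .
    show "a dvd 2 ^ e * odd_lcm y" if "a \<in> S" for a
    proof -
      have "a \<in> {m..X}" using Sm that by blast
      then have "m \<le> a" "a \<le> X" by simp_all
      then have "0 < a" "a < N" using m0 X0 unfolding N_def by linarith+
      then show ?thesis by (rule dvd_y[OF Snice[OF that]])
    qed
    show "a dvd 2 ^ e * odd_lcm y" if "a \<in> tog1 {}" for a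
    proof -
      have "nice y a" "2 * X \<le> a" "a < 8 * X" using t1[OF that] by simp_all
      then show ?thesis using X0 unfolding N_def by (intro dvd_y[unfolded N_def]) linarith+
    qed
    show "a dvd 2 ^ e * odd_lcm y" if "a \<in> tog2 {}" for a
    proof -
      have "nice y a" "8 * X \<le> a" "a < N" using t2[OF that] by simp_all
      then show ?thesis using X0 by (intro dvd_y) linarith+
    qed
  qed
  have "\<exists>E. finite E \<and> (\<forall>a\<in>E. m \<le> a \<and> (N \<le> a \<or> (\<exists>l. a = 2 ^ l))) \<and> recip_sum E = r \<and>
     \<Sum>E * z \<le> (8 * C\<^sup>2 + 4 * C + 12) * z ^ (6 * d)"
  proof (rule completion[OF d _ cov _ m _ _ e])
    show "2 * C + 8 \<le> z" using z by simp
    show "\<exists>F\<subseteq>{N..2 * N}. (\<forall>a\<in>F. nice (z ^ d) a) \<and> 4 / real z \<le> recip_sum F"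
      using m(1) X(1,2) unfolding N_def by (intro res) linarith+
    show "4 * m \<le> N" "N \<le> C * z ^ (3 * d)" using X unfolding N_def by linarith+
    show "denom_smooth e (z ^ (3 * d - 4)) r" using rd unfolding y_def .
  qed (use r1 r2 in auto)
  then obtain E where E: "finite E" "\<forall>a\<in>E. m \<le> a \<and> (N \<le> a \<or> (\<exists>l. a = 2 ^ l))" "recip_sum E = r"
    "\<Sum>E * z \<le> (8 * C\<^sup>2 + 4 * C + 12) * z ^ (6 * d)" by (elim exE conjE)
  have Edisj: "a \<notin> E" if "nice y a" "a < N" for a using E(2) that unfolding nice_def by (meson not_le)
  define A where "A K L = S \<union> (tog1 K \<union> (tog2 L \<union> E))" for K L
  have A: "finite (A K L) \<and> (\<forall>a\<in>A K L. m \<le> a) \<and> recip_sum (A K L) = \<alpha> \<and>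
      \<Sum>(A K L) = \<Sum>S + 2 * \<Sum>K1 + 7 * \<Sum>K + 26 * \<Sum>K2 + \<Sum>L + \<Sum>E" if K: "K \<subseteq> K1" "L \<subseteq> K2" for K L
  proof -
    have fin: "finite (tog1 K)" "finite (tog2 L)" using T1(3)[OF K(1)] T2(3)[OF K(2)] by auto
    have d1: "tog2 L \<inter> E = {}" using t2[OF _ K(2)] Edisj by blast
    have d2: "tog1 K \<inter> (tog2 L \<union> E) = {}"
    proof -
      have False if "a \<in> tog1 K" "a \<in> tog2 L \<union> E" for a
        using t1[OF that(1) K(1)] t2[OF _ K(2), of a] Edisj[of a] that(2) X0 unfolding N_def by auto
      then show ?thesis by blast
    qed
    have d3: "S \<inter> (tog1 K \<union> (tog2 L \<union> E)) = {}"
    proof -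
      have False if a: "a \<in> S" "a \<in> tog1 K \<union> (tog2 L \<union> E)" for a
      proof -
        have "a \<le> X" using a(1) Sm by auto
        then show False using t1[OF _ K(1), of a] t2[OF _ K(2), of a] Edisj[of a] Snice[OF a(1)] a(2) X0
          unfolding N_def by auto
      qed
      then show ?thesis by blast
    qed
    have "finite (A K L)" unfolding A_def using finS fin E(1) by simp
    moreover have "m \<le> a" if "a \<in> A K L" for a
    proof -
      from that consider "a \<in> S" | "a \<in> tog1 K" | "a \<in> tog2 L" | "a \<in> E" unfolding A_def by blast
      then show ?thesis
      proof cases
        case 1 then show ?thesis using Sm by auto
      next
        case 2 then show ?thesis using t1[OF _ K(1)] X(1) by fastforce
      next
        case 3 then show ?thesis using t2[OF _ K(2)] X(1) by fastforce
      next
        case 4 then show ?thesis using E(2) by blast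
      qed
    qed
    moreover have "recip_sum (A K L) = recip_sum S + (recip_sum (tog1 K) + (recip_sum (tog2 L) + recip_sum E))"
      unfolding A_def using finS fin E(1) d1 d2 d3 by (simp add: recip_sum_Un)
    then have "recip_sum (A K L) = \<alpha>" using rr[OF K(1)] rr2[OF K(2)] E(3) unfolding r_eq \<rho>_def by simp
    moreover have "\<Sum>(A K L) = \<Sum>S + (\<Sum>(tog1 K) + (\<Sum>(tog2 L) + \<Sum>E))"
      unfolding A_def using finS fin E(1) d1 d2 d3 by (simp add: sum.union_disjoint)
    moreover have "\<Sum>(tog1 K) = 2 * \<Sum>K1 + 7 * \<Sum>K" using T1(2)[OF K(1)] UV1 by simp
    moreover have "\<Sum>(tog2 L) = 26 * \<Sum>K2 + \<Sum>L" using T2(2)[OF K(2)] UV2 by simp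
    ultimately show ?thesis by simp
  qed
  define Bs where "Bs = \<Sum>S + 2 * \<Sum>K1 + 26 * \<Sum>K2 + \<Sum>E"
  have A00: "\<Sum>(A {} {}) = Bs" "finite (A {} {})" "\<And>a. a \<in> A {} {} \<Longrightarrow> m \<le> a" "recip_sum (A {} {}) = \<alpha>"
    using A[of "{}" "{}"] unfolding Bs_def by auto
  \<comment> \<open>The general lower bound, applied to the constructed set itself, replaces an
    evaluation of Bs from below: the base cannot fall short by more than O(m), so n is within reach
    of the coarse steps.\<close>
  have Blow: "(exp (2 * \<alpha>) - 1) / 2 * (real m)\<^sup>2 - (exp \<alpha> + exp (2 * \<alpha>)) * real m \<le> real Bs"
    using sum_lower_bound[OF A00(2,3) m0(2) A00(4)] unfolding A00(1) .
  have K1s: "real (\<Sum>K1) = sum real K1" by simp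
  have Eup: "real (\<Sum>E) \<le> real (8 * C\<^sup>2 + 4 * C + 12) * (real m)\<^sup>2 / real z"
  proof -
    have "z ^ (6 * d) = z ^ (3 * d) * z ^ (3 * d)" by (simp flip: power_add)
    also have "\<dots> \<le> m * m" using m(1) by (intro mult_mono) auto
    finally have "(8 * C\<^sup>2 + 4 * C + 12) * z ^ (6 * d) \<le> (8 * C\<^sup>2 + 4 * C + 12) * (m * m)" by (rule mult_left_mono) simp
    then have "\<Sum>E * z \<le> (8 * C\<^sup>2 + 4 * C + 12) * (m * m)" using E(4) by linarith
    then have "real (\<Sum>E * z) \<le> real ((8 * C\<^sup>2 + 4 * C + 12) * (m * m))" by (simp only: of_nat_le_iff)
    then have "real (\<Sum>E) * real z \<le> real (8 * C\<^sup>2 + 4 * C + 12) * (real m)\<^sup>2"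
      by (simp only: of_nat_mult power2_eq_square)
    then show ?thesis using z24 by (subst pos_le_divide_eq) auto
  qed
  have Bup: "real (Bs + a0) \<le> real n"
  proof -
    \<comment> \<open>26 copies of \<open>\<Sum>K2\<close> come from U2 and one more bounds a0;
      174528 = 27 * 6464, where 6464 = 2 * 3232.\<close>
    have "27 * \<Sum>K2 \<le> 174528 * z * X" using sK2 by linarith
    then have "26 * \<Sum>K2 + a0 \<le> 174528 * z * X" using a0 by linarith
    then have "real (26 * \<Sum>K2 + a0) \<le> real (174528 * z * X)" by (simp only: of_nat_le_iff)
    then have "real (26 * \<Sum>K2 + a0) \<le> 174528 * real z * real X" by simp
    moreover have "real (2 * \<Sum>K1) \<le> \<epsilon> * (real m)\<^sup>2" using K1(3) K1s unfolding \<tau>_def by simp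
    moreover have "real (Bs + a0) = real (\<Sum>S) + real (2 * \<Sum>K1) + real (26 * \<Sum>K2 + a0) + real (\<Sum>E)"
      unfolding Bs_def by simp
    ultimately show ?thesis using sS Eup n_lower by linarith
  qed
  \<comment> \<open>The offset a0 is subtracted in advance because the fine sums start at a0. Coarse
    steps 7 * k \<le> 14 * X then approach n from below, and the fine switch supplies the rest
    j.\<close>
  define t' where "t' = real n - real (Bs + a0)"
  have t'0: "0 \<le> t'" using Bup unfolding t'_def by linarith
  have t'u: "t' \<le> (\<Sum>k\<in>K1. 7 * real k)"
  proof -
    have "(\<Sum>k\<in>K1. 7 * real k) = 7 * sum real K1" by (simp add: sum_distrib_left)
    moreover have "7 * (\<epsilon> * (real m)\<^sup>2 / 2 - 2 * real X) \<le> 7 * sum real K1"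
      using less_imp_le[OF K1(2)] unfolding \<tau>_def by (rule mult_left_mono) simp
    ultimately have "7 * (\<epsilon> * (real m)\<^sup>2 / 2 - 2 * real X) \<le> (\<Sum>k\<in>K1. 7 * real k)" by (simp only:)
    moreover have "real Bs \<le> real (Bs + a0)" by simp
    ultimately show ?thesis unfolding t'_def using n_upper Blow by linarith
  qed
  have "\<exists>K\<subseteq>K1. t' - 14 * real X < (\<Sum>k\<in>K. 7 * real k) \<and> (\<Sum>k\<in>K. 7 * real k) \<le> t'"
  proof (rule greedy_subset_sum)
    show "7 * real a \<le> 14 * real X" if "a \<in> K1" for a using G1le[of a] K1(1) that by auto
  qed (use finK1 t'0 t'u X0 in auto)
  then obtain K where K: "K \<subseteq> K1" "t' - 14 * real X < (\<Sum>k\<in>K. 7 * real k)" "(\<Sum>k\<in>K. 7 * real k) \<le> t'" by blast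
  have K7: "(\<Sum>k\<in>K. 7 * real k) = real (7 * \<Sum>K)" by (simp add: sum_distrib_left)
  have "real (7 * \<Sum>K + (Bs + a0)) \<le> real n" using K(3) unfolding K7 t'_def by simp
  then have le: "7 * \<Sum>K + (Bs + a0) \<le> n" by (simp only: of_nat_le_iff)
  define j where "j = n - (7 * \<Sum>K + (Bs + a0))"
  have nj: "n = 7 * \<Sum>K + (Bs + a0) + j" unfolding j_def using le by simp
  have "real j < 14 * real X" using K(2) unfolding K7 t'_def nj by simp
  then have "j < 14 * X" by linarith
  then have "j < 2 ^ l" using l(2) by simp
  then obtain L where L: "L \<subseteq> K2" "\<Sum>L = a0 + j" using K2(4) by blast
  have "\<Sum>(A K L) = n" using A[OF K(1) L(1)] L(2) unfolding nj Bs_def by simp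
  then show ?thesis using A[OF K(1) L(1)] by blast
qed

section \<open>Choice of the parameters\<close>

lemma power_bracket:
  fixes k m :: nat
  assumes "0 < k"
  shows "\<exists>z. z ^ k \<le> m \<and> m < (z + 1) ^ k"
proof -
  define w where "w = (LEAST w. m < w ^ k)"
  have "m < (m + 1) ^ 1" by simp
  also have "(m + 1) ^ 1 \<le> (m + 1) ^ k" using assms by (intro power_increasing) auto
  finally have w: "m < w ^ k" unfolding w_def by (rule LeastI)
  then obtain z where z: "w = Suc z" using assms by (cases w) (auto simp: zero_power)
  have "\<not> m < z ^ k" using not_less_Least[of z "\<lambda>w. m < w ^ k"] z unfolding w_def by simp
  then show ?thesis using w z by (intro exI[of _ z]) simp
qed

lemma Suc_power_le_double:
  fixes k z :: nat
  assumes "2 * k \<le> z" "0 < z"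
  shows "(z + 1) ^ k \<le> 2 * z ^ k"
proof -
  have "1 / 2 \<le> 1 + real k * (- 1 / (real z + 1))" using assms by (simp add: field_simps)
  also have "\<dots> \<le> (1 + (- 1 / (real z + 1))) ^ k" by (rule Bernoulli_inequality) simp
  also have "1 + (- 1 / (real z + 1)) = real z / (real z + 1)" by (simp add: field_simps)
  finally have "(real z + 1) ^ k \<le> 2 * real z ^ k" by (simp add: power_divide field_simps)
  then have "real ((z + 1) ^ k) \<le> real (2 * z ^ k)" by (simp add: add.commute)
  then show ?thesis by (simp only: of_nat_le_iff)
qed

text \<open>Budget in multiples of \<epsilon> * m^2: the enlarged interval costs 1/2, the set K1
  costs 1 and the remaining errors 1/2, which gives the lower end 2. The coarse steps reach 7/2
  beyond the minimal sum and lose at most 1/2 to errors, which gives the upper end 3.\<close>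

lemma eventually_window:
  fixes \<alpha> \<epsilon> :: real and t :: nat
  assumes \<alpha>: "0 < \<alpha>" and t: "0 < t" "real t * \<alpha> \<in> \<int>" and \<epsilon>: "0 < \<epsilon>" "\<epsilon> \<le> 1 / 4" "\<epsilon> \<le> \<alpha>"
  shows "\<exists>m0. \<forall>m\<ge>m0. \<forall>n. ((exp (2 * \<alpha>) - 1) / 2 + 2 * \<epsilon>) * (real m)\<^sup>2 \<le> real n \<longrightarrow>
     real n \<le> ((exp (2 * \<alpha>) - 1) / 2 + 3 * \<epsilon>) * (real m)\<^sup>2 \<longrightarrow>
     (\<exists>A. finite A \<and> (\<forall>a\<in>A. m \<le> a) \<and> recip_sum A = \<alpha> \<and> \<Sum>A = n)"
proof -
  \<comment> \<open>The interval is longer than exp \<alpha> * m by the factor 1 + \<eta>. Its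
    surplus ln (1 + \<eta>) of reciprocal mass pays for the numbers that are not nice, and \<eta> is
    so small that P^2 grows by at most \<epsilon>.\<close>
  define \<eta> where "\<eta> = min 1 (\<epsilon> / (4 * exp (2 * \<alpha>)))"
  have \<eta>: "0 < \<eta>" "\<eta> \<le> 1" "\<eta> \<le> \<epsilon> / (4 * exp (2 * \<alpha>))" unfolding \<eta>_def using \<epsilon> by auto
  define P where "P = (1 + \<eta>) * exp \<alpha>"
  have P1: "1 < P"
  proof -
    have "1 * 1 < (1 + \<eta>) * exp \<alpha>" using \<eta> \<alpha> by (intro mult_strict_mono) auto
    then show ?thesis unfolding P_def by simp
  qed
  have P2: "(P\<^sup>2 - 1) / 2 \<le> (exp (2 * \<alpha>) - 1) / 2 + \<epsilon> / 2"
  proof -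
    have "(1 + \<eta>)\<^sup>2 \<le> 1 + 3 * \<eta>" using \<eta> by (simp add: power2_eq_square algebra_simps mult_left_le)
    then have "P\<^sup>2 \<le> (1 + 3 * \<eta>) * exp (2 * \<alpha>)" unfolding P_def power_mult_distrib exp_double
      by (intro mult_right_mono) auto
    also have "\<dots> = exp (2 * \<alpha>) + 3 * (\<eta> * exp (2 * \<alpha>))" by (simp add: algebra_simps)
    finally have "P\<^sup>2 \<le> exp (2 * \<alpha>) + 3 * (\<eta> * exp (2 * \<alpha>))" .
    moreover have "\<eta> * exp (2 * \<alpha>) \<le> \<epsilon> / (4 * exp (2 * \<alpha>)) * exp (2 * \<alpha>)" using \<eta>(3) by (intro mult_right_mono) auto
    then have "\<eta> * exp (2 * \<alpha>) \<le> \<epsilon> / 4" by simp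
    ultimately show ?thesis using \<epsilon>(1) by argo
  qed
  define C0 where "C0 = nat \<lceil>P\<rceil> + 1"
  have C0: "P + 1 \<le> real C0" unfolding C0_def by linarith
  \<comment> \<open>X \<le> C0 * m and m \<le> 2 * z ^ (3 * d), so 100000 * X \<le> C * z ^ (3 *
    d).\<close>
  define C where "C = 200000 * C0"
  have Cpos: "0 < C" unfolding C_def C0_def by simp
  \<comment> \<open>The second bound fits the surplus just described; 1 / 16 yields 16 * b \<le> X,
    which leaves enough nice numbers for the toggles.\<close>
  define \<theta> where "\<theta> = min (1 / 16) (ln (1 + \<eta>))"
  have \<theta>: "0 < \<theta>" "\<theta> \<le> 1 / 16" "\<theta> \<le> ln (1 + \<eta>)" unfolding \<theta>_def using \<eta> by auto
  obtain D0 where D0: "\<forall>D\<ge>D0. \<exists>z0. \<forall>z\<ge>z0. \<forall>x \<le> C * z ^ D.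
     real (card {a\<in>{1..x}. \<not> nice (z ^ (D - 5)) a}) \<le> \<theta> * real z ^ D"
    using eventually_few_non_nice[OF Cpos \<theta>(1)] by (rule exE)
  define d where "d = max 7 D0"
  have d: "7 \<le> d" "0 < d" "D0 \<le> 3 * d" unfolding d_def by auto
  obtain z1 where z1: "\<forall>z\<ge>z1. \<forall>x \<le> C * z ^ (3 * d).
     real (card {a\<in>{1..x}. \<not> nice (z ^ (3 * d - 5)) a}) \<le> \<theta> * real z ^ (3 * d)"
    using D0[rule_format, OF d(3)] by (rule exE)
  obtain z2 where z2: "\<forall>z\<ge>z2. \<forall>p. prime p \<longrightarrow> odd p \<longrightarrow> p \<le> z ^ (3 * d) \<longrightarrow> covers p z"
    using eventually_covers[of "3 * d"] by (rule exE)
  obtain z3 where z3: "\<forall>z\<ge>z3. \<forall>N. z ^ (3 * d) \<le> N \<longrightarrow> N \<le> C * z ^ (3 * d) \<longrightarrow>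
     (\<exists>F\<subseteq>{N..2 * N}. (\<forall>a\<in>F. nice (z ^ d) a) \<and> 4 / real z \<le> recip_sum F)"
    using smooth_reservoir[OF d(2) Cpos] by (rule exE)
  have "\<forall>\<^sub>F z :: real in at_top. ln (32 * real C) + real (3 * d) * ln z < (z + 1) * ln 2"
    by real_asymp
  then obtain z4 :: real where z4: "\<And>z. z4 \<le> z \<Longrightarrow> ln (32 * real C) + real (3 * d) * ln z < (z + 1) * ln 2"
    unfolding eventually_at_top_linorder by blast
  \<comment> \<open>All errors are bounded by multiples of q = m^2 / z. Kl and Ku add up the
    coefficients for the two ends of the window, and a large z makes each total at most \<epsilon> /
    2 * m^2.\<close>
  define Kl where "Kl = (3 * P + 3) / 2 + 174528 * real C0 + real (8 * C\<^sup>2 + 4 * C + 12)"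
  define Ku where "Ku = exp \<alpha> + exp (2 * \<alpha>) + 14 * real C0"
  define Z0 where "Z0 = (2 * C + 24 + 6 * d + t + nat \<lceil>4 / \<alpha>\<rceil> + nat \<lceil>2 * Kl / \<epsilon>\<rceil> + nat \<lceil>2 * Ku / \<epsilon>\<rceil>)"
  define k4 where "k4 = nat \<lceil>z4\<rceil>"
  define Z where "Z = max (max (max z1 z2) (max z3 k4)) Z0"
  have Z: "z1 \<le> Z" "z2 \<le> Z" "z3 \<le> Z" "k4 \<le> Z" "Z0 \<le> Z" unfolding Z_def by simp_all
  show ?thesis
  proof (intro exI[of _ "Z ^ (3 * d)"] allI impI)
    fix m n :: nat
    assume mZ: "Z ^ (3 * d) \<le> m"
      and n1: "((exp (2 * \<alpha>) - 1) / 2 + 2 * \<epsilon>) * (real m)\<^sup>2 \<le> real n"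
      and n2: "real n \<le> ((exp (2 * \<alpha>) - 1) / 2 + 3 * \<epsilon>) * (real m)\<^sup>2"
    obtain z where z: "z ^ (3 * d) \<le> m" "m < (z + 1) ^ (3 * d)" using power_bracket[of "3 * d" m] d by auto
    have "Z \<le> z"
    proof (rule ccontr)
      assume "\<not> Z \<le> z"
      then have "(z + 1) ^ (3 * d) \<le> Z ^ (3 * d)" by (intro power_mono) auto
      then show False using z(2) mZ by linarith
    qed
    then have "Z0 \<le> z" using Z(5) by linarith
    then have zz: "z1 \<le> z" "z2 \<le> z" "z3 \<le> z" "z4 \<le> real z" "2 * C + 24 \<le> z" "6 * d \<le> z" "t \<le> z"
      "4 / \<alpha> \<le> real z" "2 * Kl / \<epsilon> \<le> real z" "2 * Ku / \<epsilon> \<le> real z" using Z(1-4) \<open>Z \<le> z\<close> unfolding Z0_def k4_def by linarith+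
    have z0: "24 \<le> z" using zz(5) by linarith
    have m2: "m \<le> 2 * z ^ (3 * d)" using Suc_power_le_double[of "3 * d" z] z(2) zz(6) z0 by linarith
    have "z ^ 2 \<le> z ^ (3 * d)" using d z0 by (intro power_increasing) auto
    then have zzm: "z ^ 2 \<le> m" using z(1) by linarith
    have "z * 1 \<le> z ^ 2" unfolding power2_eq_square using z0 by (intro mult_left_mono) auto
    then have zm: "z \<le> m" using zzm by linarith
    have m0: "0 < m" using zm z0 by linarith
    define X where "X = nat \<lceil>P * real m\<rceil>"
    have X: "P * real m \<le> real X" "real X \<le> P * real m + 1"
    proof -
      have "0 \<le> P * real m" using P1 by simp
      then show "P * real m \<le> real X" "real X \<le> P * real m + 1" unfolding X_def by linarith+
    qed
    have XC0: "real X \<le> real C0 * real m"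
    proof -
      have "P * real m + 1 \<le> (P + 1) * real m" using m0 by (simp add: distrib_right)
      also have "\<dots> \<le> real C0 * real m" using C0 by (intro mult_right_mono) auto
      finally show ?thesis using X by linarith
    qed
    then have "real X \<le> real (C0 * m)" by simp
    then have XC0': "X \<le> C0 * m" by (simp only: of_nat_le_iff)
    have "C0 * m \<le> C0 * (2 * z ^ (3 * d))" using m2 by (rule mult_left_mono) simp
    then have XC: "100000 * X \<le> C * z ^ (3 * d)" unfolding C_def using XC0' by linarith
    have mX: "m \<le> X"
    proof -
      have "1 * real m \<le> P * real m" using P1 by (intro mult_right_mono) auto
      then have "real m \<le> real X" using X by linarith
      then show ?thesis by simp
    qed
    define b where "b = card {a\<in>{1..3232 * X}. \<not> nice (z ^ (3 * d - 5)) a}"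
    have "real b \<le> \<theta> * real z ^ (3 * d)" unfolding b_def using XC by (intro z1[rule_format, OF zz(1)]) linarith
    also have "\<dots> \<le> \<theta> * real m"
    proof -
      have "real (z ^ (3 * d)) \<le> real m" using z(1) by (simp only: of_nat_le_iff)
      then show ?thesis using \<theta>(1) by (intro mult_left_mono) auto
    qed
    finally have b\<theta>: "real b \<le> \<theta> * real m" .
    obtain e where e: "2 ^ e \<le> 4 * z ^ (4 * d + 4)" "4 * z ^ (4 * d + 4) < 2 ^ (e + 1)"
      using ex_power_ivl1[of 2 "4 * z ^ (4 * d + 4)"] z0 by (auto simp: Suc_le_eq)
    have err: "real m \<le> (real m)\<^sup>2 / real z" "real z * real X \<le> real C0 * ((real m)\<^sup>2 / real z)"
    proof -
      have "real m * real z \<le> (real m)\<^sup>2" unfolding power2_eq_square using zm by (intro mult_left_mono) auto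
      then show "real m \<le> (real m)\<^sup>2 / real z" using z0 by (subst pos_le_divide_eq) auto
      have "real (z ^ 2) \<le> real m" using zzm by (simp only: of_nat_le_iff)
      then have "real z * real z \<le> real m" by (simp add: power2_eq_square)
      then have "(real z * real z) * real m \<le> real m * real m" by (rule mult_right_mono) simp
      then have "real z * real m \<le> (real m)\<^sup>2 / real z" using z0
        by (subst pos_le_divide_eq) (auto simp: power2_eq_square mult_ac)
      then have "real C0 * (real z * real m) \<le> real C0 * ((real m)\<^sup>2 / real z)" by (rule mult_left_mono) simp
      moreover have "real z * real X \<le> real z * (real C0 * real m)" using XC0 by (rule mult_left_mono) simp
      ultimately show "real z * real X \<le> real C0 * ((real m)\<^sup>2 / real z)" by (simp add: mult_ac)
    qed
    define q where "q = (real m)\<^sup>2 / real z"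
    have q0: "0 \<le> q" unfolding q_def by simp
    have small: "K * q \<le> \<epsilon> / 2 * (real m)\<^sup>2" if "2 * K / \<epsilon> \<le> real z" for K
    proof -
      have "K \<le> \<epsilon> / 2 * real z" using that \<epsilon>(1) by (simp add: field_simps)
      then have "K * q \<le> \<epsilon> / 2 * real z * q" using q0 by (rule mult_right_mono)
      also have "\<dots> = \<epsilon> / 2 * (real m)\<^sup>2" unfolding q_def using z0 by simp
      finally show ?thesis .
    qed
    show "\<exists>A. finite A \<and> (\<forall>a\<in>A. m \<le> a) \<and> recip_sum A = \<alpha> \<and> \<Sum>A = n"
    proof (rule window_core[OF d(1) zz(5) \<epsilon>(1,2) _ z(1) m2 mX XC])
      have "2 / real z \<le> \<alpha> / 2"
      proof -
        have "4 \<le> \<alpha> * real z" using zz(8) \<alpha> by (simp add: field_simps)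
        then show ?thesis using z0 by (simp add: field_simps)
      qed
      then show "\<epsilon> / 4 + 2 / real z \<le> \<alpha>" using \<epsilon>(3) \<alpha> by linarith
      show "32 * X < 2 ^ (z + 1)"
      proof -
        have "32 * X \<le> 32 * C * z ^ (3 * d)" using XC by linarith
        then have le: "real (32 * X) \<le> real (32 * C * z ^ (3 * d))" by (simp only: of_nat_le_iff)
        have "ln (real (32 * C * z ^ (3 * d))) = ln (32 * real C) + real (3 * d) * ln (real z)"
          using Cpos z0 by (simp add: ln_mult ln_realpow)
        also have "\<dots> < (real z + 1) * ln 2" by (rule z4[OF zz(4)])
        also have "\<dots> = ln (2 ^ (z + 1))" by (subst ln_realpow) (simp_all add: add.commute)
        finally have "real (32 * C * z ^ (3 * d)) < 2 ^ (z + 1)" using Cpos z0 by (subst (asm) ln_less_cancel_iff) auto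
        then have "real (32 * X) < real (2 ^ (z + 1))" using le by simp
        then show ?thesis by (simp only: of_nat_less_iff)
      qed
      show "real b / real m \<le> ln ((real X + 1) / real m) - \<alpha>"
      proof -
        have "real b / real m \<le> \<theta>" using b\<theta> m0 by (simp add: field_simps)
        moreover have "P \<le> (real X + 1) / real m" using X(1) m0 by (simp add: field_simps)
        then have "ln P \<le> ln ((real X + 1) / real m)" using P1 by (intro ln_mono) auto
        moreover have "ln P = ln (1 + \<eta>) + \<alpha>" unfolding P_def using \<eta> by (simp add: ln_mult)
        ultimately show ?thesis using \<theta>(3) by linarith
      qed
      show "card {a\<in>{1..3232 * X}. \<not> nice (z ^ (3 * d - 5)) a} \<le> b" unfolding b_def by simp
      show "16 * b \<le> X"
      proof -
        have "\<theta> * real m \<le> 1 / 16 * real m" using \<theta>(2) by (rule mult_right_mono) simp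
        then have "16 * real b \<le> real m" using b\<theta> by linarith
        then show ?thesis using mX by linarith
      qed
      show "covers p z" if "prime p" "odd p" "p \<le> z ^ (3 * d)" for p using z2 zz(2) that by blast
      show "\<exists>F\<subseteq>{N..2 * N}. (\<forall>a\<in>F. nice (z ^ d) a) \<and> 4 / real z \<le> recip_sum F"
        if "z ^ (3 * d) \<le> N" "N \<le> C * z ^ (3 * d)" for N
        using z3[rule_format, OF zz(3) that] .
      show "2 ^ e \<le> 4 * z ^ (4 * d + 4)" by (rule e(1))
      show "2 * z ^ (4 * d + 4) \<le> 2 ^ e" using e(2) by simp
      show "denom_smooth e (z ^ (3 * d - 4)) \<alpha>"
      proof -
        have "z ^ 1 \<le> z ^ (3 * d - 4)" using d z0 by (intro power_increasing) auto
        then have ty: "t \<le> z ^ (3 * d - 4)" using zz(7) by simp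
        have "z ^ (3 * d - 4) \<le> z ^ (4 * d + 4)" using z0 by (intro power_increasing) auto
        then have te: "t \<le> 2 ^ e" using ty e(2) by simp
        have "smooth (z ^ (3 * d - 4)) t" unfolding smooth_def using ty t(1) by (meson dvd_imp_le le_trans)
        then have "t dvd 2 ^ e * odd_lcm (z ^ (3 * d - 4))" using t(1) te by (rule smooth_dvd)
        then obtain c where c: "2 ^ e * odd_lcm (z ^ (3 * d - 4)) = t * c" by (rule dvdE)
        have "2 ^ e * real (odd_lcm (z ^ (3 * d - 4))) = real (2 ^ e * odd_lcm (z ^ (3 * d - 4)))" by simp
        also have "\<dots> = real t * real c" unfolding c by simp
        finally have "2 ^ e * real (odd_lcm (z ^ (3 * d - 4))) * \<alpha> = real c * (real t * \<alpha>)" by (simp add: mult_ac)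
        then show ?thesis unfolding denom_smooth_def using t(2) by (simp only: Ints_mult Ints_of_nat)
      qed
      show "(real X * (real X + 1) - real m * (real m - 1)) / 2 + \<epsilon> * (real m)\<^sup>2
        + 174528 * real z * real X + real (8 * C\<^sup>2 + 4 * C + 12) * (real m)\<^sup>2 / real z \<le> real n"
      proof -
        have "real X * (real X + 1) \<le> (P * real m + 1) * (P * real m + 2)" using X(2) by (intro mult_mono) auto
        also have "\<dots> = P\<^sup>2 * (real m)\<^sup>2 + 3 * P * real m + 2" by (simp add: power2_eq_square algebra_simps)
        finally have "(real X * (real X + 1) - real m * (real m - 1)) / 2
            \<le> (P\<^sup>2 - 1) / 2 * (real m)\<^sup>2 + (3 * P * real m + 2 + real m) / 2"
          by (simp add: power2_eq_square algebra_simps diff_divide_distrib add_divide_distrib)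
        also have "(P\<^sup>2 - 1) / 2 * (real m)\<^sup>2 \<le> ((exp (2 * \<alpha>) - 1) / 2 + \<epsilon> / 2) * (real m)\<^sup>2"
          using P2 by (rule mult_right_mono) simp
        also have "(3 * P * real m + 2 + real m) / 2 \<le> (3 * P + 3) / 2 * real m"
        proof -
          have "2 \<le> 2 * real m" using m0 by simp
          then show ?thesis by (simp add: algebra_simps add_divide_distrib)
        qed
        also have "(3 * P + 3) / 2 * real m \<le> (3 * P + 3) / 2 * q"
          unfolding q_def using err(1) P1 by (intro mult_left_mono) auto
        finally have 1: "(real X * (real X + 1) - real m * (real m - 1)) / 2
            \<le> ((exp (2 * \<alpha>) - 1) / 2 + \<epsilon> / 2) * (real m)\<^sup>2 + (3 * P + 3) / 2 * q" by simp
        have 2: "174528 * real z * real X \<le> 174528 * real C0 * q" using err(2) unfolding q_def by simp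
        have 3: "real (8 * C\<^sup>2 + 4 * C + 12) * (real m)\<^sup>2 / real z = real (8 * C\<^sup>2 + 4 * C + 12) * q"
          unfolding q_def by simp
        have "Kl * q = (3 * P + 3) / 2 * q + 174528 * real C0 * q + real (8 * C\<^sup>2 + 4 * C + 12) * q"
          unfolding Kl_def by (simp only: distrib_right)
        then have 4: "(3 * P + 3) / 2 * q + 174528 * real C0 * q + real (8 * C\<^sup>2 + 4 * C + 12) * q \<le> \<epsilon> / 2 * (real m)\<^sup>2"
          using small[OF zz(9)] by simp
        have "((exp (2 * \<alpha>) - 1) / 2 + \<epsilon> / 2) * (real m)\<^sup>2 + \<epsilon> * (real m)\<^sup>2 + \<epsilon> / 2 * (real m)\<^sup>2
           = ((exp (2 * \<alpha>) - 1) / 2 + 2 * \<epsilon>) * (real m)\<^sup>2" by (simp add: algebra_simps)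
        then show ?thesis using 1 2 3 4 n1 by linarith
      qed
      show "real n \<le> (exp (2 * \<alpha>) - 1) / 2 * (real m)\<^sup>2 - (exp \<alpha> + exp (2 * \<alpha>)) * real m
        + 7 * (\<epsilon> * (real m)\<^sup>2 / 2 - 2 * real X)"
      proof -
        have "Ku * real m \<le> Ku * q" unfolding q_def Ku_def using err(1) by (intro mult_left_mono add_nonneg_nonneg) auto
        also have "\<dots> \<le> \<epsilon> / 2 * (real m)\<^sup>2" by (rule small[OF zz(10)])
        finally have 1: "Ku * real m \<le> \<epsilon> / 2 * (real m)\<^sup>2" .
        have "Ku * real m = (exp \<alpha> + exp (2 * \<alpha>)) * real m + 14 * (real C0 * real m)"
          unfolding Ku_def by (simp add: algebra_simps)
        then have "(exp \<alpha> + exp (2 * \<alpha>)) * real m + 14 * real X \<le> \<epsilon> / 2 * (real m)\<^sup>2" using 1 XC0 by linarith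
        moreover have "((exp (2 * \<alpha>) - 1) / 2 + 3 * \<epsilon>) * (real m)\<^sup>2
           = (exp (2 * \<alpha>) - 1) / 2 * (real m)\<^sup>2 + 7 * (\<epsilon> * (real m)\<^sup>2 / 2) - \<epsilon> / 2 * (real m)\<^sup>2"
          by (simp add: algebra_simps)
        ultimately show ?thesis using n2 by argo
      qed
    qed
  qed
qed

section \<open>The threshold\<close>

lemma of_rat_sum_inverse: "real_of_rat (\<Sum>a\<in>A. 1 / of_nat a) = recip_sum A"
  unfolding recip_sum_def by (simp add: of_rat_sum of_rat_divide)

lemma is_partition_iff:
  "is_partition \<alpha> n A \<longleftrightarrow> finite A \<and> (\<forall>a\<in>A. 0 < a) \<and> \<Sum>A = n \<and> recip_sum A = of_rat \<alpha>"
  unfolding is_partition_def of_rat_sum_inverse[symmetric] of_rat_eq_iff ..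

lemma eventually_partition:
  fixes \<alpha> :: rat and \<epsilon> :: real
  assumes \<alpha>: "0 < \<alpha>" and \<epsilon>: "0 < \<epsilon>" "\<epsilon> \<le> 1 / 4" "\<epsilon> \<le> of_rat \<alpha>"
  shows "\<exists>m0. \<forall>m\<ge>m0. \<forall>n. ((exp (2 * of_rat \<alpha>) - 1) / 2 + 2 * \<epsilon>) * (real m)\<^sup>2 \<le> real n \<longrightarrow>
     (\<exists>A. is_partition \<alpha> n A \<and> is_large m A)"
proof -
  define \<beta> where "\<beta> = real_of_rat \<alpha>"
  define c where "c = (exp (2 * \<beta>) - 1) / 2"
  have \<beta>0: "0 < \<beta>" unfolding \<beta>_def using \<alpha> by simp
  have c0: "0 < c" unfolding c_def using \<beta>0 by simp
  obtain p q where pq: "quotient_of \<alpha> = (p, q)" by (cases "quotient_of \<alpha>")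
  have q0: "0 < q" using quotient_of_denom_pos[OF pq] .
  have "\<alpha> = of_int p / of_int q" using quotient_of_div[OF pq] .
  then have "\<beta> = of_int p / of_int q" unfolding \<beta>_def by (simp add: of_rat_divide)
  then have "real (nat q) * \<beta> = of_int p" using q0 by simp
  then have t: "0 < nat q" "real (nat q) * \<beta> \<in> \<int>" using q0 by auto
  obtain m1 where m1: "\<forall>m\<ge>m1. \<forall>n. (c + 2 * \<epsilon>) * (real m)\<^sup>2 \<le> real n \<longrightarrow>
     real n \<le> (c + 3 * \<epsilon>) * (real m)\<^sup>2 \<longrightarrow>
     (\<exists>A. finite A \<and> (\<forall>a\<in>A. m \<le> a) \<and> recip_sum A = \<beta> \<and> \<Sum>A = n)"
    using eventually_window[OF \<beta>0 t \<epsilon>(1,2), folded c_def] \<epsilon>(3) unfolding \<beta>_def by blast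
  \<comment> \<open>Windows of consecutive m overlap once m is large, because the ratio ((x + 1) /
    x)^2 tends to 1.\<close>
  have "\<forall>\<^sub>F x :: real in at_top. (c + 2 * \<epsilon>) * (x + 1)\<^sup>2 \<le> (c + 3 * \<epsilon>) * x\<^sup>2"
    using \<epsilon>(1) c0 by real_asymp
  then obtain x0 :: real where x0: "\<And>x. x0 \<le> x \<Longrightarrow> (c + 2 * \<epsilon>) * (x + 1)\<^sup>2 \<le> (c + 3 * \<epsilon>) * x\<^sup>2"
    unfolding eventually_at_top_linorder by blast
  have "\<exists>A. is_partition \<alpha> n A \<and> is_large m A"
    if m: "m1 + nat \<lceil>x0\<rceil> + 1 \<le> m" and n: "(c + 2 * \<epsilon>) * (real m)\<^sup>2 \<le> real n" for m n
  proof -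
    \<comment> \<open>The first w whose window begins above n; its predecessor m' is at least m, and
      its window contains n by the overlap.\<close>
    define w where "w = (LEAST w. real n < (c + 2 * \<epsilon>) * (real w)\<^sup>2)"
    have ce: "0 < c + 2 * \<epsilon>" using c0 \<epsilon> by simp
    obtain k :: nat where k: "real n / (c + 2 * \<epsilon>) + 1 < real k" using reals_Archimedean2 by blast
    have k1: "1 \<le> real k" using k ce by (smt (verit) divide_nonneg_pos of_nat_0_le_iff)
    have "real n / (c + 2 * \<epsilon>) < real k * 1" using k by simp
    also have "\<dots> \<le> real k * real k" using k1 by (intro mult_left_mono) auto
    finally have "real n < (c + 2 * \<epsilon>) * (real k)\<^sup>2" using ce by (simp add: field_simps power2_eq_square)
    then have w: "real n < (c + 2 * \<epsilon>) * (real w)\<^sup>2" unfolding w_def by (rule LeastI)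
    have "m < w"
    proof (rule ccontr)
      assume "\<not> m < w"
      then have "(real w)\<^sup>2 \<le> (real m)\<^sup>2" by (intro power_mono) auto
      then have "(c + 2 * \<epsilon>) * (real w)\<^sup>2 \<le> (c + 2 * \<epsilon>) * (real m)\<^sup>2" using ce by (intro mult_left_mono) auto
      then show False using w n by linarith
    qed
    then obtain m' where m': "w = Suc m'" "m \<le> m'" by (cases w) auto
    have lo: "(c + 2 * \<epsilon>) * (real m')\<^sup>2 \<le> real n"
      using not_less_Least[of m' "\<lambda>w. real n < (c + 2 * \<epsilon>) * (real w)\<^sup>2"] m'(1) unfolding w_def by simp
    have "x0 \<le> real m'" using m m'(2) by linarith
    then have hi: "real n \<le> (c + 3 * \<epsilon>) * (real m')\<^sup>2" using x0[of "real m'"] w m'(1) by (simp add: add.commute)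
    have "m1 \<le> m'" using m m'(2) by linarith
    then obtain A where A: "finite A" "\<forall>a\<in>A. m' \<le> a" "recip_sum A = \<beta>" "\<Sum>A = n"
      using m1 lo hi by blast
    have "is_partition \<alpha> n A" unfolding is_partition_iff using A m m'(2) unfolding \<beta>_def by fastforce
    moreover have "is_large m A" unfolding is_large_def using A(2) m'(2) by fastforce
    ultimately show ?thesis by blast
  qed
  then show ?thesis unfolding c_def \<beta>_def by blast
qed

lemma partition_threshold_tendsto:
  fixes \<alpha> :: rat
  assumes \<alpha>: "0 < \<alpha>"
  shows "(\<lambda>m. real (partition_threshold \<alpha> m) / (real m)\<^sup>2) \<longlonglongrightarrow> (exp (2 * of_rat \<alpha>) - 1) / 2"
proof (rule LIMSEQ_I)
  fix \<delta> :: real assume \<delta>: "0 < \<delta>"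
  define \<beta> where "\<beta> = real_of_rat \<alpha>"
  define c where "c = (exp (2 * \<beta>) - 1) / 2"
  define K where "K = exp \<beta> + exp (2 * \<beta>)"
  have \<beta>0: "0 < \<beta>" unfolding \<beta>_def using \<alpha> by simp
  have c0: "0 < c" unfolding c_def using \<beta>0 by simp
  define \<epsilon> where "\<epsilon> = min (min (1 / 4) \<beta>) (\<delta> / 4)"
  have \<epsilon>: "0 < \<epsilon>" "\<epsilon> \<le> 1 / 4" "\<epsilon> \<le> \<beta>" "\<epsilon> \<le> \<delta> / 4" unfolding \<epsilon>_def using \<delta> \<beta>0 by auto
  obtain m0 where m0: "\<forall>m\<ge>m0. \<forall>n. (c + 2 * \<epsilon>) * (real m)\<^sup>2 \<le> real n \<longrightarrow>
     (\<exists>A. is_partition \<alpha> n A \<and> is_large m A)"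
    using eventually_partition[OF \<alpha> \<epsilon>(1,2) \<epsilon>(3)[unfolded \<beta>_def]] unfolding c_def \<beta>_def by blast
  have "norm (real (partition_threshold \<alpha> m) / (real m)\<^sup>2 - (exp (2 * of_rat \<alpha>) - 1) / 2) < \<delta>"
    if m: "m0 + 1 + nat \<lceil>8 / \<delta>\<rceil> + nat \<lceil>2 * K / \<delta>\<rceil> \<le> m" for m
  proof -
    have mm: "m0 \<le> m" "1 \<le> m" "8 / \<delta> \<le> real m" "2 * K / \<delta> \<le> real m" using m by linarith+
    have mpos: "0 < real m" using mm(2) by simp
    let ?P = "\<lambda>N. 0 < N \<and> (\<forall>n\<ge>N. \<exists>A. is_partition \<alpha> n A \<and> is_large m A)"
    define N where "N = nat \<lceil>(c + 2 * \<epsilon>) * (real m)\<^sup>2\<rceil> + 1"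
    have Nl: "(c + 2 * \<epsilon>) * (real m)\<^sup>2 \<le> real N" unfolding N_def by linarith
    have "0 \<le> (c + 2 * \<epsilon>) * (real m)\<^sup>2" using c0 \<epsilon> by (intro mult_nonneg_nonneg) auto
    then have Nu: "real N \<le> (c + 2 * \<epsilon>) * (real m)\<^sup>2 + 2" unfolding N_def by linarith
    have "\<exists>A. is_partition \<alpha> n A \<and> is_large m A" if "N \<le> n" for n
    proof -
      have "(c + 2 * \<epsilon>) * (real m)\<^sup>2 \<le> real n" using Nl that by linarith
      then show ?thesis using m0 mm(1) by blast
    qed
    then have PN: "?P N" unfolding N_def by auto
    define T where "T = partition_threshold \<alpha> m"
    have T: "T = (LEAST N. ?P N)" unfolding T_def partition_threshold_def ..
    have TN: "T \<le> N" unfolding T by (rule Least_le[where P = ?P, OF PN])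
    \<comment> \<open>N is a valid threshold, so the least one is attained. It satisfies its own
      condition at n = T, which supplies a partition of T for
      \<open>sum_lower_bound\<close>.\<close>
    have "?P T" unfolding T by (rule LeastI[where P = ?P, OF PN])
    then obtain A where A: "is_partition \<alpha> T A" "is_large m A" by blast
    have "c * (real m)\<^sup>2 - K * real m \<le> real (\<Sum>A)" unfolding c_def K_def
      using A mm(2) unfolding is_partition_iff is_large_def \<beta>_def by (intro sum_lower_bound) auto
    then have Tl: "c * (real m)\<^sup>2 - K * real m \<le> real T" using A(1) unfolding is_partition_iff by simp
    have "real T \<le> (c + 2 * \<epsilon>) * (real m)\<^sup>2 + 2" using TN Nu by linarith
    then have "real T / (real m)\<^sup>2 \<le> ((c + 2 * \<epsilon>) * (real m)\<^sup>2 + 2) / (real m)\<^sup>2" by (rule divide_right_mono) simp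
    also have "\<dots> = c + 2 * \<epsilon> + 2 / (real m)\<^sup>2" using mpos by (simp add: add_divide_distrib)
    also have "2 / (real m)\<^sup>2 \<le> 2 / real m"
      using mm(2) by (intro divide_left_mono) (auto simp: power2_eq_square mult_le_cancel_left1)
    also have "2 / real m \<le> \<delta> / 4" using mm(3) \<delta> mpos by (simp add: field_simps)
    finally have up: "real T / (real m)\<^sup>2 \<le> c + 2 * \<epsilon> + \<delta> / 4" by simp
    have "(c * (real m)\<^sup>2 - K * real m) / (real m)\<^sup>2 \<le> real T / (real m)\<^sup>2" using Tl by (rule divide_right_mono) simp
    moreover have "(c * (real m)\<^sup>2 - K * real m) / (real m)\<^sup>2 = c - K / real m"
      using mpos by (simp add: diff_divide_distrib power2_eq_square)
    moreover have "K / real m \<le> \<delta> / 2" using mm(4) \<delta> mpos by (simp add: field_simps)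
    ultimately have "c - \<delta> / 2 \<le> real T / (real m)\<^sup>2" by linarith
    then have "\<bar>real T / (real m)\<^sup>2 - c\<bar> < \<delta>" using up \<epsilon>(4) \<delta> by linarith
    then show ?thesis unfolding T_def c_def \<beta>_def by simp
  qed
  then show "\<exists>no. \<forall>n\<ge>no. norm (real (partition_threshold \<alpha> n) / (real n)\<^sup>2 - (exp (2 * of_rat \<alpha>) - 1) / 2) < \<delta>"
    by blast
qed

theorem theorem3:
  fixes \<alpha> :: rat
  assumes "\<alpha> > 0"
  shows "\<exists>\<epsilon> :: nat \<Rightarrow> real. \<epsilon> \<longlonglongrightarrow> 0 \<and>
    (\<forall>m\<ge>1. real (partition_threshold \<alpha> m)
       = (1 / 2 + \<epsilon> m) * (exp (2 * of_rat \<alpha>) - 1) * (real m)\<^sup>2)"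
proof -
  define c :: real where "c = exp (2 * of_rat \<alpha>) - 1"
  have c0: "0 < c" unfolding c_def using assms by simp
  \<comment> \<open>Obtained by solving the desired equation, so the content lies in the
    limit.\<close>
  define \<epsilon> where "\<epsilon> m = real (partition_threshold \<alpha> m) / (real m)\<^sup>2 / c - 1 / 2" for m
  have "\<epsilon> \<longlonglongrightarrow> c / 2 / c - 1 / 2" unfolding \<epsilon>_def
    using partition_threshold_tendsto[OF assms, folded c_def] c0
    by (intro tendsto_diff tendsto_divide[of _ "c / 2"] tendsto_const) simp_all
  then have "\<epsilon> \<longlonglongrightarrow> 0" using c0 by simp
  moreover have "real (partition_threshold \<alpha> m) = (1 / 2 + \<epsilon> m) * c * (real m)\<^sup>2" if "1 \<le> m" for m
    unfolding \<epsilon>_def using that c0 by simp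
  ultimately show ?thesis unfolding c_def by blast
qed

end
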